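(* Let $n\ge3$. The group $C_n$ is generated by the elements $\alpha_1,\alpha,\sigma_1,\sigma$, where $$\sigma=\sigma_1\sigma_2\cdots\sigma_{n-1},\qquad \alpha=\alpha_{n-1}\alpha_{n-2}\cdots\alpha_1,$$ with the following defining relations: $$\sigma^n=(\sigma\sigma_1)^{n-1},\quad \sigma_1(\sigma^{-j}\sigma_1\sigma^j)=(\sigma^{-j}\sigma_1\sigma^j)\sigma_1,\quad 2\le j\le n/2;$$ $$\alpha_1^2=1,\quad \alpha^n=(\alpha_1\alpha)^{n-1},\quad \alpha_1(\alpha^{-j}\alpha_1\alpha^j)=(\alpha^{-j}\alpha_1\alpha^j)\alpha_1,\quad 2\le j\le n/2;$$ $$\alpha^{-i}\alpha_1\alpha^i\,\sigma^j\sigma_1\sigma^{-j}=\sigma^j\sigma_1\sigma^{-j}\,\alpha^{-i}\alpha_1\alpha^i,\quad 0\le i,j\le n-2,\ |i-j|\ge2;$$ $$\sigma^{i-1}\sigma_1\sigma^{-(i-1)}\alpha^{-i}\alpha_1\alpha\alpha_1\alpha^{i-1}=\alpha^{-i}\alpha_1\alpha\alpha_1\alpha^{i-1}\sigma^i\sigma_1\sigma^{-i},\quad 1\le i\le n-2;$$ $$\sigma^{i-1}\sigma_1\sigma\sigma_1\sigma^{-i}\alpha^{-(i-1)}\alpha_1\alpha^{i-1}=\alpha^{-i}\alpha_1\alpha^i\sigma^{i-1}\sigma_1\sigma\sigma_1\sigma^{-i},\quad 1\le i\le n-2.$$ The generators $\sigma_1,\dots,\sigma_{n-1},\alpha_1,\dots,\alpha_{n-1}$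 of $C_n$ are recovered by $$\sigma_{i+1}=\sigma^i\sigma_1\sigma^{-i},\qquad \alpha_{i+1}=\alpha^{-i}\alpha_1\alpha^i,\qquad 1\le i\le n-2.$$
   Context: $F_n$ is the free group on $x_1,\dots,x_n$; $C_n\le\mathrm{Aut}(F_n)$ is the group of conjugating automorphisms, i.e. those sending each $x_i$ to $f_i^{-1}x_{\pi(i)}f_i$ with $f_i\in F_n$, $\pi\in S_n$. It is generated by the automorphisms ($1\le i\le n-1$) $\sigma_i: x_i\mapsto x_ix_{i+1}x_i^{-1},\ x_{i+1}\mapsto x_i,\ x_l\mapsto x_l$ for $l\ne i,i+1$; and $\alpha_i: x_i\mapsto x_{i+1},\ x_{i+1}\mapsto x_i,\ x_l\mapsto x_l$ for $l\ne i,i+1$. In this statement products of automorphisms are read as usual composition of functions: $\beta\gamma$ means first apply $\gamma$, then $\beta$. *)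

theory Defs
  imports "HOL-Algebra.Bij" "HOL-Algebra.Generated_Groups" "HOL-Combinatorics.Permutations"
begin

section \<open>Free groups\<close>

text \<open>The letter \<open>(x, True)\<close> stands for the generator \<open>x\<close>, and \<open>(x, False)\<close> for its inverse.
  The free group on \<open>X\<close> consists of the reduced words over \<open>X\<close>; a product is formed by
  prepending the letters of the first factor to the second one, cancelling whenever possible.\<close>

definition flip :: "'a \<times> bool \<Rightarrow> 'a \<times> bool" where
  "flip a = (fst a, \<not> snd a)"

fun reduced :: "('a \<times> bool) list \<Rightarrow> bool" where
  "reduced [] \<longleftrightarrow> True"
| "reduced [a] \<longleftrightarrow> True"
| "reduced (a # b # w) \<longleftrightarrow> b \<noteq> flip a \<and> reduced (b # w)"

fun push :: "'a \<times> bool \<Rightarrow> ('a \<times> bool) list \<Rightarrow> ('a \<times> bool) list" where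
  "push a [] = [a]"
| "push a (b # w) = (if b = flip a then w else a # b # w)"

definition free_group :: "'a set \<Rightarrow> ('a \<times> bool) list monoid" where
  "free_group X =
    \<lparr>carrier = {w. reduced w \<and> fst ` set w \<subseteq> X}, monoid.mult = \<lambda>u v. foldr push u v, one = []\<rparr>"

definition gen :: "'a \<Rightarrow> ('a \<times> bool) list" where
  "gen x = [(x, True)]"

lemma flip_flip [simp]: "flip (flip a) = a"
  by (simp add: flip_def)

lemma fst_flip [simp]: "fst (flip a) = fst a"
  by (simp add: flip_def)

lemma flip_neq [simp]: "flip a \<noteq> a" "a \<noteq> flip a"
  by (auto simp: flip_def prod_eq_iff)

lemma reduced_Cons: "reduced (a # w) \<longleftrightarrow> reduced w \<and> (w = [] \<or> hd w \<noteq> flip a)"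
  by (cases w) auto

lemma reduced_push: "reduced w \<Longrightarrow> reduced (push a w)"
  by (cases w) (auto simp: reduced_Cons)

lemma reduced_foldr_push: "reduced v \<Longrightarrow> reduced (foldr push u v)"
  by (induction u) (auto simp: reduced_push)

lemma push_flip_push:
  assumes "reduced w"
  shows "push a (push (flip a) w) = w"
proof (cases w)
  case (Cons b v)
  then show ?thesis using \<open>reduced w\<close> by (cases v) auto
qed simp

lemma foldr_push_push:
  assumes "reduced v" "reduced w"
  shows "foldr push (push a v) w = push a (foldr push v w)"
  using assms by (cases v) (auto simp: push_flip_push reduced_foldr_push)

lemma foldr_push_assoc:
  assumes "reduced v" "reduced w"
  shows "foldr push (foldr push u v) w = foldr push u (foldr push v w)"
  using assms by (induction u) (auto simp: foldr_push_push reduced_foldr_push)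

lemma set_push: "fst ` set (push a w) \<subseteq> insert (fst a) (fst ` set w)"
  by (cases w) auto

lemma set_foldr_push: "fst ` set (foldr push u v) \<subseteq> fst ` set u \<union> fst ` set v"
proof (induction u)
  case (Cons a u)
  have "fst ` set (foldr push (a # u) v) \<subseteq> insert (fst a) (fst ` set (foldr push u v))"
    using set_push by simp
  also have "\<dots> \<subseteq> fst ` set (a # u) \<union> fst ` set v" using Cons by (simp add: subset_insertI2)
  finally show ?case .
qed simp

lemma foldr_push_Nil: "reduced u \<Longrightarrow> foldr push u [] = u"
proof (induction u)
  case (Cons a u)
  then show ?case by (cases u) auto
qed simp

lemma foldr_push_inverse: "reduced w \<Longrightarrow> foldr push (rev (map flip u)) (foldr push u w) = w"
proof (induction u arbitrary: w)
  case (Cons a u)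
  have "push (flip a) (push a (foldr push u w)) = foldr push u w"
    using push_flip_push[of "foldr push u w" "flip a"] Cons.prems by (simp add: reduced_foldr_push)
  with Cons show ?case by simp
qed simp

lemma group_free_group: "group (free_group X)"
proof (rule groupI)
  fix u v assume "u \<in> carrier (free_group X)" "v \<in> carrier (free_group X)"
  then show "u \<otimes>\<^bsub>free_group X\<^esub> v \<in> carrier (free_group X)"
    using order_trans[OF set_foldr_push[of u v], of X]
    by (simp add: free_group_def reduced_foldr_push)
next
  fix u assume u: "u \<in> carrier (free_group X)"
  let ?v = "foldr push (rev (map flip u)) []"
  have "?v \<in> carrier (free_group X)"
    using u order_trans[OF set_foldr_push[of "rev (map flip u)" "[]"], of X]
    by (simp add: free_group_def reduced_foldr_push image_image)
  moreover have "foldr push ?v u = []"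
    using u foldr_push_inverse[of "[]" u]
    by (simp add: free_group_def foldr_push_assoc foldr_push_Nil)
  ultimately show "\<exists>v\<in>carrier (free_group X). v \<otimes>\<^bsub>free_group X\<^esub> u = \<one>\<^bsub>free_group X\<^esub>"
    by (auto simp: free_group_def)
qed (auto simp: free_group_def foldr_push_assoc)

text \<open>The homomorphism from a free group to \<open>G\<close> that extends a map \<open>\<iota>\<close> given on the generators.\<close>

definition free_ext ::
  "('g, 'm) monoid_scheme \<Rightarrow> ('a \<Rightarrow> 'g) \<Rightarrow> ('a \<times> bool) list \<Rightarrow> 'g" where
  "free_ext G \<iota> w =
    foldr (\<lambda>a g. (if snd a then \<iota> (fst a) else inv\<^bsub>G\<^esub> \<iota> (fst a)) \<otimes>\<^bsub>G\<^esub> g) w \<one>\<^bsub>G\<^esub>"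

lemma (in group) free_ext_closed:
  "\<lbrakk>\<iota> \<in> X \<rightarrow> carrier G; fst ` set w \<subseteq> X\<rbrakk> \<Longrightarrow> free_ext G \<iota> w \<in> carrier G"
  by (induction w) (auto simp: free_ext_def)

lemma (in group) free_ext_push:
  assumes "\<iota> \<in> X \<rightarrow> carrier G" "fst a \<in> X" "fst ` set w \<subseteq> X"
  shows "free_ext G \<iota> (push a w) = free_ext G \<iota> [a] \<otimes> free_ext G \<iota> w"
proof (cases w)
  case Nil
  then show ?thesis using assms by (auto simp: free_ext_def Pi_def)
next
  case (Cons b v)
  have "free_ext G \<iota> v \<in> carrier G"
    using assms Cons by (intro free_ext_closed[of _ X]) auto
  moreover have "\<iota> (fst a) \<in> carrier G" "\<iota> (fst b) \<in> carrier G" using assms Cons by auto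
  ultimately show ?thesis using Cons unfolding free_ext_def
    by (auto simp: free_ext_def flip_def m_assoc[symmetric])
qed

lemma (in group) free_ext_hom:
  assumes "\<iota> \<in> X \<rightarrow> carrier G"
  shows "free_ext G \<iota> \<in> hom (free_group X) G"
proof (rule homI)
  fix u v assume u: "u \<in> carrier (free_group X)" and v: "v \<in> carrier (free_group X)"
  then have uX: "fst ` set u \<subseteq> X" and vX: "fst ` set v \<subseteq> X" by (auto simp: free_group_def)
  have "free_ext G \<iota> (foldr push u v) = free_ext G \<iota> u \<otimes> free_ext G \<iota> v" using uX
  proof (induction u)
    case Nil
    then show ?case using free_ext_closed[OF assms vX] by (simp add: free_ext_def)
  next
    case (Cons a u)
    have "free_ext G \<iota> (a # u) = free_ext G \<iota> [a] \<otimes> free_ext G \<iota> u"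
      using assms Cons.prems by (auto simp: free_ext_def Pi_def)
    moreover have "fst ` set (foldr push u v) \<subseteq> X"
      using order_trans[OF set_foldr_push[of u v], of X] Cons.prems vX by simp
    moreover have "free_ext G \<iota> [a] \<in> carrier G" "free_ext G \<iota> u \<in> carrier G"
        "free_ext G \<iota> v \<in> carrier G"
      using assms Cons.prems vX by (intro free_ext_closed[of _ X]; auto)+
    ultimately show ?case using Cons assms by (simp add: free_ext_push[of _ X] m_assoc)
  qed
  then show "free_ext G \<iota> (u \<otimes>\<^bsub>free_group X\<^esub> v) = free_ext G \<iota> u \<otimes> free_ext G \<iota> v"
    by (simp add: free_group_def)
qed (use assms in \<open>auto simp: free_group_def intro: free_ext_closed[of _ X]\<close>)


section \<open>Group presentations\<close>

definition normal_closure :: "('g, 'm) monoid_scheme \<Rightarrow> 'g set \<Rightarrow> 'g set" where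
  "normal_closure G R = \<Inter> {N. N \<lhd> G \<and> R \<subseteq> N}"

text \<open>\<open>G\<close> is generated by the elements \<open>\<iota> x\<close>, \<open>x \<in> X\<close>, with defining relations \<open>u = v\<close> for
  \<open>(u, v) \<in> R\<close>, where \<open>u\<close> and \<open>v\<close> are elements of the free group on \<open>X\<close>.\<close>

definition presented_by ::
  "('g, 'm) monoid_scheme \<Rightarrow> 'a set \<Rightarrow> ('a \<Rightarrow> 'g) \<Rightarrow>
    (('a \<times> bool) list \<times> ('a \<times> bool) list) set \<Rightarrow> bool" where
  "presented_by G X \<iota> R \<longleftrightarrow>
    group G \<and> \<iota> \<in> X \<rightarrow> carrier G \<and>
    R \<subseteq> carrier (free_group X) \<times> carrier (free_group X) \<and>
    generate G (\<iota> ` X) = carrier G \<and>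
    kernel (free_group X) G (free_ext G \<iota>) =
      normal_closure (free_group X)
        {u \<otimes>\<^bsub>free_group X\<^esub> inv\<^bsub>free_group X\<^esub> v | u v. (u, v) \<in> R}"


section \<open>Conjugating automorphisms\<close>

abbreviation F :: "nat \<Rightarrow> (nat \<times> bool) list monoid" where
  "F n \<equiv> free_group {1..n}"

text \<open>The multiplication of \<open>AutoGroup\<close> is composition of functions, the right factor being
  applied first; its elements are extensional functions on the carrier.\<close>

definition conj_aut_group ::
  "nat \<Rightarrow> ((nat \<times> bool) list \<Rightarrow> (nat \<times> bool) list) monoid" where
  "conj_aut_group n = AutoGroup (F n)
    \<lparr>carrier := {\<phi> \<in> auto (F n). \<exists>\<pi> f. \<pi> permutes {1..n} \<and> f \<in> {1..n} \<rightarrow> carrier (F n) \<and>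
      (\<forall>i\<in>{1..n}. \<phi> (gen i) = inv\<^bsub>F n\<^esub> f i \<otimes>\<^bsub>F n\<^esub> gen (\<pi> i) \<otimes>\<^bsub>F n\<^esub> f i)}\<rparr>"

definition endo :: "nat \<Rightarrow> (nat \<Rightarrow> (nat \<times> bool) list) \<Rightarrow> (nat \<times> bool) list \<Rightarrow> (nat \<times> bool) list"
  where "endo n f = restrict (free_ext (F n) f) (carrier (F n))"

definition sigma_gen :: "nat \<Rightarrow> nat \<Rightarrow> (nat \<times> bool) list \<Rightarrow> (nat \<times> bool) list" where
  "sigma_gen n i = endo n (\<lambda>l.
    if l = i then gen i \<otimes>\<^bsub>F n\<^esub> gen (i + 1) \<otimes>\<^bsub>F n\<^esub> inv\<^bsub>F n\<^esub> gen i
    else if l = i + 1 then gen i else gen l)"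

definition alpha_gen :: "nat \<Rightarrow> nat \<Rightarrow> (nat \<times> bool) list \<Rightarrow> (nat \<times> bool) list" where
  "alpha_gen n i = endo n (\<lambda>l.
    if l = i then gen (i + 1) else if l = i + 1 then gen i else gen l)"

definition sigma :: "nat \<Rightarrow> (nat \<times> bool) list \<Rightarrow> (nat \<times> bool) list" where
  "sigma n = foldr (\<lambda>i g. sigma_gen n i \<otimes>\<^bsub>conj_aut_group n\<^esub> g) [1..<n] \<one>\<^bsub>conj_aut_group n\<^esub>"

definition alpha :: "nat \<Rightarrow> (nat \<times> bool) list \<Rightarrow> (nat \<times> bool) list" where
  "alpha n = foldr (\<lambda>i g. alpha_gen n i \<otimes>\<^bsub>conj_aut_group n\<^esub> g) (rev [1..<n]) \<one>\<^bsub>conj_aut_group n\<^esub>"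


section \<open>The generating symbols and the relations\<close>

datatype symbol = Alpha1 | Alpha | Sigma1 | Sigma

primrec symbol_value :: "nat \<Rightarrow> symbol \<Rightarrow> (nat \<times> bool) list \<Rightarrow> (nat \<times> bool) list" where
  "symbol_value n Alpha1 = alpha_gen n 1"
| "symbol_value n Alpha = alpha n"
| "symbol_value n Sigma1 = sigma_gen n 1"
| "symbol_value n Sigma = sigma n"

context
  fixes G :: "('g, 'm) monoid_scheme" (structure)
begin

text \<open>All index ranges are ranges of integers, so that exponents such as \<open>-(i - 1)\<close> are integer
  exponents; \<open>2 * j \<le> int n\<close> expresses that \<open>j\<close> is at most the rational number \<open>n / 2\<close>.\<close>

definition relations :: "nat \<Rightarrow> 'g \<Rightarrow> 'g \<Rightarrow> 'g \<Rightarrow> 'g \<Rightarrow> ('g \<times> 'g) set" where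
  "relations n a1 a s1 s =
    {(s [^] n, (s \<otimes> s1) [^] (n - 1))}
    \<union> {(s1 \<otimes> (s [^] (- j) \<otimes> s1 \<otimes> s [^] j), (s [^] (- j) \<otimes> s1 \<otimes> s [^] j) \<otimes> s1) | j :: int.
        2 \<le> j \<and> 2 * j \<le> int n}
    \<union> {(a1 [^] (2 :: nat), \<one>), (a [^] n, (a1 \<otimes> a) [^] (n - 1))}
    \<union> {(a1 \<otimes> (a [^] (- j) \<otimes> a1 \<otimes> a [^] j), (a [^] (- j) \<otimes> a1 \<otimes> a [^] j) \<otimes> a1) | j :: int.
        2 \<le> j \<and> 2 * j \<le> int n}
    \<union> {(a [^] (- i) \<otimes> a1 \<otimes> a [^] i \<otimes> s [^] j \<otimes> s1 \<otimes> s [^] (- j),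
         s [^] j \<otimes> s1 \<otimes> s [^] (- j) \<otimes> a [^] (- i) \<otimes> a1 \<otimes> a [^] i) | (i :: int) (j :: int).
        0 \<le> i \<and> i \<le> int n - 2 \<and> 0 \<le> j \<and> j \<le> int n - 2 \<and> 2 \<le> \<bar>i - j\<bar>}
    \<union> {(s [^] (i - 1) \<otimes> s1 \<otimes> s [^] (- (i - 1)) \<otimes> a [^] (- i) \<otimes> a1 \<otimes> a \<otimes> a1 \<otimes> a [^] (i - 1),
         a [^] (- i) \<otimes> a1 \<otimes> a \<otimes> a1 \<otimes> a [^] (i - 1) \<otimes> s [^] i \<otimes> s1 \<otimes> s [^] (- i)) | i :: int.
        1 \<le> i \<and> i \<le> int n - 2}
    \<union> {(s [^] (i - 1) \<otimes> s1 \<otimes> s \<otimes> s1 \<otimes> s [^] (- i) \<otimes> a [^] (- (i - 1)) \<otimes> a1 \<otimes> a [^] (i - 1),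
         a [^] (- i) \<otimes> a1 \<otimes> a [^] i \<otimes> s [^] (i - 1) \<otimes> s1 \<otimes> s \<otimes> s1 \<otimes> s [^] (- i)) | i :: int.
        1 \<le> i \<and> i \<le> int n - 2}"

end

end

theory Submission
  imports Defs "HOL-Algebra.Sym_Groups" "HOL-Library.Sublist"
begin

text \<open>
  That the relations hold in \<open>C\<^sub>n\<close> is a computation on the basis \<open>x\<^sub>1, \<dots>, x\<^sub>n\<close>. The content of the
  theorem is that they suffice. Let \<open>H\<close> be any group in which the relations hold. It is enough to
  construct a function \<open>f\<close> from \<open>C\<^sub>n\<close> to \<open>H\<close> with \<open>f 1 = 1\<close> such that right multiplication of the
  argument by a generator multiplies the value on the right by the corresponding element of \<open>H\<close>:
  then a word with trivial value in \<open>C\<^sub>n\<close> has trivial value in \<open>H\<close>, and \<open>H\<close> may be the quotient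
  of the free group by any normal subgroup that contains the relators
  (\<open>kernel_subset_normal\<close>).

  The function is built with other generators, the permutations of the basis and the basis
  conjugations \<open>e i j\<close>, which send \<open>x\<^sub>i\<close> to \<open>x\<^sub>j x\<^sub>i x\<^sub>j\<^sup>-\<^sup>1\<close> and fix the rest of the basis. An
  element \<open>\<phi>\<close> of \<open>C\<^sub>n\<close> is a tuple of reduced words \<open>\<phi> x\<^sub>i = w\<^sub>i\<^sup>-\<^sup>1 p\<^sub>i w\<^sub>i\<close>, where \<open>p\<^sub>i\<close> is a basis
  element, and the move from \<open>\<phi>\<close> to \<open>\<phi> e i j\<close> or \<open>\<phi> (e i j)\<^sup>-\<^sup>1\<close> conjugates the \<open>i\<close>-th word of the
  tuple by the \<open>j\<close>-th word or its inverse. Three facts about the total length of the tuple carry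
  the proof.

  \<^item> Every move changes the length, and it lowers the length exactly if \<open>w\<^sub>i\<close> ends in
    \<open>p\<^sub>j\<^sup>\<plusminus>\<^sup>1 w\<^sub>j\<close>, with the sign given by the move (\<open>total_length_strict\<close>).
  \<^item> If no move lowers the length, then \<open>\<phi>\<close> permutes the basis. This is Nielsen's argument: the
    middle letters \<open>p\<^sub>i\<close> survive in every reduced product of the \<open>\<phi> x\<^sub>i\<close>, and a product of this kind
    can be a single letter only if the corresponding \<open>w\<^sub>i\<close> is empty (\<open>no_descent_perm_aut\<close>).
  \<^item> If two moves lower the length of \<open>\<phi>\<close>, then their results are joined by a path of moves through
    tuples that are shorter than \<open>\<phi>\<close>, and the loop so obtained is filled by McCool's
    relations between the basis conjugations (\<open>moves_peak\<close>).

  As in Newman's lemma, it follows that the value of \<open>f\<close> can be computed along any descending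
  path (\<open>labelling_exists\<close>). The same argument, with the adjacent transpositions as moves and a
  weight that counts disorder as length, extends elements of \<open>H\<close> that satisfy the Coxeter relations
  to a homomorphism on the symmetric group (\<open>sym_group_hom\<close>), which gives the values of \<open>f\<close> on
  permutations of the basis.

  It remains to find the basis conjugations in \<open>H\<close>. Following Artin, the relations between the two
  generators \<open>\<sigma>\<close>, \<open>\<sigma>\<^sub>1\<close> are equivalent to the braid relations between the conjugates
  \<open>\<sigma>\<^sup>i \<sigma>\<^sub>1 \<sigma>\<^sup>-\<^sup>i\<close>, and similarly for \<open>\<alpha>\<close>, \<open>\<alpha>\<^sub>1\<close> (\<open>relations_welded\<close>). The elements \<open>\<sigma>\<^sub>i \<alpha>\<^sub>i\<close>
  are conjugate under the symmetric group and define \<open>e i j\<close>; the commutation relations, the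
  braid relation and the last mixed relation then turn into the relations of McCool (\<open>welded\<close>).
\<close>

section \<open>Functions on a group determined by descending moves\<close>

text \<open>
  The moves \<open>g m\<close> generate a graph on \<open>C\<close> whose edges carry labels \<open>h m\<close> in \<open>H\<close>. A function with
  the prescribed change of value along each edge exists if all loops have trivial label. The
  assumption \<open>peak\<close> localizes this: the two ways down from a vertex \<open>v\<close> have to agree only for
  functions that are already consistent on all edges strictly below \<open>v\<close>. It is phrased with such
  a function instead of with paths, so that joining two lower neighbours is an equational step.
\<close>

locale descent = C: group C + H: group H
  for C :: "('c, 'x) monoid_scheme" and H :: "('h, 'y) monoid_scheme" +
  fixes M :: "'m set" and g :: "'m \<Rightarrow> 'c" and h :: "'m \<Rightarrow> 'h"
    and \<mu> :: "'c \<Rightarrow> nat" and B :: "'c set" and b :: "'c \<Rightarrow> 'h"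
  assumes move_closed: "m \<in> M \<Longrightarrow> g m \<in> carrier C"
    and label_closed: "m \<in> M \<Longrightarrow> h m \<in> carrier H"
    and base_closed: "v \<in> B \<Longrightarrow> v \<in> carrier C" "v \<in> B \<Longrightarrow> b v \<in> carrier H"
    and reverse: "m \<in> M \<Longrightarrow> \<exists>m'\<in>M. g m' = inv\<^bsub>C\<^esub> g m \<and> h m' = inv\<^bsub>H\<^esub> h m"
    and strict: "\<lbrakk>v \<in> carrier C; m \<in> M\<rbrakk> \<Longrightarrow> \<mu> (v \<otimes>\<^bsub>C\<^esub> g m) \<noteq> \<mu> v"
    and base_min: "\<lbrakk>v \<in> B; m \<in> M\<rbrakk> \<Longrightarrow> \<mu> v < \<mu> (v \<otimes>\<^bsub>C\<^esub> g m)"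
    and descent_exists: "\<lbrakk>v \<in> carrier C; v \<notin> B\<rbrakk> \<Longrightarrow> \<exists>m\<in>M. \<mu> (v \<otimes>\<^bsub>C\<^esub> g m) < \<mu> v"
    and peak: "\<And>v m m' f. \<lbrakk>v \<in> carrier C; m \<in> M; m' \<in> M;
        \<mu> (v \<otimes>\<^bsub>C\<^esub> g m) < \<mu> v; \<mu> (v \<otimes>\<^bsub>C\<^esub> g m') < \<mu> v; f \<in> carrier C \<rightarrow> carrier H;
        \<And>u m. \<lbrakk>u \<in> carrier C; m \<in> M; \<mu> u < \<mu> v; \<mu> (u \<otimes>\<^bsub>C\<^esub> g m) < \<mu> v\<rbrakk> \<Longrightarrow>
          f (u \<otimes>\<^bsub>C\<^esub> g m) = f u \<otimes>\<^bsub>H\<^esub> h m\<rbrakk>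
      \<Longrightarrow> f (v \<otimes>\<^bsub>C\<^esub> g m) \<otimes>\<^bsub>H\<^esub> inv\<^bsub>H\<^esub> h m = f (v \<otimes>\<^bsub>C\<^esub> g m') \<otimes>\<^bsub>H\<^esub> inv\<^bsub>H\<^esub> h m'"
begin

text \<open>
  A relation and not yet a function: that different ways down give the same value is the point.
\<close>

inductive value_at :: "'c \<Rightarrow> 'h \<Rightarrow> bool" where
  base: "v \<in> B \<Longrightarrow> value_at v (b v)"
| step: "\<lbrakk>v \<in> carrier C; m \<in> M; \<mu> (v \<otimes>\<^bsub>C\<^esub> g m) < \<mu> v; value_at (v \<otimes>\<^bsub>C\<^esub> g m) x\<rbrakk>
    \<Longrightarrow> value_at v (x \<otimes>\<^bsub>H\<^esub> inv\<^bsub>H\<^esub> h m)"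

lemma value_at_closed: "value_at v x \<Longrightarrow> v \<in> carrier C \<and> x \<in> carrier H"
  by (induction rule: value_at.induct) (auto simp: base_closed label_closed)

lemma value_at_move:
  assumes "u \<in> carrier C" "m \<in> M"
    and u: "\<exists>!x. value_at u x" and um: "\<exists>!x. value_at (u \<otimes>\<^bsub>C\<^esub> g m) x"
  shows "(THE x. value_at (u \<otimes>\<^bsub>C\<^esub> g m) x) = (THE x. value_at u x) \<otimes>\<^bsub>H\<^esub> h m"
proof -
  let ?um = "u \<otimes>\<^bsub>C\<^esub> g m" and ?f = "\<lambda>u. THE x. value_at u x"
  have fu: "value_at u (?f u)" and fum: "value_at ?um (?f ?um)"
    using theI'[OF u] theI'[OF um] by auto
  have cl: "?f u \<in> carrier H" "?f ?um \<in> carrier H" "h m \<in> carrier H" "g m \<in> carrier C"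
    using value_at_closed[OF fu] value_at_closed[OF fum] assms label_closed move_closed by auto
  show ?thesis
  proof (cases "\<mu> ?um < \<mu> u")
    case True
    have "value_at u (?f ?um \<otimes>\<^bsub>H\<^esub> inv\<^bsub>H\<^esub> h m)" using value_at.step[OF assms(1,2) True fum] .
    then have "?f u = ?f ?um \<otimes>\<^bsub>H\<^esub> inv\<^bsub>H\<^esub> h m" using u fu by blast
    then show ?thesis using cl by (simp add: H.m_assoc)
  next
    case False
    then have less: "\<mu> u < \<mu> ?um" using strict[OF assms(1,2)] by linarith
    obtain m' where m': "m' \<in> M" "g m' = inv\<^bsub>C\<^esub> g m" "h m' = inv\<^bsub>H\<^esub> h m"
      using reverse assms by blast
    have um': "?um \<otimes>\<^bsub>C\<^esub> g m' = u" using m' cl assms by (simp add: C.m_assoc)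
    have "value_at ?um (?f u \<otimes>\<^bsub>H\<^esub> inv\<^bsub>H\<^esub> h m')"
      using value_at.step[of ?um m' "?f u"] um' less fu m' cl assms by simp
    then have "?f ?um = ?f u \<otimes>\<^bsub>H\<^esub> inv\<^bsub>H\<^esub> h m'" using um fum by blast
    then show ?thesis using cl m' by simp
  qed
qed

text \<open>
  By induction on the height of \<open>v\<close>: below \<open>v\<close> the values form a function that is consistent along
  all edges, so the peak assumption applies to it, and all descents from \<open>v\<close> give the same value.
\<close>

lemma value_at_unique: "v \<in> carrier C \<Longrightarrow> \<exists>!x. value_at v x"
proof (induction "\<mu> v" arbitrary: v rule: less_induct)
  case less
  show ?case
  proof (cases "v \<in> B")
    case True
    have "x = b v" if "value_at v x" for x
      using that True base_min[OF True] by (cases rule: value_at.cases) force+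
    then show ?thesis using value_at.base[OF True] by blast
  next
    case False
    define f where "f u = (if u \<in> carrier C \<and> \<mu> u < \<mu> v then THE x. value_at u x else \<one>\<^bsub>H\<^esub>)" for u
    have f: "value_at u (f u)" if "u \<in> carrier C" "\<mu> u < \<mu> v" for u
      using theI'[OF less.hyps[OF that(2,1)]] that by (simp add: f_def)
    have f_eq: "f u = x" if "value_at u x" "\<mu> u < \<mu> v" for u x
      using that f less.hyps value_at_closed by blast
    have fH: "f \<in> carrier C \<rightarrow> carrier H"
    proof
      fix u assume u: "u \<in> carrier C"
      show "f u \<in> carrier H"
      proof (cases "\<mu> u < \<mu> v")
        case True
        then show ?thesis using value_at_closed[OF f[OF u]] by simp
      qed (simp add: f_def)
    qed
    have cons: "f (u \<otimes>\<^bsub>C\<^esub> g m) = f u \<otimes>\<^bsub>H\<^esub> h m"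
      if "u \<in> carrier C" "m \<in> M" "\<mu> u < \<mu> v" "\<mu> (u \<otimes>\<^bsub>C\<^esub> g m) < \<mu> v" for u m
      using value_at_move[OF that(1,2)] less.hyps that move_closed by (simp add: f_def)
    obtain m where m: "m \<in> M" "\<mu> (v \<otimes>\<^bsub>C\<^esub> g m) < \<mu> v"
      using descent_exists[OF less.prems False] by blast
    have "x = f (v \<otimes>\<^bsub>C\<^esub> g m) \<otimes>\<^bsub>H\<^esub> inv\<^bsub>H\<^esub> h m" if "value_at v x" for x
      using that
    proof (cases rule: value_at.cases)
      case (step m' y)
      have "f (v \<otimes>\<^bsub>C\<^esub> g m') \<otimes>\<^bsub>H\<^esub> inv\<^bsub>H\<^esub> h m' = f (v \<otimes>\<^bsub>C\<^esub> g m) \<otimes>\<^bsub>H\<^esub> inv\<^bsub>H\<^esub> h m"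
        using peak[OF less.prems step(3) m(1) step(4) m(2) fH cons] .
      then show ?thesis using step f_eq by simp
    qed (use False in simp)
    moreover have "value_at v (f (v \<otimes>\<^bsub>C\<^esub> g m) \<otimes>\<^bsub>H\<^esub> inv\<^bsub>H\<^esub> h m)"
      using value_at.step[OF less.prems m] f less.prems m move_closed by simp
    ultimately show ?thesis by blast
  qed
qed

theorem labelling_exists:
  obtains f where "f \<in> carrier C \<rightarrow> carrier H" "\<And>v. v \<in> B \<Longrightarrow> f v = b v"
    "\<And>v m. \<lbrakk>v \<in> carrier C; m \<in> M\<rbrakk> \<Longrightarrow> f (v \<otimes>\<^bsub>C\<^esub> g m) = f v \<otimes>\<^bsub>H\<^esub> h m"
proof
  let ?f = "\<lambda>u. THE x. value_at u x"
  show "?f \<in> carrier C \<rightarrow> carrier H"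
    using theI'[OF value_at_unique] value_at_closed by blast
  show "?f v = b v" if "v \<in> B" for v
    using the1_equality[OF value_at_unique value_at.base] base_closed that by blast
  show "?f (v \<otimes>\<^bsub>C\<^esub> g m) = ?f v \<otimes>\<^bsub>H\<^esub> h m" if "v \<in> carrier C" "m \<in> M" for v m
    using value_at_move value_at_unique move_closed that by simp
qed

lemma descent_induct [consumes 1, case_names base step]:
  assumes "v \<in> carrier C"
    and "\<And>v. v \<in> B \<Longrightarrow> P v"
    and "\<And>v m. \<lbrakk>v \<in> carrier C; v \<notin> B; m \<in> M; \<mu> (v \<otimes>\<^bsub>C\<^esub> g m) < \<mu> v; P (v \<otimes>\<^bsub>C\<^esub> g m)\<rbrakk> \<Longrightarrow> P v"
  shows "P v"
  using assms(1)
proof (induction "\<mu> v" arbitrary: v rule: less_induct)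
  case less
  then show ?case using assms(2,3) descent_exists move_closed by (metis C.m_closed)
qed

end


section \<open>The symmetric group\<close>

text \<open>
  Swapping an adjacent pair in descending order lowers this weight by the difference of the two
  entries. It replaces the number of inversions, and is easier to compare.
\<close>

definition perm_weight :: "nat \<Rightarrow> (nat \<Rightarrow> nat) \<Rightarrow> nat" where
  "perm_weight n p = (\<Sum>i\<in>{1..n}. i * (n - p i))"

abbreviation adj :: "nat \<Rightarrow> nat \<Rightarrow> nat" where
  "adj k \<equiv> transpose k (Suc k)"

lemma adj_permutes: "\<lbrakk>1 \<le> k; k < n\<rbrakk> \<Longrightarrow> adj k permutes {1..n}"
  by (intro permutes_swap_id) auto

lemma perm_weight_descent:
  assumes p: "p permutes {1..n}" and k: "1 \<le> k" "k < n" and desc: "p (Suc k) < p k"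
  shows "perm_weight n (p \<circ> adj k) < perm_weight n p"
proof -
  have split: "perm_weight n q = k * (n - q k) + Suc k * (n - q (Suc k))
      + (\<Sum>i\<in>{1..n} - {k, Suc k}. i * (n - q i))" for q
  proof -
    have "{1..n} = insert k (insert (Suc k) ({1..n} - {k, Suc k}))" using k by auto
    then have "perm_weight n q
        = (\<Sum>i\<in>insert k (insert (Suc k) ({1..n} - {k, Suc k})). i * (n - q i))"
      unfolding perm_weight_def by (metis (no_types))
    then show ?thesis by simp
  qed
  have "p k \<le> n" using permutes_in_image[OF p, of k] k by simp
  then have "k * (n - p (Suc k)) + Suc k * (n - p k) < k * (n - p k) + Suc k * (n - p (Suc k))"
    using desc by simp
  moreover have "(\<Sum>i\<in>{1..n} - {k, Suc k}. i * (n - (p \<circ> adj k) i))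
      = (\<Sum>i\<in>{1..n} - {k, Suc k}. i * (n - p i))"
    by (rule sum.cong) (auto simp: transpose_def)
  ultimately show ?thesis unfolding split by simp
qed

lemma no_descent_imp_id:
  assumes p: "p permutes {1..n}" and asc: "\<And>k. \<lbrakk>1 \<le> k; k < n\<rbrakk> \<Longrightarrow> p k \<le> p (Suc k)"
  shows "p = id"
proof (rule permutes_natset_ge[OF p], rule ballI)
  have "1 \<le> i \<Longrightarrow> i \<le> n \<Longrightarrow> i \<le> p i" for i
  proof (induction i rule: nat_induct_at_least[of 1])
    case base
    then show ?case using permutes_in_image[OF p, of 1] by simp
  next
    case (Suc i)
    then have "p i \<noteq> p (Suc i)" using permutes_inj[OF p] by (simp add: inj_eq)
    then show ?case using Suc asc[of i] by linarith
  qed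
  then show "i \<le> p i" if "i \<in> {1..n}" for i using that by simp
qed

lemma adj_descent_iff:
  assumes p: "p permutes {1..n}" and k: "1 \<le> k" "k < n"
  shows "perm_weight n (p \<circ> adj k) < perm_weight n p \<longleftrightarrow> p (Suc k) < p k"
    and "perm_weight n (p \<circ> adj k) \<noteq> perm_weight n p"
proof -
  have "p k \<noteq> p (Suc k)" using permutes_inj[OF p] by (simp add: inj_eq)
  moreover have "perm_weight n p < perm_weight n (p \<circ> adj k)" if "p k < p (Suc k)"
    using perm_weight_descent[OF permutes_compose[OF adj_permutes[OF k] p] k] that
    by (simp add: comp_assoc)
  ultimately show "perm_weight n (p \<circ> adj k) < perm_weight n p \<longleftrightarrow> p (Suc k) < p k"
      "perm_weight n (p \<circ> adj k) \<noteq> perm_weight n p"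
    using perm_weight_descent[OF p k] by (metis less_asym nat_neq_iff)+
qed

lemma permutes_adj_induct [consumes 1, case_names id adj]:
  assumes "p permutes {1..n}" and "P id"
    and step: "\<And>p k. \<lbrakk>p permutes {1..n}; 1 \<le> k; k < n; p k < p (Suc k); P p\<rbrakk> \<Longrightarrow> P (p \<circ> adj k)"
  shows "P p"
  using assms(1)
proof (induction "perm_weight n p" arbitrary: p rule: less_induct)
  case less
  show ?case
  proof (cases "p = id")
    case False
    then obtain k where k: "1 \<le> k" "k < n" "p (Suc k) < p k"
      using no_descent_imp_id[OF less.prems] by (meson not_le)
    let ?q = "p \<circ> adj k"
    have q: "?q permutes {1..n}" using permutes_compose adj_permutes k less.prems by blast
    have "P ?q" using less.hyps[OF _ q] perm_weight_descent[OF less.prems k] by simp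
    then have "P (?q \<circ> adj k)" using step[OF q k(1,2)] k by simp
    then show ?thesis by (simp add: comp_assoc)
  qed (use assms in simp)
qed

text \<open>
  Used to transport a relation between basis conjugations from one tuple of indices to all others.
\<close>

lemma permutes_extend:
  assumes "distinct xs" "distinct ys" "length xs = length ys" "set xs \<subseteq> S" "set ys \<subseteq> S"
  obtains p where "p permutes S" "map p xs = ys"
proof -
  have "\<exists>p. p permutes S \<and> map p xs = ys"
    using assms(3,1,2,4,5)
  proof (induction xs ys rule: list_induct2)
    case Nil
    show ?case using permutes_id[of S] by (auto simp: id_def)
  next
    case (Cons x xs y ys)
    then obtain p where p: "p permutes S" "map p xs = ys" by auto
    have "p x \<notin> set ys"
      using p Cons.prems permutes_inj[OF p(1)] by (auto simp: inj_eq)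
    then have "transpose (p x) y z = z" if "z \<in> set ys" for z
      using that Cons.prems by (intro transpose_apply_other) auto
    then have "map (transpose (p x) y) (map p xs) = ys"
      unfolding p(2) by (rule map_idI)
    then have "map (transpose (p x) y \<circ> p) xs = ys" by (simp del: map_map add: map_map[symmetric])
    moreover have "p x \<in> S" using permutes_in_image[OF p(1)] Cons.prems by auto
    then have "transpose (p x) y \<circ> p permutes S"
      using p Cons.prems by (intro permutes_compose permutes_swap_id) auto
    ultimately show ?case by (intro exI[of _ "transpose (p x) y \<circ> p"]) (simp add: o_def)
  qed
  then show thesis using that by blast
qed

locale coxeter = group K for K :: "('k, 'x) monoid_scheme" (structure) +
  fixes n :: nat and a :: "nat \<Rightarrow> 'k"
  assumes a_closed [simp]: "\<lbrakk>1 \<le> i; i < n\<rbrakk> \<Longrightarrow> a i \<in> carrier K"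
    and a_square: "\<lbrakk>1 \<le> i; i < n\<rbrakk> \<Longrightarrow> a i \<otimes> a i = \<one>"
    and a_commute: "\<lbrakk>1 \<le> i; i + 2 \<le> j; j < n\<rbrakk> \<Longrightarrow> a i \<otimes> a j = a j \<otimes> a i"
    and a_braid: "\<lbrakk>1 \<le> i; Suc i < n\<rbrakk> \<Longrightarrow> a i \<otimes> a (Suc i) \<otimes> a i = a (Suc i) \<otimes> a i \<otimes> a (Suc i)"
begin

lemma a_inv: "\<lbrakk>1 \<le> i; i < n\<rbrakk> \<Longrightarrow> inv a i = a i"
  using inv_equality[OF a_square] by simp

lemma a_cancel [simp]: "\<lbrakk>1 \<le> i; i < n; x \<in> carrier K\<rbrakk> \<Longrightarrow> x \<otimes> a i \<otimes> a i = x"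
  by (simp add: m_assoc a_square)

text \<open>
  Completeness of the Coxeter relations. Two descents at a permutation are either far apart, and
  then commute, or adjacent; then three consecutive entries are in descending order, and the
  hexagon of the braid relation connects the two lower neighbours below the peak.
\<close>

lemma sym_group_descent:
  "descent (sym_group n) K {1..<n} adj a (perm_weight n) {id} (\<lambda>_. \<one>)"
proof -
  have peak: "f (v \<circ> adj i) \<otimes> a i = f (v \<circ> adj j) \<otimes> a j"
    if v: "v permutes {1..n}" and ij: "1 \<le> i" "i < j" "j < n"
      and desc: "v (Suc i) < v i" "v (Suc j) < v j"
      and f: "\<And>p. p permutes {1..n} \<Longrightarrow> f p \<in> carrier K"
      and cons: "\<And>u k. \<lbrakk>u permutes {1..n}; 1 \<le> k; k < n; perm_weight n u < perm_weight n v;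
        perm_weight n (u \<circ> adj k) < perm_weight n v\<rbrakk> \<Longrightarrow> f (u \<circ> adj k) = f u \<otimes> a k"
    for v i j and f :: "(nat \<Rightarrow> nat) \<Rightarrow> 'k"
  proof -
    have perm: "u \<circ> adj k permutes {1..n}" if "u permutes {1..n}" "1 \<le> k" "k < n" for u k
      using that permutes_compose adj_permutes by blast
    have down: "f (u \<circ> adj k) = f u \<otimes> a k \<and> perm_weight n (u \<circ> adj k) < perm_weight n v"
      if "u permutes {1..n}" "1 \<le> k" "k < n" "u (Suc k) < u k" "perm_weight n u < perm_weight n v" for u k
      using cons[OF that(1,2,3,5)] perm_weight_descent[OF that(1-4)] that by linarith
    let ?vi = "v \<circ> adj i" and ?vj = "v \<circ> adj j"
    have less: "perm_weight n ?vi < perm_weight n v" "perm_weight n ?vj < perm_weight n v"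
      using perm_weight_descent[OF v] ij desc by auto
    have i: "i < n" and j: "1 \<le> j" using ij by auto
    have pi: "?vi permutes {1..n}" and pj: "?vj permutes {1..n}" using perm v ij i j by auto
    have cl: "f ?vi \<in> carrier K" "f ?vj \<in> carrier K" "a i \<in> carrier K" "a j \<in> carrier K"
      using f pi pj ij by auto
    show ?thesis
    proof (cases "j = Suc i")
      case False
      have vji: "v \<circ> adj j \<circ> adj i = v \<circ> adj i \<circ> adj j"
        using False ij by (auto simp: fun_eq_iff transpose_def)
      have "f ?vi \<otimes> a j = f (?vi \<circ> adj j)"
        using down[OF pi j ij(3) _ less(1)] desc ij False by (simp add: transpose_def)
      also have "\<dots> = f ?vj \<otimes> a i"
        using down[OF pj ij(1) i _ less(2)] desc ij False by (simp add: transpose_def flip: vji)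
      finally have eq: "f ?vi \<otimes> a j = f ?vj \<otimes> a i" .
      have "f ?vi \<otimes> a i = f ?vi \<otimes> a j \<otimes> a j \<otimes> a i" using cl ij j by simp
      also have "\<dots> = f ?vj \<otimes> (a i \<otimes> a j) \<otimes> a i" unfolding eq using cl by (simp add: m_assoc)
      also have "\<dots> = f ?vj \<otimes> a j \<otimes> a i \<otimes> a i"
        using a_commute[of i j] ij False cl by (simp add: m_assoc)
      finally show ?thesis using cl ij i by simp
    next
      case True
      then have asc: "v (Suc (Suc i)) < v i" using desc by simp
      note di = down[OF pi j ij(3) _ less(1)] and dj = down[OF pj ij(1) i _ less(2)]
      have 1: "f (?vi \<circ> adj j) = f ?vi \<otimes> a j" "perm_weight n (?vi \<circ> adj j) < perm_weight n v"
        using di desc True asc by (simp_all add: transpose_def)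
      have 2: "f (?vj \<circ> adj i) = f ?vj \<otimes> a i" "perm_weight n (?vj \<circ> adj i) < perm_weight n v"
        using dj desc True asc by (simp_all add: transpose_def)
      have 3: "f (?vi \<circ> adj j \<circ> adj i) = f ?vi \<otimes> a j \<otimes> a i"
        using down[OF perm[OF pi j ij(3)] ij(1) i _ 1(2)] 1(1) desc True by (simp add: transpose_def)
      have 4: "f (?vj \<circ> adj i \<circ> adj j) = f ?vj \<otimes> a i \<otimes> a j"
        using down[OF perm[OF pj ij(1) i] j ij(3) _ 2(2)] 2(1) desc True by (simp add: transpose_def)
      have "?vi \<circ> adj j \<circ> adj i = ?vj \<circ> adj i \<circ> adj j"
        using True by (auto simp: fun_eq_iff transpose_def)
      then have eq: "f ?vi \<otimes> a j \<otimes> a i = f ?vj \<otimes> a i \<otimes> a j" using 3 4 by simp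
      have "f ?vi \<otimes> a i = f ?vi \<otimes> a j \<otimes> a i \<otimes> a i \<otimes> a j \<otimes> a i" using cl ij i j by simp
      also have "\<dots> = f ?vj \<otimes> (a i \<otimes> a j \<otimes> a i) \<otimes> a j \<otimes> a i"
        unfolding eq using cl by (simp add: m_assoc)
      also have "\<dots> = f ?vj \<otimes> a j \<otimes> a i \<otimes> a j \<otimes> a j \<otimes> a i"
        using a_braid[of i] ij True cl by (simp add: m_assoc)
      finally show ?thesis using cl ij i j by simp
    qed
  qed
  interpret S: group "sym_group n" by (rule sym_group_is_group)
  show ?thesis
  proof
    fix v i j and f :: "(nat \<Rightarrow> nat) \<Rightarrow> 'k"
    assume v: "v \<in> carrier (sym_group n)" and i: "i \<in> {1..<n}" and j: "j \<in> {1..<n}"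
      and less: "perm_weight n (v \<otimes>\<^bsub>sym_group n\<^esub> adj i) < perm_weight n v"
        "perm_weight n (v \<otimes>\<^bsub>sym_group n\<^esub> adj j) < perm_weight n v"
      and f: "f \<in> carrier (sym_group n) \<rightarrow> carrier K"
      and cons: "\<And>u m. \<lbrakk>u \<in> carrier (sym_group n); m \<in> {1..<n}; perm_weight n u < perm_weight n v;
        perm_weight n (u \<otimes>\<^bsub>sym_group n\<^esub> adj m) < perm_weight n v\<rbrakk>
        \<Longrightarrow> f (u \<otimes>\<^bsub>sym_group n\<^esub> adj m) = f u \<otimes> a m"
    have desc: "v (Suc i) < v i" "v (Suc j) < v j"
      using less adj_descent_iff[of v n] v i j by (auto simp: sym_group_carrier sym_group_mult)
    have cons': "\<lbrakk>u permutes {1..n}; 1 \<le> k; k < n; perm_weight n u < perm_weight n v;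
        perm_weight n (u \<circ> adj k) < perm_weight n v\<rbrakk> \<Longrightarrow> f (u \<circ> adj k) = f u \<otimes> a k" for u k
      using cons[of u k] by (simp add: sym_group_carrier sym_group_mult)
    have f': "f p \<in> carrier K" if "p permutes {1..n}" for p
      using f that by (auto simp: sym_group_carrier)
    have "f (v \<circ> adj i) \<otimes> a i = f (v \<circ> adj j) \<otimes> a j"
      using peak[of v i j f] peak[of v j i f] v i j desc f' cons'
      by (cases i j rule: linorder_cases) (simp_all add: sym_group_carrier)
    then show "f (v \<otimes>\<^bsub>sym_group n\<^esub> adj i) \<otimes> inv a i = f (v \<otimes>\<^bsub>sym_group n\<^esub> adj j) \<otimes> inv a j"
      using i j by (simp add: sym_group_mult a_inv)
  next
    fix m assume m: "m \<in> {1..<n}"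
    have "inv\<^bsub>sym_group n\<^esub> adj m = adj m"
      using m adj_permutes by (intro S.inv_equality)
        (auto simp: sym_group_carrier sym_group_mult sym_group_one)
    then show "\<exists>m'\<in>{1..<n}. adj m' = inv\<^bsub>sym_group n\<^esub> adj m \<and> a m' = inv a m"
      using m a_inv by auto
  next
    fix v :: "nat \<Rightarrow> nat" assume "v \<in> carrier (sym_group n)" and ne: "v \<notin> {id}"
    then have v: "v permutes {1..n}" by (simp add: sym_group_carrier)
    obtain k where k: "1 \<le> k" "k < n" "v (Suc k) < v k"
      using no_descent_imp_id[OF v] ne by (metis not_le singletonI)
    then show "\<exists>m\<in>{1..<n}. perm_weight n (v \<otimes>\<^bsub>sym_group n\<^esub> adj m) < perm_weight n v"
      using perm_weight_descent[OF v k] by (intro bexI[of _ k]) (simp_all add: sym_group_mult)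
  next
    fix v :: "nat \<Rightarrow> nat" and m assume "v \<in> {id}" and m: "m \<in> {1..<n}"
    then show "perm_weight n v < perm_weight n (v \<otimes>\<^bsub>sym_group n\<^esub> adj m)"
      using adj_descent_iff[of id n m] by (auto simp: sym_group_mult permutes_id)
  qed (use adj_permutes adj_descent_iff(2) permutes_id in
    \<open>auto simp: sym_group_carrier sym_group_mult\<close>)
qed

lemma sym_group_hom:
  obtains \<rho> where "\<rho> \<in> hom (sym_group n) K" "\<And>i. \<lbrakk>1 \<le> i; i < n\<rbrakk> \<Longrightarrow> \<rho> (adj i) = a i"
proof -
  interpret D: descent "sym_group n" K "{1..<n}" adj a "perm_weight n" "{id}" "\<lambda>_. \<one>"
    by (rule sym_group_descent)
  obtain \<rho> where \<rho>: "\<rho> \<in> carrier (sym_group n) \<rightarrow> carrier K" "\<rho> id = \<one>"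
    and step: "\<And>v m. \<lbrakk>v \<in> carrier (sym_group n); m \<in> {1..<n}\<rbrakk>
      \<Longrightarrow> \<rho> (v \<otimes>\<^bsub>sym_group n\<^esub> adj m) = \<rho> v \<otimes> a m"
    by (rule D.labelling_exists, rule that, assumption) auto
  have cl: "\<rho> p \<in> carrier K" if "p permutes {1..n}" for p
    using \<rho> that by (auto simp: sym_group_carrier)
  have step': "\<rho> (p \<circ> adj i) = \<rho> p \<otimes> a i" if "p permutes {1..n}" "1 \<le> i" "i < n" for p i
    using step[of p i] that by (simp add: sym_group_carrier sym_group_mult)
  have "\<rho> (p \<circ> q) = \<rho> p \<otimes> \<rho> q" if p: "p permutes {1..n}" and "q permutes {1..n}" for p q
    using that(2)
  proof (induction rule: permutes_adj_induct)
    case id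
    then show ?case using \<rho>(2) cl[OF p] by (simp add: id_def)
  next
    case (adj q k)
    have "\<rho> (p \<circ> (q \<circ> adj k)) = \<rho> (p \<circ> q) \<otimes> a k"
      using step'[OF permutes_compose[OF adj(1) p] adj(2,3)] by (simp only: comp_assoc)
    also have "\<dots> = \<rho> p \<otimes> (\<rho> q \<otimes> a k)"
      unfolding adj.IH using cl[OF p] cl[OF adj(1)] adj(2,3) by (simp add: m_assoc)
    also have "\<rho> q \<otimes> a k = \<rho> (q \<circ> adj k)" using step'[OF adj(1-3)] by (rule sym)
    finally show ?case .
  qed
  then have "\<rho> \<in> hom (sym_group n) K"
    using \<rho> by (auto simp: hom_def sym_group_carrier sym_group_mult)
  moreover have "\<rho> (adj i) = a i" if "1 \<le> i" "i < n" for i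
    using step'[OF permutes_id that] \<rho>(2) that by simp
  ultimately show thesis using that by blast
qed

end


section \<open>Products and conjugates in groups\<close>

abbreviation ordered_prod :: "('k, 'x) monoid_scheme \<Rightarrow> (nat \<Rightarrow> 'k) \<Rightarrow> nat list \<Rightarrow> 'k" where
  "ordered_prod K x js \<equiv> foldr (\<lambda>i g. x i \<otimes>\<^bsub>K\<^esub> g) js \<one>\<^bsub>K\<^esub>"

context group
begin

lemma inv_cancel_left [simp]:
  assumes "x \<in> carrier G" "y \<in> carrier G"
  shows "inv x \<otimes> (x \<otimes> y) = y" "x \<otimes> (inv x \<otimes> y) = y"
  using assms by (simp_all flip: m_assoc)

lemma ordered_prod_closed [simp]:
  "(\<And>i. i \<in> set js \<Longrightarrow> x i \<in> carrier G) \<Longrightarrow> ordered_prod G x js \<in> carrier G"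
  by (induction js) auto

lemma ordered_prod_append:
  assumes "\<And>i. i \<in> set js \<union> set ks \<Longrightarrow> x i \<in> carrier G"
  shows "ordered_prod G x (js @ ks) = ordered_prod G x js \<otimes> ordered_prod G x ks"
  using assms by (induction js) (auto simp: m_assoc)

lemma ordered_prod_commute:
  assumes "y \<in> carrier G" "\<And>i. i \<in> set js \<Longrightarrow> x i \<in> carrier G \<and> y \<otimes> x i = x i \<otimes> y"
  shows "y \<otimes> ordered_prod G x js = ordered_prod G x js \<otimes> y"
  using assms(2)
proof (induction js)
  case (Cons j js)
  have cl: "x j \<in> carrier G" "ordered_prod G x js \<in> carrier G" using Cons.prems by auto
  have "y \<otimes> ordered_prod G x (j # js) = (y \<otimes> x j) \<otimes> ordered_prod G x js"
    using assms cl by (simp add: m_assoc)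
  also have "\<dots> = x j \<otimes> (y \<otimes> ordered_prod G x js)" using assms cl Cons.prems by (simp add: m_assoc)
  finally show ?case using assms cl Cons by (simp add: m_assoc)
qed (use assms in simp)

lemma ordered_prod_rev_inv:
  assumes "\<And>i. i \<in> set js \<Longrightarrow> x i \<in> carrier G \<and> inv x i = x i"
  shows "inv ordered_prod G x js = ordered_prod G x (rev js)"
  using assms
proof (induction js)
  case (Cons j js)
  then show ?case
    using ordered_prod_append[of "rev js" "[j]" x] by (simp add: inv_mult_group del: foldr_append)
qed simp

text \<open>
  Equations \<open>p x = x' p\<close> express conjugation by \<open>p\<close> without inverses; this is the form in which the
  action of permutations on generators is used below.
\<close>

lemma conj_commute_iff:
  assumes "p \<in> carrier G" "x \<in> carrier G" "y \<in> carrier G" "x' \<in> carrier G" "y' \<in> carrier G"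
    and "p \<otimes> x = x' \<otimes> p" "p \<otimes> y = y' \<otimes> p"
  shows "x' \<otimes> y' = y' \<otimes> x' \<longleftrightarrow> x \<otimes> y = y \<otimes> x"
proof -
  have "x' \<otimes> y' \<otimes> p = x' \<otimes> p \<otimes> y" "y' \<otimes> x' \<otimes> p = y' \<otimes> p \<otimes> x"
    using assms by (simp_all add: m_assoc)
  then have "x' \<otimes> y' \<otimes> p = p \<otimes> (x \<otimes> y)" "y' \<otimes> x' \<otimes> p = p \<otimes> (y \<otimes> x)"
    using assms by (simp_all flip: m_assoc)
  then show ?thesis
    using assms(1-5) by (metis m_closed Units_eq Units_l_cancel right_cancel)
qed

lemma commute_inv:
  assumes "x \<in> carrier G" "y \<in> carrier G" "x \<otimes> y = y \<otimes> x"
  shows "inv x \<otimes> y = y \<otimes> inv x"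
proof -
  have "inv x \<otimes> (x \<otimes> y) \<otimes> inv x = inv x \<otimes> (y \<otimes> x) \<otimes> inv x" using assms(3) by simp
  moreover have "inv x \<otimes> (x \<otimes> y) \<otimes> inv x = y \<otimes> inv x"
    "inv x \<otimes> (y \<otimes> x) \<otimes> inv x = inv x \<otimes> y"
    using assms(1,2) by (simp_all add: m_assoc)
  ultimately show ?thesis by simp
qed

end


section \<open>Artin's two generators of the braid group\<close>

text \<open>
  For \<open>x = \<sigma>\<close>, \<open>y = \<sigma>\<^sub>1\<close> the element with index \<open>k\<close> is \<open>\<sigma>\<^bsub>k + 1\<^esub>\<close>. Integer indices
  make conjugation by \<open>x\<close> a shift of the index without boundary cases.
\<close>

definition (in monoid) twist :: "'a \<Rightarrow> 'a \<Rightarrow> int \<Rightarrow> 'a" where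
  "twist x y k = x [^] k \<otimes> y \<otimes> x [^] (- k)"

context group
begin

lemma twist_closed [simp]: "\<lbrakk>x \<in> carrier G; y \<in> carrier G\<rbrakk> \<Longrightarrow> twist x y k \<in> carrier G"
  by (simp add: twist_def)

lemma twist_0 [simp]: "y \<in> carrier G \<Longrightarrow> twist x y 0 = y"
  by (simp add: twist_def)

lemma int_pow_twist:
  assumes "x \<in> carrier G" "y \<in> carrier G"
  shows "x [^] l \<otimes> twist x y k = twist x y (l + k) \<otimes> x [^] (l :: int)"
proof -
  have "x [^] (- (l + k)) \<otimes> x [^] l = x [^] (- k)"
    using assms by (simp flip: int_pow_mult)
  then have "twist x y (l + k) \<otimes> x [^] l = x [^] (l + k) \<otimes> y \<otimes> x [^] (- k)"
    unfolding twist_def using assms by (simp add: m_assoc)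
  also have "\<dots> = x [^] l \<otimes> (x [^] k \<otimes> y \<otimes> x [^] (- k))"
    using assms by (simp add: int_pow_mult m_assoc)
  finally show ?thesis by (simp add: twist_def)
qed

lemma mult_twist:
  assumes "x \<in> carrier G" "y \<in> carrier G"
  shows "x \<otimes> twist x y k = twist x y (k + 1) \<otimes> x"
  using int_pow_twist[OF assms, of 1 k] assms by (simp add: add.commute)

lemma twist_commute_shift:
  assumes "x \<in> carrier G" "y \<in> carrier G"
  shows "twist x y (k + j) \<otimes> twist x y (l + j) = twist x y (l + j) \<otimes> twist x y (k + j)
    \<longleftrightarrow> twist x y k \<otimes> twist x y l = twist x y l \<otimes> twist x y k"
  using conj_commute_iff[of "x [^] j" "twist x y k" "twist x y l" "twist x y (k + j)" "twist x y (l + j)"]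
    int_pow_twist[OF assms, of j] assms by (simp add: add.commute)

lemma twist_braid_shift:
  assumes "x \<in> carrier G" "y \<in> carrier G"
    and "twist x y k \<otimes> twist x y l \<otimes> twist x y k = twist x y l \<otimes> twist x y k \<otimes> twist x y l"
  shows "twist x y (k + j) \<otimes> twist x y (l + j) \<otimes> twist x y (k + j)
    = twist x y (l + j) \<otimes> twist x y (k + j) \<otimes> twist x y (l + j)"
proof -
  have tw: "twist x y (i + j) = x [^] j \<otimes> twist x y i \<otimes> inv (x [^] j)" for i
    using int_pow_twist[OF assms(1,2), of j i] assms by (simp add: m_assoc add.commute)
  have "twist x y k \<otimes> twist x y l \<otimes> twist x y k \<otimes> inv (x [^] j)
    = twist x y l \<otimes> twist x y k \<otimes> twist x y l \<otimes> inv (x [^] j)"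
    using assms(3) by simp
  then show ?thesis unfolding tw using assms(1,2) by (simp add: m_assoc)
qed

text \<open>
  The product telescopes: neighbouring powers of \<open>x\<close> combine to a single \<open>x\<close>.
\<close>

lemma prod_twist:
  assumes "x \<in> carrier G" "y \<in> carrier G"
  shows "ordered_prod G (\<lambda>i. twist x y (int i - 1)) [1..<Suc m] = (y \<otimes> x) [^] m \<otimes> x [^] (- int m)"
proof (induction m)
  case (Suc m)
  have "ordered_prod G (\<lambda>i. twist x y (int i - 1)) [1..<Suc (Suc m)]
      = (y \<otimes> x) [^] m \<otimes> x [^] (- int m) \<otimes> twist x y (int m)"
    using Suc assms ordered_prod_append[of "[1..<Suc m]" "[Suc m]" "\<lambda>i. twist x y (int i - 1)"]
    by (simp del: foldr_append)
  also have "\<dots> = (y \<otimes> x) [^] m \<otimes> (x [^] (- int m) \<otimes> twist x y (int m))"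
    using assms by (simp add: m_assoc)
  also have "x [^] (- int m) \<otimes> twist x y (int m) = y \<otimes> x \<otimes> x [^] (- int (Suc m))"
    using int_pow_twist[OF assms, of "- int m" "int m"] int_pow_mult[of x 1 "- int (Suc m)"] assms
    by (simp add: m_assoc)
  finally show ?case using assms by (simp add: m_assoc)
qed simp

lemma pow_mult_rotate:
  assumes "x \<in> carrier G" "y \<in> carrier G"
  shows "x \<otimes> (y \<otimes> x) [^] (m :: nat) = (x \<otimes> y) [^] m \<otimes> x"
proof (induction m)
  case (Suc m)
  have "x \<otimes> (y \<otimes> x) [^] Suc m = (x \<otimes> (y \<otimes> x) [^] m) \<otimes> (y \<otimes> x)"
    using assms by (simp add: m_assoc)
  then show ?case using Suc assms by (simp add: m_assoc)
qed (use assms in simp)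

end

text \<open>
  Artin's presentation of the braid group on \<open>n\<close> strands: \<open>y\<close> is the first half twist and \<open>x\<close> the
  product of all \<open>n - 1\<close> half twists.
\<close>

locale artin = group K for K :: "('k, 'x) monoid_scheme" (structure) +
  fixes n :: nat and x y :: 'k
  assumes n3: "3 \<le> n" and xy_closed [simp]: "x \<in> carrier K" "y \<in> carrier K"
    and pow_eq: "x [^] n = (x \<otimes> y) [^] (n - 1)"
    and comm: "\<And>j :: int. \<lbrakk>2 \<le> j; 2 * j \<le> int n\<rbrakk> \<Longrightarrow> y \<otimes> twist x y j = twist x y j \<otimes> y"
begin

abbreviation "t \<equiv> twist x y"

text \<open>
  \<open>x\<^sup>n\<close> commutes with \<open>x\<close> and, being a power of \<open>x y\<close>, with \<open>x y\<close>. Hence the conjugates of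
  \<open>y\<close> by powers of \<open>x\<close> are indexed by residues modulo \<open>n\<close>, and commutation at distance up to
  \<open>n / 2\<close> extends to all pairs that are not neighbours on the cycle.
\<close>

lemma pow_central: "x [^] n \<otimes> y = y \<otimes> x [^] n"
proof -
  have "(x \<otimes> y) \<otimes> x [^] n = x [^] n \<otimes> (x \<otimes> y)"
    unfolding pow_eq using nat_pow_comm[of "x \<otimes> y" 1 "n - 1"] by simp
  moreover have "x [^] n \<otimes> x = x \<otimes> x [^] n"
    using nat_pow_comm[of x n 1] by simp
  ultimately have "x \<otimes> (y \<otimes> x [^] n) = x \<otimes> (x [^] n \<otimes> y)"
    by (simp add: m_assoc) (simp flip: m_assoc)
  then show ?thesis by simp
qed

lemma t_periodic: "t (k + int n) = t k"
proof -
  have "x [^] int n \<otimes> t 0 = t (int n) \<otimes> x [^] int n" using int_pow_twist[of x y "int n" 0] by simp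
  moreover have "x [^] int n \<otimes> t 0 = t 0 \<otimes> x [^] int n"
    using pow_central by (simp add: int_pow_int)
  ultimately have "t (int n) = t 0" by simp
  moreover have "t (k + i) = x [^] k \<otimes> t i \<otimes> inv (x [^] k)" for i
    using int_pow_twist[of x y k i] by (simp add: m_assoc)
  ultimately show ?thesis by (metis add_0_right)
qed

lemma t_commute:
  assumes "2 \<le> l - k" "l - k \<le> int n - 2"
  shows "t k \<otimes> t l = t l \<otimes> t k"
proof (cases "2 * (l - k) \<le> int n")
  case True
  then show ?thesis using twist_commute_shift[of x y 0 k "l - k"] comm assms by simp
next
  case False
  \<comment> \<open>The distance is more than \<open>n / 2\<close>, so go around the cycle the other way.\<close>
  have "t l \<otimes> t (k + int n) = t (k + int n) \<otimes> t l"
    using twist_commute_shift[of x y 0 l "k + int n - l"] comm[of "k + int n - l"] assms False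
    by (simp add: algebra_simps)
  then show ?thesis by (simp add: t_periodic)
qed

lemma t_prod: "ordered_prod K (\<lambda>i. t (int i - 1)) [1..<n] = x"
proof -
  have "x \<otimes> (y \<otimes> x) [^] (n - 1) = x \<otimes> x [^] n"
    using pow_mult_rotate[of x y "n - 1"] pow_eq nat_pow_comm[of x n 1] by simp
  then have "(y \<otimes> x) [^] (n - 1) = x [^] int n" by (simp add: int_pow_int)
  then have "ordered_prod K (\<lambda>i. t (int i - 1)) [1..<Suc (n - 1)] = x [^] int n \<otimes> x [^] (- int (n - 1))"
    using prod_twist[of x y "n - 1"] by simp
  also have "\<dots> = x [^] (1 :: int)"
    using n3 by (simp add: of_nat_diff flip: int_pow_mult)
  finally show ?thesis using n3 by simp
qed

text \<open>
  Since \<open>x\<close> is the product \<open>t\<^sub>0 t\<^sub>1 R\<close>, where \<open>t\<^sub>0\<close> commutes with \<open>R\<close>, the equation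
  \<open>x t\<^sub>0 = t\<^sub>1 x\<close> reads \<open>t\<^sub>0 t\<^sub>1 t\<^sub>0 R = t\<^sub>1 t\<^sub>0 t\<^sub>1 R\<close>.
\<close>

lemma t_braid: "t k \<otimes> t (k + 1) \<otimes> t k = t (k + 1) \<otimes> t k \<otimes> t (k + 1)"
proof -
  define R where "R = ordered_prod K (\<lambda>i. t (int i - 1)) [3..<n]"
  have R: "R \<in> carrier K" by (simp add: R_def)
  have "[1..<n] = [1, 2] @ [3..<n]"
    using n3 by (simp add: upt_conv_Cons numeral_3_eq_3 numeral_2_eq_2)
  then have x: "x = t 0 \<otimes> t 1 \<otimes> R"
    using t_prod by (simp add: R_def m_assoc)
  have comm: "t 0 \<otimes> R = R \<otimes> t 0"
    unfolding R_def
  proof (rule ordered_prod_commute)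
    fix i assume "i \<in> set [3..<n]"
    then show "t (int i - 1) \<in> carrier K \<and> t 0 \<otimes> t (int i - 1) = t (int i - 1) \<otimes> t 0"
      using t_commute[of "int i - 1" 0] by auto
  qed simp
  have shift: "x \<otimes> t 0 = t 1 \<otimes> x" using mult_twist[of x y 0] by simp
  have "u \<otimes> v \<otimes> u = v \<otimes> u \<otimes> v"
    if "u \<in> carrier K" "v \<in> carrier K" "x = u \<otimes> v \<otimes> R" "u \<otimes> R = R \<otimes> u" "x \<otimes> u = v \<otimes> x" for u v
  proof -
    have "u \<otimes> v \<otimes> u \<otimes> R = v \<otimes> u \<otimes> v \<otimes> R"
      using that(5) R that(1,2,4) unfolding that(3) by (simp add: m_assoc)
    then show ?thesis using R that(1,2) by simp
  qed
  from this[OF _ _ x comm shift] have "t 0 \<otimes> t 1 \<otimes> t 0 = t 1 \<otimes> t 0 \<otimes> t 1"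
    by simp
  then show ?thesis using twist_braid_shift[of x y 0 1 k] by (simp add: add.commute)
qed

end

text \<open>
  The converse direction: elements that satisfy the braid relations are twists of the first one by
  their product, and that pair satisfies Artin's relations.
\<close>

locale braid_elements = group K for K :: "('k, 'x) monoid_scheme" (structure) +
  fixes n :: nat and z :: "nat \<Rightarrow> 'k"
  assumes n3: "3 \<le> n"
    and z_closed [simp]: "\<lbrakk>1 \<le> i; i < n\<rbrakk> \<Longrightarrow> z i \<in> carrier K"
    and z_commute: "\<lbrakk>1 \<le> i; i + 2 \<le> j; j < n\<rbrakk> \<Longrightarrow> z i \<otimes> z j = z j \<otimes> z i"
    and z_braid: "\<lbrakk>1 \<le> i; Suc i < n\<rbrakk> \<Longrightarrow> z i \<otimes> z (Suc i) \<otimes> z i = z (Suc i) \<otimes> z i \<otimes> z (Suc i)"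
begin

definition "zprod = ordered_prod K z [1..<n]"

lemma zprod_closed [simp]: "zprod \<in> carrier K"
  unfolding zprod_def by (rule ordered_prod_closed) simp

lemma zprod_shift:
  assumes i: "1 \<le> i" "Suc i < n"
  shows "zprod \<otimes> z i = z (Suc i) \<otimes> zprod"
proof -
  define L R where "L = ordered_prod K z [1..<i]" and "R = ordered_prod K z [Suc (Suc i)..<n]"
  have cl: "L \<in> carrier K" "R \<in> carrier K" "z i \<in> carrier K" "z (Suc i) \<in> carrier K"
    unfolding L_def R_def using i by (auto intro!: ordered_prod_closed)
  have "[1..<n] = [1..<i] @ i # Suc i # [Suc (Suc i)..<n]"
    using i upt_add_eq_append[of 1 i "n - i"] by (simp add: upt_conv_Cons)
  then have "zprod = L \<otimes> ordered_prod K z (i # Suc i # [Suc (Suc i)..<n])"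
    unfolding zprod_def L_def using i by (simp only:) (rule ordered_prod_append, auto)
  then have zprod: "zprod = L \<otimes> (z i \<otimes> z (Suc i) \<otimes> R)"
    using cl by (simp add: m_assoc flip: R_def)
  have 1: "z i \<otimes> R = R \<otimes> z i"
    unfolding R_def using i by (intro ordered_prod_commute) (auto intro: z_commute)
  have 2: "z (Suc i) \<otimes> L = L \<otimes> z (Suc i)"
    unfolding L_def using i by (intro ordered_prod_commute) (auto intro: z_commute[symmetric])
  have "zprod \<otimes> z i = L \<otimes> (z i \<otimes> z (Suc i) \<otimes> (R \<otimes> z i))" using cl zprod by (simp add: m_assoc)
  also have "\<dots> = L \<otimes> (z i \<otimes> z (Suc i) \<otimes> z i \<otimes> R)" unfolding 1[symmetric] using cl by (simp add: m_assoc)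
  also have "\<dots> = (L \<otimes> z (Suc i)) \<otimes> (z i \<otimes> z (Suc i) \<otimes> R)"
    unfolding z_braid[OF i] using cl by (simp add: m_assoc)
  also have "\<dots> = z (Suc i) \<otimes> zprod" unfolding 2[symmetric] zprod using cl by (simp add: m_assoc)
  finally show ?thesis .
qed

lemma z_twist: "\<lbrakk>1 \<le> i; i < n\<rbrakk> \<Longrightarrow> z i = twist zprod (z 1) (int i - 1)"
proof (induction i rule: nat_induct_at_least[of 1])
  case (Suc i)
  have "z (Suc i) \<otimes> zprod = twist zprod (z 1) (int i) \<otimes> zprod"
    using zprod_shift[of i] mult_twist[of zprod "z 1" "int i - 1"] Suc n3 by simp
  then show ?case using Suc n3 by simp
qed (use n3 in simp)

lemma artin: "artin K n zprod (z 1)"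
proof
  show "3 \<le> n" "zprod \<in> carrier K" "z 1 \<in> carrier K" using n3 by simp_all
  have "ordered_prod K z [1..<Suc (n - 1)] = ordered_prod K (\<lambda>i. twist zprod (z 1) (int i - 1)) [1..<Suc (n - 1)]"
  proof (intro foldr_cong refl)
    fix i g assume "i \<in> set [1..<Suc (n - 1)]"
    then have "z i = twist zprod (z 1) (int i - 1)" by (intro z_twist) auto
    then show "z i \<otimes> g = twist zprod (z 1) (int i - 1) \<otimes> g" by (rule arg_cong)
  qed
  then have "ordered_prod K z [1..<n] = (z 1 \<otimes> zprod) [^] (n - 1) \<otimes> zprod [^] (- int (n - 1))"
    using prod_twist[of zprod "z 1" "n - 1"] n3 by simp
  then have zprod_eq: "zprod = (z 1 \<otimes> zprod) [^] (n - 1) \<otimes> zprod [^] (- int (n - 1))"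
    unfolding zprod_def[symmetric] .
  have z1: "z 1 \<in> carrier K" using n3 by simp
  have "zprod \<otimes> zprod [^] int (n - 1) = (z 1 \<otimes> zprod) [^] (n - 1) \<otimes> zprod [^] (- int (n - 1)) \<otimes> zprod [^] int (n - 1)"
    using arg_cong[OF zprod_eq, of "\<lambda>u. u \<otimes> zprod [^] int (n - 1)"] .
  also have "\<dots> = (z 1 \<otimes> zprod) [^] (n - 1)"
    using z1 by (simp add: m_assoc int_pow_neg)
  finally have "zprod [^] (1 :: int) \<otimes> zprod [^] int (n - 1) = (z 1 \<otimes> zprod) [^] (n - 1)" by simp
  moreover have "1 + int (n - 1) = int n" using n3 by simp
  then have "zprod [^] n = zprod [^] (1 + int (n - 1))" by (simp only: int_pow_int)
  then have "zprod [^] n = zprod [^] (1 :: int) \<otimes> zprod [^] int (n - 1)" by (simp only: int_pow_mult zprod_closed)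
  ultimately have "zprod [^] n = (z 1 \<otimes> zprod) [^] (n - 1)" by simp
  then have "zprod \<otimes> zprod [^] n = (zprod \<otimes> z 1) [^] (n - 1) \<otimes> zprod"
    using pow_mult_rotate[of zprod "z 1" "n - 1"] n3 by simp
  then have "zprod [^] n \<otimes> zprod = (zprod \<otimes> z 1) [^] (n - 1) \<otimes> zprod"
    using nat_pow_comm[of zprod n 1] by simp
  then show "zprod [^] n = (zprod \<otimes> z 1) [^] (n - 1)" using n3 by simp
next
  fix j :: int assume j: "2 \<le> j" "2 * j \<le> int n"
  then have "z 1 \<otimes> z (nat (j + 1)) = z (nat (j + 1)) \<otimes> z 1" by (intro z_commute) auto
  moreover have "z (nat (j + 1)) = twist zprod (z 1) j" using z_twist[of "nat (j + 1)"] j by simp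
  ultimately show "z 1 \<otimes> twist zprod (z 1) j = twist zprod (z 1) j \<otimes> z 1" by simp
qed

end


section \<open>From braids and permutations to basis conjugations\<close>

text \<open>
  The relations between the standard generators of \<open>C\<^sub>n\<close>, which is also known as the welded braid
  group: \<open>a\<close> plays the role of \<open>\<alpha>\<close>, \<open>s\<close> that of \<open>\<sigma>\<close>.
\<close>

locale welded = coxeter +
  fixes s :: "nat \<Rightarrow> 'a"
  assumes n3: "3 \<le> n"
    and s_closed [simp]: "\<lbrakk>1 \<le> i; i < n\<rbrakk> \<Longrightarrow> s i \<in> carrier K"
    and s_commute: "\<lbrakk>1 \<le> i; i + 2 \<le> j; j < n\<rbrakk> \<Longrightarrow> s i \<otimes> s j = s j \<otimes> s i"
    and s_braid: "\<lbrakk>1 \<le> i; Suc i < n\<rbrakk> \<Longrightarrow> s i \<otimes> s (Suc i) \<otimes> s i = s (Suc i) \<otimes> s i \<otimes> s (Suc i)"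
    and sa_commute: "\<lbrakk>1 \<le> i; i < n; 1 \<le> j; j < n; i + 2 \<le> j \<or> j + 2 \<le> i\<rbrakk>
      \<Longrightarrow> a i \<otimes> s j = s j \<otimes> a i"
    and saa: "\<lbrakk>1 \<le> i; Suc i < n\<rbrakk> \<Longrightarrow> s i \<otimes> a (Suc i) \<otimes> a i = a (Suc i) \<otimes> a i \<otimes> s (Suc i)"
    and ssa: "\<lbrakk>1 \<le> i; Suc i < n\<rbrakk> \<Longrightarrow> s i \<otimes> s (Suc i) \<otimes> a i = a (Suc i) \<otimes> s i \<otimes> s (Suc i)"
begin

definition \<rho> :: "(nat \<Rightarrow> nat) \<Rightarrow> 'a" where
  "\<rho> = (SOME \<rho>. \<rho> \<in> hom (sym_group n) K \<and> (\<forall>i. 1 \<le> i \<longrightarrow> i < n \<longrightarrow> \<rho> (adj i) = a i))"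

lemma \<rho>_hom: "\<rho> \<in> hom (sym_group n) K" and \<rho>_adj: "\<lbrakk>1 \<le> i; i < n\<rbrakk> \<Longrightarrow> \<rho> (adj i) = a i"
proof -
  have "\<exists>\<rho>. \<rho> \<in> hom (sym_group n) K \<and> (\<forall>i. 1 \<le> i \<longrightarrow> i < n \<longrightarrow> \<rho> (adj i) = a i)"
    using sym_group_hom by metis
  from someI_ex[OF this] show "\<rho> \<in> hom (sym_group n) K"
    and "\<lbrakk>1 \<le> i; i < n\<rbrakk> \<Longrightarrow> \<rho> (adj i) = a i" by (auto simp: \<rho>_def)
qed

lemma \<rho>_closed [simp]: "p permutes {1..n} \<Longrightarrow> \<rho> p \<in> carrier K"
  using \<rho>_hom by (auto simp: hom_def sym_group_carrier)

lemma \<rho>_comp: "\<lbrakk>p permutes {1..n}; q permutes {1..n}\<rbrakk> \<Longrightarrow> \<rho> (p \<circ> q) = \<rho> p \<otimes> \<rho> q"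
  using \<rho>_hom by (auto simp: hom_def sym_group_carrier sym_group_mult)

lemma \<rho>_id: "\<rho> id = \<one>"
  using hom_one[OF \<rho>_hom sym_group_is_group is_group] by (simp add: sym_group_one)

text \<open>
  In \<open>C\<^sub>n\<close>, the product \<open>\<sigma>\<^sub>1 \<alpha>\<^sub>1\<close> sends \<open>x\<^sub>2\<close> to \<open>x\<^sub>1 x\<^sub>2 x\<^sub>1\<^sup>-\<^sup>1\<close> and fixes the other basis elements,
  so it is the basis conjugation with indices \<open>2\<close> and \<open>1\<close>. The others are its conjugates by
  permutations.
\<close>

definition e :: "nat \<Rightarrow> nat \<Rightarrow> 'a" where
  "e i j = (let p = SOME p. p permutes {1..n} \<and> p 2 = i \<and> p 1 = j
    in \<rho> p \<otimes> (s 1 \<otimes> a 1) \<otimes> inv \<rho> p)"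

text \<open>
  This makes \<open>e\<close> independent of the chosen permutation. A permutation that fixes \<open>1\<close> and \<open>2\<close> is
  reached from the identity by adjacent transpositions that create descents; none of them can
  involve the positions \<open>1\<close> or \<open>2\<close>, and the remaining \<open>a k\<close> are far from \<open>s 1\<close> and \<open>a 1\<close>.
\<close>

lemma stabilizer_commute:
  assumes "p permutes {1..n}" "p 1 = 1" "p 2 = 2"
  shows "\<rho> p \<otimes> (s 1 \<otimes> a 1) = (s 1 \<otimes> a 1) \<otimes> \<rho> p"
proof -
  have d: "s 1 \<otimes> a 1 \<in> carrier K" using n3 by simp
  have "p 1 = 1 \<longrightarrow> p 2 = 2 \<longrightarrow> \<rho> p \<otimes> (s 1 \<otimes> a 1) = (s 1 \<otimes> a 1) \<otimes> \<rho> p"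
    using assms(1)
  proof (induction rule: permutes_adj_induct)
    case id
    then show ?case using d by (simp add: \<rho>_id flip: id_def)
  next
    case (adj p k)
    show ?case
    proof (intro impI)
      assume fixed: "(p \<circ> adj k) 1 = 1" "(p \<circ> adj k) 2 = 2"
      have inj: "p i \<noteq> p j" if "i \<noteq> j" for i j
        using permutes_inj[OF adj(1)] that by (simp add: inj_eq)
      have pos: "1 \<le> p 2" using permutes_in_image[OF adj(1), of 2] n3 by simp
      have "k \<noteq> 1" using fixed adj(4) by (auto simp: transpose_def numeral_2_eq_2)
      moreover have "k \<noteq> 2"
      proof
        assume "k = 2"
        then have "p 1 = 1" "p (Suc 2) = 2" using fixed by (auto simp: transpose_def)
        then show False using adj(4) pos inj[of 1 2] \<open>k = 2\<close> by simp
      qed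
      ultimately have k: "3 \<le> k" using adj(2) by linarith
      have cl: "\<rho> p \<in> carrier K" "a k \<in> carrier K" "s 1 \<in> carrier K" "a 1 \<in> carrier K"
        using adj n3 by simp_all
      have ak: "a k \<otimes> (s 1 \<otimes> a 1) = (s 1 \<otimes> a 1) \<otimes> a k"
      proof -
        have "a k \<otimes> (s 1 \<otimes> a 1) = (a k \<otimes> s 1) \<otimes> a 1" using cl by (simp add: m_assoc)
        also have "\<dots> = s 1 \<otimes> (a k \<otimes> a 1)"
          using sa_commute[of k 1] k adj cl by (simp add: m_assoc)
        also have "\<dots> = s 1 \<otimes> (a 1 \<otimes> a k)" using a_commute[of 1 k] k adj by simp
        finally show ?thesis using cl by (simp add: m_assoc)
      qed
      have "p 1 = 1" "p 2 = 2" using fixed k by (auto simp: transpose_def)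
      then have p: "\<rho> p \<otimes> (s 1 \<otimes> a 1) = (s 1 \<otimes> a 1) \<otimes> \<rho> p" using adj by blast
      have "\<rho> (p \<circ> adj k) = \<rho> p \<otimes> a k"
        using \<rho>_comp[OF adj(1) adj_permutes[OF adj(2,3)]] \<rho>_adj[OF adj(2,3)] by simp
      moreover have "\<rho> p \<otimes> a k \<otimes> (s 1 \<otimes> a 1) = (\<rho> p \<otimes> (s 1 \<otimes> a 1)) \<otimes> a k"
        using ak cl d by (simp only: m_assoc m_closed)
      moreover have "\<dots> = (s 1 \<otimes> a 1) \<otimes> (\<rho> p \<otimes> a k)"
        unfolding p using cl d by (simp only: m_assoc m_closed)
      ultimately show "\<rho> (p \<circ> adj k) \<otimes> (s 1 \<otimes> a 1) = (s 1 \<otimes> a 1) \<otimes> \<rho> (p \<circ> adj k)"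
        by (simp only:)
    qed
  qed
  then show ?thesis using assms by blast
qed

lemma conj_base:
  assumes p: "p permutes {1..n}"
  shows "\<rho> p \<otimes> (s 1 \<otimes> a 1) = e (p 2) (p 1) \<otimes> \<rho> p" and e_base_closed: "e (p 2) (p 1) \<in> carrier K"
proof -
  define q where "q = (SOME q. q permutes {1..n} \<and> q 2 = p 2 \<and> q 1 = p 1)"
  have "\<exists>q. q permutes {1..n} \<and> q 2 = p 2 \<and> q 1 = p 1" using p by blast
  from someI_ex[OF this] have q: "q permutes {1..n}" "q 2 = p 2" "q 1 = p 1" by (auto simp: q_def)
  define d where "d = s 1 \<otimes> a 1"
  define r where "r = inv' q \<circ> p"
  have qi: "inv' q permutes {1..n}" using permutes_inv[OF q(1)] .
  have r: "r permutes {1..n}" unfolding r_def using permutes_compose[OF p qi] .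
  have "r 1 = 1" "r 2 = 2"
    using q permutes_inverses(2)[OF q(1)] by (simp_all add: r_def) (metis q(2,3))+
  then have rd: "\<rho> r \<otimes> d = d \<otimes> \<rho> r" unfolding d_def using stabilizer_commute[OF r] by blast
  have "q \<circ> r = p" using permutes_inverses(1)[OF q(1)] by (simp add: r_def fun_eq_iff)
  then have pr: "\<rho> p = \<rho> q \<otimes> \<rho> r" using \<rho>_comp[OF q(1) r] by simp
  have e: "e (p 2) (p 1) = \<rho> q \<otimes> d \<otimes> inv \<rho> q" by (simp add: e_def q_def d_def Let_def)
  have cl: "d \<in> carrier K" "\<rho> q \<in> carrier K" "\<rho> r \<in> carrier K"
    using q r n3 by (simp_all add: d_def)
  then show "e (p 2) (p 1) \<in> carrier K" unfolding e by simp
  have "\<rho> p \<otimes> d = \<rho> q \<otimes> (d \<otimes> \<rho> r)" unfolding pr rd[symmetric] using cl by (simp add: m_assoc)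
  also have "\<dots> = e (p 2) (p 1) \<otimes> \<rho> p" unfolding e pr using cl by (simp add: m_assoc)
  finally show "\<rho> p \<otimes> (s 1 \<otimes> a 1) = e (p 2) (p 1) \<otimes> \<rho> p" by (simp add: d_def)
qed

lemma index_pair:
  assumes "i \<in> {1..n}" "j \<in> {1..n}" "i \<noteq> j"
  obtains p where "p permutes {1..n}" "p 2 = i" "p 1 = j"
  using permutes_extend[of "[2, 1]" "[i, j]" "{1..n}"] assms n3 by auto

lemma e_closed [simp]: "\<lbrakk>i \<in> {1..n}; j \<in> {1..n}; i \<noteq> j\<rbrakk> \<Longrightarrow> e i j \<in> carrier K"
  using index_pair e_base_closed by metis

lemma \<rho>_e:
  assumes p: "p permutes {1..n}" and ij: "i \<in> {1..n}" "j \<in> {1..n}" "i \<noteq> j"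
  shows "\<rho> p \<otimes> e i j = e (p i) (p j) \<otimes> \<rho> p"
proof -
  obtain q where q: "q permutes {1..n}" "q 2 = i" "q 1 = j" using index_pair ij by blast
  have pq: "p \<circ> q permutes {1..n}" using permutes_compose[OF q(1) p] .
  have "p i \<in> {1..n}" "p j \<in> {1..n}" "p i \<noteq> p j"
    using permutes_in_image[OF p] permutes_inj[OF p] ij by (auto simp: inj_eq)
  then have cl: "\<rho> p \<in> carrier K" "\<rho> q \<in> carrier K" "e i j \<in> carrier K" "e (p i) (p j) \<in> carrier K"
      "s 1 \<otimes> a 1 \<in> carrier K"
    using p q ij n3 by simp_all
  have "\<rho> p \<otimes> e i j \<otimes> \<rho> q = \<rho> p \<otimes> (\<rho> q \<otimes> (s 1 \<otimes> a 1))"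
    using conj_base[OF q(1)] q cl by (simp only: m_assoc)
  also have "\<dots> = \<rho> (p \<circ> q) \<otimes> (s 1 \<otimes> a 1)" unfolding \<rho>_comp[OF p q(1)] using cl by (simp only: m_assoc)
  also have "\<dots> = e (p i) (p j) \<otimes> \<rho> (p \<circ> q)" using conj_base[OF pq] q by simp
  also have "\<dots> = e (p i) (p j) \<otimes> \<rho> p \<otimes> \<rho> q" unfolding \<rho>_comp[OF p q(1)] using cl by (simp only: m_assoc)
  finally show ?thesis using cl by simp
qed

lemma a_e:
  assumes "1 \<le> k" "k < n" "i \<in> {1..n}" "j \<in> {1..n}" "i \<noteq> j"
  shows "a k \<otimes> e i j = e (adj k i) (adj k j) \<otimes> a k"
  using \<rho>_e[OF adj_permutes assms(3-5), of k] \<rho>_adj assms by simp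

text \<open>
  Conjugation by \<open>a i a (i + 1)\<close> shifts both \<open>s i\<close>, by the relation \<open>saa\<close>, and \<open>a i\<close>, by the braid
  relation; so it takes \<open>s i a i\<close> to the next element of this form.
\<close>

lemma e_Suc: "\<lbrakk>1 \<le> i; i < n\<rbrakk> \<Longrightarrow> e (Suc i) i = s i \<otimes> a i"
proof (induction i rule: nat_induct_at_least[of 1])
  case base
  have "\<one> \<otimes> (s 1 \<otimes> a 1) = e 2 1 \<otimes> \<one>"
    using conj_base[OF permutes_id] \<rho>_id by (simp flip: id_def)
  then show ?case using n3 by (simp add: numeral_2_eq_2)
next
  case (Suc i)
  have i: "1 \<le> i" "i < n" "Suc i < n" using Suc by auto
  have cl: "a i \<in> carrier K" "a (Suc i) \<in> carrier K" "s i \<in> carrier K" "s (Suc i) \<in> carrier K"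
    using i by simp_all
  have "a (Suc i) \<otimes> e (Suc i) i = e (Suc (Suc i)) i \<otimes> a (Suc i)"
    using a_e[of "Suc i" "Suc i" i] i by (simp add: transpose_def)
  moreover have "a i \<otimes> e (Suc (Suc i)) i = e (Suc (Suc i)) (Suc i) \<otimes> a i"
    using a_e[of i "Suc (Suc i)" i] i by (simp add: transpose_def)
  moreover have ecl: "e (Suc i) i \<in> carrier K" "e (Suc (Suc i)) i \<in> carrier K"
      "e (Suc (Suc i)) (Suc i) \<in> carrier K" using i by simp_all
  ultimately have 1: "a i \<otimes> a (Suc i) \<otimes> e (Suc i) i = e (Suc (Suc i)) (Suc i) \<otimes> (a i \<otimes> a (Suc i))"
    using cl by (metis m_assoc m_closed)
  have 2: "a i \<otimes> a (Suc i) \<otimes> s i = s (Suc i) \<otimes> (a i \<otimes> a (Suc i))"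
  proof -
    have "a i \<otimes> a (Suc i) \<otimes> s i \<otimes> (a (Suc i) \<otimes> a i)
        = a i \<otimes> a (Suc i) \<otimes> (s i \<otimes> a (Suc i) \<otimes> a i)" using cl by (simp add: m_assoc)
    also have "\<dots> = a i \<otimes> (a (Suc i) \<otimes> a (Suc i)) \<otimes> a i \<otimes> s (Suc i)"
      unfolding saa[OF i(1,3)] using cl by (simp add: m_assoc)
    also have "\<dots> = s (Suc i)" using cl i by (simp add: a_square)
    finally have f: "a i \<otimes> a (Suc i) \<otimes> s i \<otimes> (a (Suc i) \<otimes> a i) = s (Suc i)" .
    have "s (Suc i) \<otimes> (a i \<otimes> a (Suc i))
        = a i \<otimes> a (Suc i) \<otimes> s i \<otimes> (a (Suc i) \<otimes> a i) \<otimes> (a i \<otimes> a (Suc i))" by (simp only: f)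
    also have "\<dots> = a i \<otimes> a (Suc i) \<otimes> s i" using cl i by (simp flip: m_assoc)
    finally show ?thesis by (rule sym)
  qed
  have "s (Suc i) \<otimes> a (Suc i) \<otimes> (a i \<otimes> a (Suc i)) = s (Suc i) \<otimes> (a (Suc i) \<otimes> a i \<otimes> a (Suc i))"
    using cl by (simp add: m_assoc)
  also have "\<dots> = (s (Suc i) \<otimes> (a i \<otimes> a (Suc i))) \<otimes> a i"
    unfolding a_braid[OF i(1,3), symmetric] using cl by (simp add: m_assoc)
  also have "\<dots> = a i \<otimes> a (Suc i) \<otimes> (s i \<otimes> a i)" unfolding 2[symmetric] using cl by (simp add: m_assoc)
  also have "s i \<otimes> a i = e (Suc i) i" using Suc by simp
  finally have "s (Suc i) \<otimes> a (Suc i) \<otimes> (a i \<otimes> a (Suc i)) = e (Suc (Suc i)) (Suc i) \<otimes> (a i \<otimes> a (Suc i))"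
    using 1 by simp
  then show ?case using cl ecl by simp
qed

lemma s_eq: "\<lbrakk>1 \<le> i; i < n\<rbrakk> \<Longrightarrow> s i = e (Suc i) i \<otimes> a i"
  by (simp add: e_Suc m_assoc a_square)

text \<open>
  One of McCool's relations. Conjugation by permutations reduces each of them to one choice of
  indices.
\<close>

lemma e_disjoint_commute:
  assumes ijkl: "distinct [i, j, k, l]" "{i, j, k, l} \<subseteq> {1..n}"
  shows "e i j \<otimes> e k l = e k l \<otimes> e i j"
proof -
  have "card {i, j, k, l} \<le> n" using card_mono[OF _ ijkl(2)] by simp
  then have n4: "4 \<le> n" using ijkl(1) by auto
  then obtain p where p: "p permutes {1..n}" "p 2 = i" "p 1 = j" "p 4 = k" "p 3 = l"
    using permutes_extend[of "[2, 1, 4, 3]" "[i, j, k, l]" "{1..n}"] ijkl by auto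
  have e21: "e 2 1 = s 1 \<otimes> a 1" and e43: "e 4 3 = s 3 \<otimes> a 3"
    using e_Suc[of 1] e_Suc[of 3] n4 by (simp_all add: numeral_2_eq_2)
  have cl: "s 1 \<in> carrier K" "a 1 \<in> carrier K" "s 3 \<in> carrier K" "a 3 \<in> carrier K" using n4 by simp_all
  have "e 2 1 \<otimes> e 4 3 = s 1 \<otimes> (a 1 \<otimes> s 3) \<otimes> a 3" unfolding e21 e43 using cl by (simp add: m_assoc)
  also have "\<dots> = (s 1 \<otimes> s 3) \<otimes> (a 1 \<otimes> a 3)"
    using sa_commute[of 1 3] n4 cl by (simp add: m_assoc)
  also have "\<dots> = s 3 \<otimes> (s 1 \<otimes> a 3) \<otimes> a 1"
    using s_commute[of 1 3] a_commute[of 1 3] n4 cl by (simp add: m_assoc)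
  also have "s 1 \<otimes> a 3 = a 3 \<otimes> s 1" using sa_commute[of 3 1] n4 by simp
  also have "s 3 \<otimes> (a 3 \<otimes> s 1) \<otimes> a 1 = e 4 3 \<otimes> e 2 1" unfolding e21 e43 using cl by (simp add: m_assoc)
  finally have "e 2 1 \<otimes> e 4 3 = e 4 3 \<otimes> e 2 1" .
  then show ?thesis
    using conj_commute_iff[of "\<rho> p" "e 2 1" "e 4 3" "e i j" "e k l"]
      \<rho>_e[OF p(1), of 2 1] \<rho>_e[OF p(1), of 4 3] p ijkl n4 by simp
qed

text \<open>
  Write \<open>s 1 = e 2 1 A\<close> and \<open>s 2 = e 3 2 B\<close> with the transpositions \<open>A\<close>, \<open>B\<close>, and move these to
  the right. The relation \<open>ssa\<close> becomes the first statement, because both sides end in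
  \<open>A B A = B A B\<close>; the braid relation becomes \<open>e 2 1 e 3 1 e 3 2 = e 3 2 e 3 1 e 2 1\<close>, which
  together with the first statement is the second one.
\<close>

lemma e_same_conjugator_21_31: "e 2 1 \<otimes> e 3 1 = e 3 1 \<otimes> e 2 1"
  and e_triangle_321: "e 3 1 \<otimes> e 2 1 \<otimes> e 3 2 = e 3 2 \<otimes> e 3 1 \<otimes> e 2 1"
proof -
  define A B where "A = a 1" and "B = a 2"
  have cl: "A \<in> carrier K" "B \<in> carrier K" "e 2 1 \<in> carrier K" "e 3 1 \<in> carrier K" "e 3 2 \<in> carrier K"
    using n3 by (simp_all add: A_def B_def)
  have s1: "s 1 = e 2 1 \<otimes> A" and s2: "s 2 = e 3 2 \<otimes> B"
    using s_eq[of 1] s_eq[of 2] n3 by (simp_all add: A_def B_def numeral_2_eq_2 numeral_3_eq_3)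
  have B21: "B \<otimes> e 2 1 = e 3 1 \<otimes> B" and B31: "B \<otimes> e 3 1 = e 2 1 \<otimes> B" and A32: "A \<otimes> e 3 2 = e 3 1 \<otimes> A"
    and A31: "A \<otimes> e 3 1 = e 3 2 \<otimes> A"
    using a_e[of 2 2 1] a_e[of 2 3 1] a_e[of 1 3 2] a_e[of 1 3 1] n3
    by (simp_all add: A_def B_def transpose_def numeral_2_eq_2 numeral_3_eq_3)
  have AB21: "A \<otimes> (B \<otimes> e 2 1) = e 3 2 \<otimes> (A \<otimes> B)"
    unfolding B21 using A31 cl by (metis m_assoc)
  have s12: "s 1 \<otimes> s 2 = e 2 1 \<otimes> e 3 1 \<otimes> (A \<otimes> B)"
  proof -
    have "s 1 \<otimes> s 2 = e 2 1 \<otimes> (A \<otimes> e 3 2) \<otimes> B" unfolding s1 s2 using cl by (simp add: m_assoc)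
    then show ?thesis unfolding A32 using cl by (simp add: m_assoc)
  qed
  have ABA: "A \<otimes> B \<otimes> A = B \<otimes> A \<otimes> B" using a_braid[of 1] n3 by (simp add: A_def B_def numeral_2_eq_2)
  have BE: "B \<otimes> (e 2 1 \<otimes> e 3 1 \<otimes> (A \<otimes> B)) = e 3 1 \<otimes> e 2 1 \<otimes> (A \<otimes> B \<otimes> A)"
  proof -
    have "B \<otimes> (e 2 1 \<otimes> e 3 1 \<otimes> (A \<otimes> B)) = (B \<otimes> e 2 1) \<otimes> e 3 1 \<otimes> (A \<otimes> B)"
      using cl by (simp add: m_assoc)
    also have "\<dots> = e 3 1 \<otimes> (B \<otimes> e 3 1) \<otimes> (A \<otimes> B)" unfolding B21 using cl by (simp add: m_assoc)
    also have "\<dots> = e 3 1 \<otimes> e 2 1 \<otimes> (B \<otimes> A \<otimes> B)" unfolding B31 using cl by (simp add: m_assoc)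
    finally show ?thesis by (simp only: ABA)
  qed
  have "s 1 \<otimes> s 2 \<otimes> A = B \<otimes> (s 1 \<otimes> s 2)"
    using ssa[of 1] n3 cl by (simp add: A_def B_def numeral_2_eq_2 m_assoc)
  then have "e 2 1 \<otimes> e 3 1 \<otimes> (A \<otimes> B \<otimes> A) = e 3 1 \<otimes> e 2 1 \<otimes> (A \<otimes> B \<otimes> A)"
    unfolding s12 BE using cl by (simp add: m_assoc)
  then show comm: "e 2 1 \<otimes> e 3 1 = e 3 1 \<otimes> e 2 1" using cl by simp
  have "s 1 \<otimes> s 2 \<otimes> s 1 = s 2 \<otimes> (s 1 \<otimes> s 2)"
    using s_braid[of 1] n3 by (simp add: m_assoc numeral_2_eq_2)
  moreover have "s 1 \<otimes> s 2 \<otimes> s 1 = e 2 1 \<otimes> e 3 1 \<otimes> (A \<otimes> (B \<otimes> e 2 1)) \<otimes> A"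
    unfolding s12 unfolding s1 using cl by (simp add: m_assoc)
  moreover have "s 2 \<otimes> (s 1 \<otimes> s 2) = e 3 2 \<otimes> (B \<otimes> (e 2 1 \<otimes> e 3 1 \<otimes> (A \<otimes> B)))"
    unfolding s12 unfolding s2 using cl by (simp add: m_assoc)
  ultimately have "e 2 1 \<otimes> e 3 1 \<otimes> e 3 2 \<otimes> (A \<otimes> B \<otimes> A) = e 3 2 \<otimes> e 3 1 \<otimes> e 2 1 \<otimes> (A \<otimes> B \<otimes> A)"
    unfolding AB21 BE using cl by (simp add: m_assoc)
  then show "e 3 1 \<otimes> e 2 1 \<otimes> e 3 2 = e 3 2 \<otimes> e 3 1 \<otimes> e 2 1" using cl comm by simp
qed

lemma index_triple:
  assumes "distinct [i, j, k]" "{i, j, k} \<subseteq> {1..n}"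
  obtains p where "p permutes {1..n}" "p 3 = i" "p 2 = j" "p 1 = k"
  using permutes_extend[of "[3, 2, 1]" "[i, j, k]" "{1..n}"] assms n3 by auto

lemma e_same_conjugator_commute:
  assumes ijk: "distinct [i, j, k]" "{i, j, k} \<subseteq> {1..n}"
  shows "e i k \<otimes> e j k = e j k \<otimes> e i k"
proof -
  obtain p where p: "p permutes {1..n}" "p 3 = i" "p 2 = j" "p 1 = k" using index_triple ijk by blast
  show ?thesis
    using conj_commute_iff[of "\<rho> p" "e 2 1" "e 3 1" "e j k" "e i k"] e_same_conjugator_21_31
      \<rho>_e[OF p(1), of 2 1] \<rho>_e[OF p(1), of 3 1] p ijk n3 by simp
qed

lemma e_triangle:
  assumes ijk: "distinct [i, j, k]" "{i, j, k} \<subseteq> {1..n}"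
  shows "e i k \<otimes> e j k \<otimes> e i j = e i j \<otimes> (e i k \<otimes> e j k)"
proof -
  obtain p where p: "p permutes {1..n}" "p 3 = i" "p 2 = j" "p 1 = k" using index_triple ijk by blast
  have cl: "e 3 1 \<in> carrier K" "e 2 1 \<in> carrier K" "e 3 2 \<in> carrier K" "\<rho> p \<in> carrier K"
    "e i k \<in> carrier K" "e j k \<in> carrier K" "e i j \<in> carrier K"
    using n3 p ijk by simp_all
  have "\<rho> p \<otimes> (e 3 1 \<otimes> e 2 1) = (\<rho> p \<otimes> e 3 1) \<otimes> e 2 1" using cl by (simp add: m_assoc)
  also have "\<dots> = e i k \<otimes> (\<rho> p \<otimes> e 2 1)" using \<rho>_e[OF p(1), of 3 1] p n3 cl by (simp add: m_assoc)
  also have "\<dots> = (e i k \<otimes> e j k) \<otimes> \<rho> p" using \<rho>_e[OF p(1), of 2 1] p n3 cl by (simp add: m_assoc)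
  finally have 1: "\<rho> p \<otimes> (e 3 1 \<otimes> e 2 1) = (e i k \<otimes> e j k) \<otimes> \<rho> p" .
  have 2: "\<rho> p \<otimes> e 3 2 = e i j \<otimes> \<rho> p" using \<rho>_e[OF p(1), of 3 2] p n3 by simp
  show ?thesis
    using conj_commute_iff[OF _ _ _ _ _ 1 2] e_triangle_321 cl by (simp add: m_assoc)
qed

end


section \<open>Words of the free group\<close>

text \<open>
  The simplifier would turn \<open>F n\<close>, which contains \<open>{1..n}\<close>, into a term with \<open>{Suc 0..n}\<close>, to which
  facts about \<open>F n\<close> no longer apply.
\<close>

declare One_nat_def [simp del]

abbreviation winv :: "('a \<times> bool) list \<Rightarrow> ('a \<times> bool) list" where
  "winv w \<equiv> rev (map flip w)"

lemma flip_eq_iff [simp]: "flip a = flip b \<longleftrightarrow> a = b"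
  by (metis flip_flip)

lemma reduced_iff_successively: "reduced w \<longleftrightarrow> successively (\<lambda>a b. b \<noteq> flip a) w"
  by (induction w rule: reduced.induct) auto

lemma reduced_winv [simp]: "reduced (winv w) \<longleftrightarrow> reduced w"
  unfolding reduced_iff_successively successively_rev successively_map
  by (rule arg_cong2[where f = successively, OF _ refl]) (auto simp: fun_eq_iff)

lemma reduced_appendD: "reduced (u @ v) \<Longrightarrow> reduced u" "reduced (u @ v) \<Longrightarrow> reduced v"
  by (simp_all add: reduced_iff_successively successively_append_iff)

lemma reduced_join: "\<lbrakk>reduced (u @ [a]); reduced (a # v)\<rbrakk> \<Longrightarrow> reduced (u @ a # v)"
  by (auto simp: reduced_iff_successively successively_append_iff)

lemma push_reduced: "reduced (a # w) \<Longrightarrow> push a w = a # w"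
  by (cases w) auto

lemma foldr_push_reduced: "reduced (u @ v) \<Longrightarrow> foldr push u v = u @ v"
proof (induction u)
  case (Cons a u)
  then have "reduced (u @ v)" by (simp add: reduced_Cons)
  then show ?case using Cons push_reduced[of a "u @ v"] by simp
qed simp

lemma length_foldr_push: "length (foldr push u v) \<le> length u + length v"
proof (induction u)
  case (Cons a u)
  have "length (push a w) \<le> Suc (length w)" for w by (cases w) auto
  then show ?case using Cons by (simp add: le_trans[OF _ Suc_leI])  (meson Suc_le_mono le_trans)
qed simp

lemma carrier_free_group: "w \<in> carrier (free_group X) \<longleftrightarrow> reduced w \<and> fst ` set w \<subseteq> X"
  by (simp add: free_group_def)

lemma mult_free_group: "u \<otimes>\<^bsub>free_group X\<^esub> v = foldr push u v"
  by (simp add: free_group_def)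

lemma one_free_group: "\<one>\<^bsub>free_group X\<^esub> = []"
  by (simp add: free_group_def)

lemma gen_closed [simp]: "gen x \<in> carrier (free_group X) \<longleftrightarrow> x \<in> X"
  by (simp add: carrier_free_group gen_def)

lemma winv_closed: "w \<in> carrier (free_group X) \<Longrightarrow> winv w \<in> carrier (free_group X)"
  by (simp add: carrier_free_group image_image)

lemma inv_free_group:
  assumes "w \<in> carrier (free_group X)"
  shows "inv\<^bsub>free_group X\<^esub> w = winv w"
proof (rule group.inv_equality[OF group_free_group _ assms winv_closed[OF assms]])
  show "winv w \<otimes>\<^bsub>free_group X\<^esub> w = \<one>\<^bsub>free_group X\<^esub>"
    using foldr_push_inverse[of "[]" w] assms
    by (simp add: mult_free_group one_free_group foldr_push_Nil carrier_free_group)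
qed

lemma mult_reduced: "reduced (u @ v) \<Longrightarrow> u \<otimes>\<^bsub>free_group X\<^esub> v = u @ v"
  by (simp add: mult_free_group foldr_push_reduced)

lemma letter_cases:
  assumes "fst a \<in> X"
  shows "[a] = (if snd a then gen (fst a) else inv\<^bsub>free_group X\<^esub> gen (fst a))"
proof -
  have "inv\<^bsub>free_group X\<^esub> gen (fst a) = winv (gen (fst a))"
    using assms by (simp add: inv_free_group)
  then show ?thesis by (cases a) (auto simp: gen_def flip_def)
qed

lemma free_ext_gen: "monoid G \<Longrightarrow> \<iota> x \<in> carrier G \<Longrightarrow> free_ext G \<iota> (gen x) = \<iota> x"
  by (simp add: free_ext_def gen_def monoid.r_one)

lemma hom_eq_free_ext:
  assumes G: "group G" and \<phi>: "\<phi> \<in> hom (free_group X) G" and w: "w \<in> carrier (free_group X)"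
  shows "\<phi> w = free_ext G (\<lambda>x. \<phi> (gen x)) w"
proof -
  interpret group_hom "free_group X" G \<phi>
    by (intro group_hom.intro group_hom_axioms.intro group_free_group G \<phi>)
  show ?thesis using w
  proof (induction w)
    case Nil
    then show ?case using hom_one by (simp add: free_ext_def one_free_group)
  next
    case (Cons a w)
    then have a: "fst a \<in> X" and red: "reduced ([a] @ w)" and w: "w \<in> carrier (free_group X)"
      and cl: "[a] \<in> carrier (free_group X)"
      by (auto simp: carrier_free_group reduced_Cons)
    have "\<phi> (a # w) = \<phi> [a] \<otimes>\<^bsub>G\<^esub> \<phi> w"
      using hom_mult[OF cl w] mult_reduced[OF red, of X] by simp
    moreover have "\<phi> [a] = (if snd a then \<phi> (gen (fst a)) else inv\<^bsub>G\<^esub> \<phi> (gen (fst a)))"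
      unfolding letter_cases[OF a] using a by simp
    ultimately show ?case using Cons w by (simp add: free_ext_def)
  qed
qed


section \<open>The group of conjugating automorphisms\<close>

type_synonym word_map = "(nat \<times> bool) list \<Rightarrow> (nat \<times> bool) list"

locale conj_auts =
  fixes n :: nat
  assumes n3: "3 \<le> n"
begin

abbreviation "C \<equiv> conj_aut_group n"

abbreviation F_times (infixl "\<otimes>\<^sub>F" 70) where "u \<otimes>\<^sub>F v \<equiv> u \<otimes>\<^bsub>F n\<^esub> v"
abbreviation F_inverse ("inv\<^sub>F _" [81] 80) where "inv\<^sub>F w \<equiv> inv\<^bsub>F n\<^esub> w"
abbreviation F_unit ("\<one>\<^sub>F") where "\<one>\<^sub>F \<equiv> \<one>\<^bsub>F n\<^esub>"
abbreviation C_times (infixl "\<otimes>\<^sub>C" 70) where "\<phi> \<otimes>\<^sub>C \<psi> \<equiv> \<phi> \<otimes>\<^bsub>C\<^esub> \<psi>"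
abbreviation C_inverse ("inv\<^sub>C _" [81] 80) where "inv\<^sub>C \<phi> \<equiv> inv\<^bsub>C\<^esub> \<phi>"
abbreviation C_unit ("\<one>\<^sub>C") where "\<one>\<^sub>C \<equiv> \<one>\<^bsub>C\<^esub>"

sublocale F: group "F n"
  by (rule group_free_group)

definition conjugating :: "word_map \<Rightarrow> bool" where
  "conjugating \<phi> \<longleftrightarrow> (\<exists>\<pi> f. \<pi> permutes {1..n} \<and> f \<in> {1..n} \<rightarrow> carrier (F n) \<and>
      (\<forall>i\<in>{1..n}. \<phi> (gen i) = inv\<^sub>F f i \<otimes>\<^sub>F gen (\<pi> i) \<otimes>\<^sub>F f i))"

lemma carrier_C: "carrier C = {\<phi> \<in> auto (F n). conjugating \<phi>}"
  by (simp add: conj_aut_group_def conjugating_def)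

lemma gen_in [simp]: "i \<in> {1..n} \<Longrightarrow> gen i \<in> carrier (F n)"
  by simp

lemma autD:
  assumes "\<phi> \<in> auto (F n)"
  shows "group_hom (F n) (F n) \<phi>" "\<phi> \<in> extensional (carrier (F n))"
    "bij_betw \<phi> (carrier (F n)) (carrier (F n))"
  using assms by (auto simp: auto_def Bij_def intro!: group_hom.intro group_hom_axioms.intro F.is_group)

lemma auto_eqI:
  assumes "\<phi> \<in> auto (F n)" "\<psi> \<in> auto (F n)" and eq: "\<And>l. l \<in> {1..n} \<Longrightarrow> \<phi> (gen l) = \<psi> (gen l)"
  shows "\<phi> = \<psi>"
proof (rule extensionalityI[OF autD(2)[OF assms(1)] autD(2)[OF assms(2)]])
  fix w assume w: "w \<in> carrier (F n)"
  have "free_ext (F n) (\<lambda>x. \<phi> (gen x)) w = free_ext (F n) (\<lambda>x. \<psi> (gen x)) w"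
    unfolding free_ext_def using w eq by (intro foldr_cong) (auto simp: carrier_free_group subset_iff)
  then show "\<phi> w = \<psi> w"
    using hom_eq_free_ext[OF F.is_group _ w, of \<phi>] hom_eq_free_ext[OF F.is_group _ w, of \<psi>] assms
    by (simp add: auto_def)
qed

interpretation A: group "AutoGroup (F n)"
  by (rule F.AutoGroup)

lemma AutoGroup_mult:
  "\<lbrakk>\<phi> \<in> auto (F n); \<psi> \<in> auto (F n); w \<in> carrier (F n)\<rbrakk> \<Longrightarrow> (\<phi> \<otimes>\<^bsub>AutoGroup (F n)\<^esub> \<psi>) w = \<phi> (\<psi> w)"
  by (simp add: AutoGroup_def BijGroup_def auto_def compose_def)

lemma AutoGroup_carrier: "carrier (AutoGroup (F n)) = auto (F n)"
  and AutoGroup_one: "w \<in> carrier (F n) \<Longrightarrow> \<one>\<^bsub>AutoGroup (F n)\<^esub> w = w"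
  by (simp_all add: AutoGroup_def BijGroup_def)

lemma subgroup_C: "subgroup (carrier C) (AutoGroup (F n))"
proof (rule A.subgroupI)
  show "carrier C \<subseteq> carrier (AutoGroup (F n))" by (auto simp: carrier_C AutoGroup_carrier)
  have "conjugating \<one>\<^bsub>AutoGroup (F n)\<^esub>"
    unfolding conjugating_def
    by (intro exI[of _ id] exI[of _ "\<lambda>_. \<one>\<^sub>F"]) (auto simp: AutoGroup_one permutes_id)
  then show "carrier C \<noteq> {}" using A.one_closed by (auto simp: carrier_C AutoGroup_carrier)
next
  fix \<phi> assume "\<phi> \<in> carrier C"
  then have \<phi>: "\<phi> \<in> auto (F n)" and "conjugating \<phi>" by (auto simp: carrier_C)
  then obtain \<pi> f where \<pi>: "\<pi> permutes {1..n}" and f: "f \<in> {1..n} \<rightarrow> carrier (F n)"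
    and val: "\<And>i. i \<in> {1..n} \<Longrightarrow> \<phi> (gen i) = inv\<^sub>F f i \<otimes>\<^sub>F gen (\<pi> i) \<otimes>\<^sub>F f i"
    by (auto simp: conjugating_def)
  let ?\<psi> = "inv\<^bsub>AutoGroup (F n)\<^esub> \<phi>"
  have \<psi>: "?\<psi> \<in> auto (F n)" using A.inv_closed \<phi> by (simp add: AutoGroup_carrier)
  interpret \<psi>: group_hom "F n" "F n" ?\<psi> by (rule autD(1)[OF \<psi>])
  have \<psi>\<phi>: "?\<psi> (\<phi> w) = w" if "w \<in> carrier (F n)" for w
    using AutoGroup_mult[OF \<psi> \<phi> that] A.l_inv \<phi> that by (simp add: AutoGroup_carrier AutoGroup_one)
  have "?\<psi> (gen j) = inv\<^sub>F (inv\<^sub>F ?\<psi> (f (inv' \<pi> j))) \<otimes>\<^sub>F gen (inv' \<pi> j)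
      \<otimes>\<^sub>F inv\<^sub>F ?\<psi> (f (inv' \<pi> j))" if j: "j \<in> {1..n}" for j
  proof -
    define i where "i = inv' \<pi> j"
    have i: "i \<in> {1..n}" unfolding i_def using permutes_in_image[OF permutes_inv[OF \<pi>]] j by blast
    have ij: "\<pi> i = j" unfolding i_def using permutes_inverses(1)[OF \<pi>] by simp
    have cl: "f i \<in> carrier (F n)" "gen j \<in> carrier (F n)" using f i j by auto
    have "gen i = ?\<psi> (inv\<^sub>F f i \<otimes>\<^sub>F gen j \<otimes>\<^sub>F f i)"
      using \<psi>\<phi>[of "gen i"] val[OF i] i ij by simp
    also have "\<dots> = inv\<^sub>F ?\<psi> (f i) \<otimes>\<^sub>F ?\<psi> (gen j) \<otimes>\<^sub>F ?\<psi> (f i)"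
      using cl by simp
    finally show ?thesis using cl by (simp add: F.m_assoc flip: i_def)
  qed
  moreover have "inv' \<pi> permutes {1..n}" by (rule permutes_inv[OF \<pi>])
  moreover have "(\<lambda>j. inv\<^sub>F ?\<psi> (f (inv' \<pi> j))) \<in> {1..n} \<rightarrow> carrier (F n)"
  proof (rule funcsetI)
    fix j assume "j \<in> {1..n}"
    then have "inv' \<pi> j \<in> {1..n}" using permutes_in_image[OF permutes_inv[OF \<pi>]] by blast
    then show "inv\<^sub>F ?\<psi> (f (inv' \<pi> j)) \<in> carrier (F n)" using funcset_mem[OF f] by simp
  qed
  ultimately have "conjugating ?\<psi>" unfolding conjugating_def by blast
  then show "?\<psi> \<in> carrier C" using \<psi> by (simp add: carrier_C)
next
  fix \<phi> \<psi> assume "\<phi> \<in> carrier C" "\<psi> \<in> carrier C"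
  then have aut: "\<phi> \<in> auto (F n)" "\<psi> \<in> auto (F n)" and "conjugating \<phi>" "conjugating \<psi>"
    by (auto simp: carrier_C)
  then obtain \<pi> f \<pi>' f' where \<pi>: "\<pi> permutes {1..n}" "\<pi>' permutes {1..n}"
    and f: "f \<in> {1..n} \<rightarrow> carrier (F n)" "f' \<in> {1..n} \<rightarrow> carrier (F n)"
    and val: "\<And>i. i \<in> {1..n} \<Longrightarrow> \<phi> (gen i) = inv\<^sub>F f i \<otimes>\<^sub>F gen (\<pi> i) \<otimes>\<^sub>F f i"
      "\<And>i. i \<in> {1..n} \<Longrightarrow> \<psi> (gen i) = inv\<^sub>F f' i \<otimes>\<^sub>F gen (\<pi>' i) \<otimes>\<^sub>F f' i"
    unfolding conjugating_def by (elim exE conjE) blast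
  interpret \<phi>: group_hom "F n" "F n" \<phi> by (rule autD(1)[OF aut(1)])
  have \<pi>'_in: "\<pi>' i \<in> {1..n}" if "i \<in> {1..n}" for i using permutes_in_image[OF \<pi>(2)] that by blast
  have "(\<phi> \<otimes>\<^bsub>AutoGroup (F n)\<^esub> \<psi>) (gen i)
      = inv\<^sub>F (f (\<pi>' i) \<otimes>\<^sub>F \<phi> (f' i)) \<otimes>\<^sub>F gen ((\<pi> \<circ> \<pi>') i) \<otimes>\<^sub>F (f (\<pi>' i) \<otimes>\<^sub>F \<phi> (f' i))"
    if i: "i \<in> {1..n}" for i
  proof -
    have "\<pi> (\<pi>' i) \<in> {1..n}" using permutes_in_image[OF \<pi>(1)] \<pi>'_in[OF i] by blast
    then have "f' i \<in> carrier (F n)" "gen (\<pi>' i) \<in> carrier (F n)" "f (\<pi>' i) \<in> carrier (F n)"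
        "gen (\<pi> (\<pi>' i)) \<in> carrier (F n)"
      using f i \<pi>'_in[OF i] by auto
    then show ?thesis
      using AutoGroup_mult[OF aut gen_in[OF i]] val(2)[OF i] val(1)[OF \<pi>'_in[OF i]]
      by (simp add: F.m_assoc F.inv_mult_group)
  qed
  moreover have "\<pi> \<circ> \<pi>' permutes {1..n}" using permutes_compose \<pi> by blast
  moreover have "(\<lambda>i. f (\<pi>' i) \<otimes>\<^sub>F \<phi> (f' i)) \<in> {1..n} \<rightarrow> carrier (F n)"
    using f \<pi>'_in by (auto intro!: F.m_closed \<phi>.hom_closed)
  ultimately have "conjugating (\<phi> \<otimes>\<^bsub>AutoGroup (F n)\<^esub> \<psi>)" unfolding conjugating_def
    by (intro exI[of _ "\<pi> \<circ> \<pi>'"] exI[of _ "\<lambda>i. f (\<pi>' i) \<otimes>\<^sub>F \<phi> (f' i)"]) simp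
  moreover have "\<phi> \<otimes>\<^bsub>AutoGroup (F n)\<^esub> \<psi> \<in> auto (F n)"
    using A.m_closed aut by (simp add: AutoGroup_carrier)
  ultimately show "\<phi> \<otimes>\<^bsub>AutoGroup (F n)\<^esub> \<psi> \<in> carrier C" by (simp add: carrier_C)
qed

sublocale C: group C
proof -
  have "C = AutoGroup (F n) \<lparr>carrier := carrier C\<rparr>" by (simp add: conj_aut_group_def)
  then show "group C" using A.subgroup_imp_group[OF subgroup_C] by metis
qed

lemma C_auto: "\<phi> \<in> carrier C \<Longrightarrow> \<phi> \<in> auto (F n)"
  by (simp add: carrier_C)

lemma C_hom: "\<phi> \<in> carrier C \<Longrightarrow> group_hom (F n) (F n) \<phi>"
  by (rule autD(1)[OF C_auto])

lemma C_apply: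
  assumes "\<phi> \<in> carrier C"
  shows "w \<in> carrier (F n) \<Longrightarrow> \<phi> w \<in> carrier (F n)"
    and "\<lbrakk>v \<in> carrier (F n); w \<in> carrier (F n)\<rbrakk> \<Longrightarrow> \<phi> (v \<otimes>\<^sub>F w) = \<phi> v \<otimes>\<^sub>F \<phi> w"
    and "w \<in> carrier (F n) \<Longrightarrow> \<phi> (inv\<^sub>F w) = inv\<^sub>F \<phi> w"
proof -
  interpret group_hom "F n" "F n" \<phi> by (rule C_hom[OF assms])
  show "w \<in> carrier (F n) \<Longrightarrow> \<phi> w \<in> carrier (F n)"
    "\<lbrakk>v \<in> carrier (F n); w \<in> carrier (F n)\<rbrakk> \<Longrightarrow> \<phi> (v \<otimes>\<^sub>F w) = \<phi> v \<otimes>\<^sub>F \<phi> w"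
    "w \<in> carrier (F n) \<Longrightarrow> \<phi> (inv\<^sub>F w) = inv\<^sub>F \<phi> w" by simp_all
qed

lemma C_mult [simp]:
  "\<lbrakk>\<phi> \<in> carrier C; \<psi> \<in> carrier C; w \<in> carrier (F n)\<rbrakk> \<Longrightarrow> (\<phi> \<otimes>\<^sub>C \<psi>) w = \<phi> (\<psi> w)"
  using AutoGroup_mult[of \<phi> \<psi> w] by (simp add: conj_aut_group_def)

lemma C_one [simp]: "w \<in> carrier (F n) \<Longrightarrow> \<one>\<^sub>C w = w"
  using AutoGroup_one by (simp add: conj_aut_group_def)

lemma C_eqI:
  "\<lbrakk>\<phi> \<in> carrier C; \<psi> \<in> carrier C; \<And>l. l \<in> {1..n} \<Longrightarrow> \<phi> (gen l) = \<psi> (gen l)\<rbrakk> \<Longrightarrow> \<phi> = \<psi>"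
  by (rule auto_eqI) (simp_all add: C_auto)

lemma endo_hom: "f \<in> {1..n} \<rightarrow> carrier (F n) \<Longrightarrow> group_hom (F n) (F n) (endo n f)"
  using F.free_ext_hom[of f "{1..n}"] F.is_group
  by (auto intro!: group_hom.intro group_hom_axioms.intro simp: endo_def hom_def)

lemma endo_gen [simp]:
  "\<lbrakk>f \<in> {1..n} \<rightarrow> carrier (F n); l \<in> {1..n}\<rbrakk> \<Longrightarrow> endo n f (gen l) = f l"
  using free_ext_gen[of "F n" f l] F.monoid_axioms by (auto simp: endo_def Pi_def)

lemma endo_inverse:
  assumes f: "f \<in> {1..n} \<rightarrow> carrier (F n)" and f': "f' \<in> {1..n} \<rightarrow> carrier (F n)"
    and inv: "\<And>l. l \<in> {1..n} \<Longrightarrow> endo n f (f' l) = gen l" and w: "w \<in> carrier (F n)"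
  shows "endo n f (endo n f' w) = w"
proof -
  interpret f: group_hom "F n" "F n" "endo n f" by (rule endo_hom[OF f])
  interpret f': group_hom "F n" "F n" "endo n f'" by (rule endo_hom[OF f'])
  have "(\<lambda>w. endo n f (endo n f' w)) \<in> hom (F n) (F n)"
    by (auto simp: hom_def)
  moreover have "(\<lambda>w. w) \<in> hom (F n) (F n)" by (auto simp: hom_def)
  moreover have "free_ext (F n) (\<lambda>x. endo n f (endo n f' (gen x))) w = free_ext (F n) gen w"
    unfolding free_ext_def using w inv f'
    by (intro foldr_cong) (auto simp: carrier_free_group subset_iff)
  ultimately show ?thesis
    using hom_eq_free_ext[OF F.is_group _ w, of "\<lambda>w. endo n f (endo n f' w)"]
      hom_eq_free_ext[OF F.is_group _ w, of "\<lambda>w. w"] by simp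
qed

lemma endo_in_C:
  assumes f: "f \<in> {1..n} \<rightarrow> carrier (F n)" and f': "f' \<in> {1..n} \<rightarrow> carrier (F n)"
    and inv: "\<And>l. l \<in> {1..n} \<Longrightarrow> endo n f (f' l) = gen l" "\<And>l. l \<in> {1..n} \<Longrightarrow> endo n f' (f l) = gen l"
    and \<pi>: "\<pi> permutes {1..n}" and g: "g \<in> {1..n} \<rightarrow> carrier (F n)"
    and conj: "\<And>l. l \<in> {1..n} \<Longrightarrow> f l = inv\<^sub>F g l \<otimes>\<^sub>F gen (\<pi> l) \<otimes>\<^sub>F g l"
  shows "endo n f \<in> carrier C"
proof -
  interpret f: group_hom "F n" "F n" "endo n f" by (rule endo_hom[OF f])
  interpret f': group_hom "F n" "F n" "endo n f'" by (rule endo_hom[OF f'])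
  have "bij_betw (endo n f) (carrier (F n)) (carrier (F n))"
    by (rule bij_betw_byWitness[where f' = "endo n f'"])
      (use endo_inverse[OF f f' inv(1)] endo_inverse[OF f' f inv(2)] in auto)
  then have "endo n f \<in> auto (F n)"
    using f.homh by (auto simp: auto_def Bij_def endo_def)
  moreover have "conjugating (endo n f)"
    unfolding conjugating_def using \<pi> g conj f by (intro exI[of _ \<pi>] exI[of _ g]) simp
  ultimately show ?thesis by (simp add: carrier_C)
qed

abbreviation "\<alpha> \<equiv> alpha_gen n"
abbreviation "\<sigma> \<equiv> sigma_gen n"

lemma \<alpha>_C [simp]: "\<lbrakk>1 \<le> i; i < n\<rbrakk> \<Longrightarrow> \<alpha> i \<in> carrier C"
  and \<alpha>_gen: "\<lbrakk>1 \<le> i; i < n; l \<in> {1..n}\<rbrakk> \<Longrightarrow> \<alpha> i (gen l) = gen (adj i l)"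
proof -
  define f where "f l = (if l = i then gen (Suc i) else if l = Suc i then gen i else gen l)" for l :: nat
  assume i: "1 \<le> i" "i < n"
  have f: "f \<in> {1..n} \<rightarrow> carrier (F n)" using i by (auto simp: f_def)
  have f_adj: "f l = gen (adj i l)" for l by (auto simp: f_def transpose_def)
  have \<alpha>: "\<alpha> i = endo n f"
    unfolding alpha_gen_def by (rule arg_cong[where f = "endo n"]) (simp add: f_def fun_eq_iff Suc_eq_plus1)
  have inv: "endo n f (f l) = gen l" if "l \<in> {1..n}" for l
  proof -
    have "adj i l \<in> {1..n}" using permutes_in_image[OF adj_permutes[OF i]] that by blast
    then show ?thesis using endo_gen[OF f] by (simp add: f_adj)
  qed
  have conj: "f l = inv\<^sub>F \<one>\<^sub>F \<otimes>\<^sub>F gen (adj i l) \<otimes>\<^sub>F \<one>\<^sub>F" if "l \<in> {1..n}" for l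
    using funcset_mem[OF f that] by (simp add: f_adj)
  have g: "(\<lambda>_. \<one>\<^sub>F) \<in> {1..n} \<rightarrow> carrier (F n)" by simp
  show "\<alpha> i \<in> carrier C"
    unfolding \<alpha> by (rule endo_in_C[OF f f inv inv adj_permutes[OF i] g conj])
  show "\<alpha> i (gen l) = gen (adj i l)" if "l \<in> {1..n}"
    unfolding \<alpha> using endo_gen[OF f that] f_adj by simp
qed

lemma \<sigma>_C [simp]: "\<lbrakk>1 \<le> i; i < n\<rbrakk> \<Longrightarrow> \<sigma> i \<in> carrier C"
  and \<sigma>_gen: "\<lbrakk>1 \<le> i; i < n; l \<in> {1..n}\<rbrakk> \<Longrightarrow> \<sigma> i (gen l) =
    (if l = i then gen i \<otimes>\<^sub>F gen (Suc i) \<otimes>\<^sub>F inv\<^sub>F gen i else if l = Suc i then gen i else gen l)"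
proof -
  define f where "f l = (if l = i then gen i \<otimes>\<^sub>F gen (Suc i) \<otimes>\<^sub>F inv\<^sub>F gen i
    else if l = Suc i then gen i else gen l)" for l :: nat
  define f' where "f' l = (if l = i then gen (Suc i)
    else if l = Suc i then inv\<^sub>F gen (Suc i) \<otimes>\<^sub>F gen i \<otimes>\<^sub>F gen (Suc i) else gen l)" for l :: nat
  assume i: "1 \<le> i" "i < n"
  have x: "gen i \<in> carrier (F n)" "gen (Suc i) \<in> carrier (F n)" using i by simp_all
  have f: "f \<in> {1..n} \<rightarrow> carrier (F n)" and f': "f' \<in> {1..n} \<rightarrow> carrier (F n)"
    using i by (auto simp: f_def f'_def)
  have \<sigma>: "\<sigma> i = endo n f"
    unfolding sigma_gen_def by (rule arg_cong[where f = "endo n"]) (simp add: f_def fun_eq_iff Suc_eq_plus1)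
  interpret f: group_hom "F n" "F n" "endo n f" by (rule endo_hom[OF f])
  interpret f': group_hom "F n" "F n" "endo n f'" by (rule endo_hom[OF f'])
  have val: "endo n f (gen i) = gen i \<otimes>\<^sub>F gen (Suc i) \<otimes>\<^sub>F inv\<^sub>F gen i"
      "endo n f (gen (Suc i)) = gen i" "endo n f' (gen i) = gen (Suc i)"
      "endo n f' (gen (Suc i)) = inv\<^sub>F gen (Suc i) \<otimes>\<^sub>F gen i \<otimes>\<^sub>F gen (Suc i)"
    using endo_gen[OF f] endo_gen[OF f'] i by (simp_all add: f_def f'_def)
  have inv: "endo n f (f' l) = gen l" "endo n f' (f l) = gen l" if "l \<in> {1..n}" for l
  proof -
    show "endo n f (f' l) = gen l"
      using endo_gen[OF f that] val x by (auto simp: f_def f'_def F.m_assoc)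
    show "endo n f' (f l) = gen l"
      using endo_gen[OF f' that] val x by (auto simp: f_def f'_def F.m_assoc)
  qed
  have conj: "f l = inv\<^sub>F (if l = i then inv\<^sub>F gen i else \<one>\<^sub>F) \<otimes>\<^sub>F gen (adj i l)
      \<otimes>\<^sub>F (if l = i then inv\<^sub>F gen i else \<one>\<^sub>F)" if "l \<in> {1..n}" for l
    using x that by (auto simp: f_def transpose_def)
  have g: "(\<lambda>l. if l = i then inv\<^sub>F gen i else \<one>\<^sub>F) \<in> {1..n} \<rightarrow> carrier (F n)"
    using x by simp
  show "\<sigma> i \<in> carrier C"
    unfolding \<sigma> by (rule endo_in_C[OF f f' inv adj_permutes[OF i] g conj])
  show "\<sigma> i (gen l) = (if l = i then gen i \<otimes>\<^sub>F gen (Suc i) \<otimes>\<^sub>F inv\<^sub>F gen i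
      else if l = Suc i then gen i else gen l)" if "l \<in> {1..n}"
    unfolding \<sigma> using endo_gen[OF f that] by (simp add: f_def)
qed

lemma \<alpha>_values:
  assumes "1 \<le> i" "i < n"
  shows "\<alpha> i (gen i) = gen (Suc i)" "\<alpha> i (gen (Suc i)) = gen i"
    "\<lbrakk>l \<in> {1..n}; l \<noteq> i; l \<noteq> Suc i\<rbrakk> \<Longrightarrow> \<alpha> i (gen l) = gen l"
  using assms by (simp_all add: \<alpha>_gen transpose_def)

lemma \<sigma>_values:
  assumes "1 \<le> i" "i < n"
  shows "\<sigma> i (gen i) = gen i \<otimes>\<^sub>F gen (Suc i) \<otimes>\<^sub>F inv\<^sub>F gen i" "\<sigma> i (gen (Suc i)) = gen i"
    "\<lbrakk>l \<in> {1..n}; l \<noteq> i; l \<noteq> Suc i\<rbrakk> \<Longrightarrow> \<sigma> i (gen l) = gen l"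
  using assms by (simp_all add: \<sigma>_gen)

text \<open>
  Both \<open>\<alpha> i\<close> and \<open>\<sigma> i\<close> send the basis elements with indices \<open>i\<close>, \<open>i + 1\<close> to words in these two, and
  fix the others.
\<close>

lemma far_commute:
  assumes "1 \<le> i" "i + 2 \<le> j" "j < n"
    and "\<phi> \<in> {\<alpha>, \<sigma>}" "\<psi> \<in> {\<alpha>, \<sigma>}"
  shows "\<phi> i \<otimes>\<^sub>C \<psi> j = \<psi> j \<otimes>\<^sub>C \<phi> i"
proof (rule C_eqI)
  have cl: "\<phi> i \<in> carrier C" "\<psi> j \<in> carrier C" using assms by auto
  then show "\<phi> i \<otimes>\<^sub>C \<psi> j \<in> carrier C" "\<psi> j \<otimes>\<^sub>C \<phi> i \<in> carrier C" by simp_all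
  fix l assume l: "l \<in> {1..n}"
  have x: "gen i \<in> carrier (F n)" "gen (Suc i) \<in> carrier (F n)" "gen j \<in> carrier (F n)"
    "gen (Suc j) \<in> carrier (F n)" "gen l \<in> carrier (F n)" using assms l by simp_all
  have fix_ij: "\<phi> i (gen k) = gen k" if "k \<in> {1..n}" "k \<noteq> i" "k \<noteq> Suc i" for k
    using that assms(1-4) \<alpha>_values(3)[of i k] \<sigma>_values(3)[of i k] by auto
  have fix_ji: "\<psi> j (gen k) = gen k" if "k \<in> {1..n}" "k \<noteq> j" "k \<noteq> Suc j" for k
    using that assms(1-3,5) \<alpha>_values(3)[of j k] \<sigma>_values(3)[of j k] by auto
  have i': "\<psi> j (gen i) = gen i" "\<psi> j (gen (Suc i)) = gen (Suc i)" using fix_ji assms(1-3) by simp_all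
  have j': "\<phi> i (gen j) = gen j" "\<phi> i (gen (Suc j)) = gen (Suc j)" using fix_ij assms(1-3) by simp_all
  have vals: "\<chi> k (gen k) = gen (Suc k) \<or>
        \<chi> k (gen k) = gen k \<otimes>\<^sub>F gen (Suc k) \<otimes>\<^sub>F inv\<^sub>F gen k" (is ?A)
      and vals_Suc: "\<chi> k (gen (Suc k)) = gen k" (is ?B)
    if \<chi>: "\<chi> \<in> {\<alpha>, \<sigma>}" and k: "1 \<le> k" "k < n" for \<chi> k
  proof -
    consider "\<chi> = \<alpha>" | "\<chi> = \<sigma>" using \<chi> by blast
    then show ?A ?B by (cases; simp add: \<alpha>_values(1,2)[OF k] \<sigma>_values(1,2)[OF k])+
  qed
  have ij: "i < n" "1 \<le> j" using assms by simp_all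
  have "\<psi> j (\<phi> i (gen i)) = \<phi> i (gen i)"
    using vals[OF assms(4,1) ij(1)]
    by (rule disjE) (simp_all only: i' C_apply[OF cl(2)] x F.m_closed F.inv_closed)
  moreover have "\<psi> j (\<phi> i (gen (Suc i))) = \<phi> i (gen (Suc i))"
    by (simp only: vals_Suc[OF assms(4,1) ij(1)] i')
  moreover have "\<phi> i (\<psi> j (gen j)) = \<psi> j (gen j)"
    using vals[OF assms(5) ij(2) assms(3)]
    by (rule disjE) (simp_all only: j' C_apply[OF cl(1)] x F.m_closed F.inv_closed)
  moreover have "\<phi> i (\<psi> j (gen (Suc j))) = \<psi> j (gen (Suc j))"
    by (simp only: vals_Suc[OF assms(5) ij(2) assms(3)] j')
  ultimately have "\<phi> i (\<psi> j (gen l)) = \<psi> j (\<phi> i (gen l))"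
    using i' j' fix_ij[OF l] fix_ji[OF l]
    by (cases "l = i"; cases "l = Suc i"; cases "l = j"; cases "l = Suc j") simp_all
  then show "(\<phi> i \<otimes>\<^sub>C \<psi> j) (gen l) = (\<psi> j \<otimes>\<^sub>C \<phi> i) (gen l)" using cl x by simp
qed

lemma C_eqI_adjacent:
  assumes i: "1 \<le> i" "Suc i < n" and cl: "\<phi> \<in> carrier C" "\<psi> \<in> carrier C"
    and "\<phi> (gen i) = \<psi> (gen i)" "\<phi> (gen (Suc i)) = \<psi> (gen (Suc i))"
      "\<phi> (gen (Suc (Suc i))) = \<psi> (gen (Suc (Suc i)))"
    and "\<And>l. \<lbrakk>l \<in> {1..n}; l \<noteq> i; l \<noteq> Suc i; l \<noteq> Suc (Suc i)\<rbrakk> \<Longrightarrow> \<phi> (gen l) = \<psi> (gen l)"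
  shows "\<phi> = \<psi>"
  using assms(5-8) by (intro C_eqI[OF cl]) metis

lemma welded_C: "welded C n \<alpha> \<sigma>"
proof
  fix i assume i: "1 \<le> i" "i < n"
  have "\<alpha> i \<otimes>\<^sub>C \<alpha> i = \<one>\<^sub>C"
  proof (rule C_eqI)
    fix l assume l: "l \<in> {1..n}"
    then have "adj i l \<in> {1..n}" using permutes_in_image[OF adj_permutes[OF i]] by blast
    then show "(\<alpha> i \<otimes>\<^sub>C \<alpha> i) (gen l) = \<one>\<^sub>C (gen l)" using i l by (simp add: \<alpha>_gen)
  qed (use i in simp_all)
  then show "\<alpha> i \<otimes>\<^sub>C \<alpha> i = \<one>\<^sub>C" .
next
  fix i assume i: "1 \<le> i" "Suc i < n"
  have x: "gen i \<in> carrier (F n)" "gen (Suc i) \<in> carrier (F n)" "gen (Suc (Suc i)) \<in> carrier (F n)"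
    using i by simp_all
  have cl: "\<alpha> i \<in> carrier C" "\<alpha> (Suc i) \<in> carrier C" "\<sigma> i \<in> carrier C" "\<sigma> (Suc i) \<in> carrier C"
    using i by simp_all
  have v: "\<alpha> i (gen (Suc (Suc i))) = gen (Suc (Suc i))" "\<alpha> (Suc i) (gen i) = gen i"
      "\<sigma> i (gen (Suc (Suc i))) = gen (Suc (Suc i))" "\<sigma> (Suc i) (gen i) = gen i"
    using i \<alpha>_values(3) \<sigma>_values(3) by simp_all
  note vals = v \<alpha>_values(1,2)[of i] \<alpha>_values(1,2)[of "Suc i"] \<sigma>_values(1,2)[of i] \<sigma>_values(1,2)[of "Suc i"]
    C_apply[OF cl(1)] C_apply[OF cl(2)] C_apply[OF cl(3)] C_apply[OF cl(4)]
  have other: "\<alpha> i (gen l) = gen l" "\<alpha> (Suc i) (gen l) = gen l" "\<sigma> i (gen l) = gen l" "\<sigma> (Suc i) (gen l) = gen l"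
    if "l \<in> {1..n}" "l \<noteq> i" "l \<noteq> Suc i" "l \<noteq> Suc (Suc i)" for l
    using that i \<alpha>_values(3) \<sigma>_values(3) by simp_all
  show "\<alpha> i \<otimes>\<^sub>C \<alpha> (Suc i) \<otimes>\<^sub>C \<alpha> i = \<alpha> (Suc i) \<otimes>\<^sub>C \<alpha> i \<otimes>\<^sub>C \<alpha> (Suc i)"
    by (rule C_eqI_adjacent[OF i]) (use i cl x in \<open>simp_all add: vals other F.m_assoc F.inv_mult_group\<close>)
  show "\<sigma> i \<otimes>\<^sub>C \<sigma> (Suc i) \<otimes>\<^sub>C \<sigma> i = \<sigma> (Suc i) \<otimes>\<^sub>C \<sigma> i \<otimes>\<^sub>C \<sigma> (Suc i)"
    by (rule C_eqI_adjacent[OF i]) (use i cl x in \<open>simp_all add: vals other F.m_assoc F.inv_mult_group\<close>)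
  show "\<sigma> i \<otimes>\<^sub>C \<alpha> (Suc i) \<otimes>\<^sub>C \<alpha> i = \<alpha> (Suc i) \<otimes>\<^sub>C \<alpha> i \<otimes>\<^sub>C \<sigma> (Suc i)"
    by (rule C_eqI_adjacent[OF i]) (use i cl x in \<open>simp_all add: vals other F.m_assoc F.inv_mult_group\<close>)
  show "\<sigma> i \<otimes>\<^sub>C \<sigma> (Suc i) \<otimes>\<^sub>C \<alpha> i = \<alpha> (Suc i) \<otimes>\<^sub>C \<sigma> i \<otimes>\<^sub>C \<sigma> (Suc i)"
    by (rule C_eqI_adjacent[OF i]) (use i cl x in \<open>simp_all add: vals other F.m_assoc F.inv_mult_group\<close>)
next
  fix i j assume "1 \<le> i" "i + 2 \<le> j" "j < n"
  then show "\<alpha> i \<otimes>\<^sub>C \<alpha> j = \<alpha> j \<otimes>\<^sub>C \<alpha> i" "\<sigma> i \<otimes>\<^sub>C \<sigma> j = \<sigma> j \<otimes>\<^sub>C \<sigma> i"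
    using far_commute by blast+
next
  fix i j assume "1 \<le> i" "i < n" "1 \<le> j" "j < n" "i + 2 \<le> j \<or> j + 2 \<le> i"
  then show "\<alpha> i \<otimes>\<^sub>C \<sigma> j = \<sigma> j \<otimes>\<^sub>C \<alpha> i"
    using far_commute[of i j \<alpha> \<sigma>] far_commute[of j i \<sigma> \<alpha>] by auto
qed (use n3 in simp_all)

sublocale W: welded C n \<alpha> \<sigma>
  by (rule welded_C)

lemma \<rho>_gen:
  assumes "p permutes {1..n}" and l: "l \<in> {1..n}"
  shows "W.\<rho> p (gen l) = gen (p l)"
  using assms
proof (induction arbitrary: l rule: permutes_adj_induct)
  case id
  then show ?case using W.\<rho>_id by (simp flip: id_def)
next
  case (adj p k)
  have "W.\<rho> (p \<circ> adj k) = W.\<rho> p \<otimes>\<^sub>C \<alpha> k"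
    using W.\<rho>_comp[OF adj(1) adj_permutes[OF adj(2,3)]] W.\<rho>_adj[OF adj(2,3)] by simp
  moreover have "adj k l \<in> {1..n}"
    using permutes_in_image[OF adj_permutes[OF adj(2,3)]] adj.prems by blast
  ultimately have "W.\<rho> (p \<circ> adj k) (gen l) = gen (p (adj k l))" using adj by (simp add: \<alpha>_gen)
  then show ?case by (simp add: o_def)
qed

lemma e_gen:
  assumes ij: "i \<in> {1..n}" "j \<in> {1..n}" "i \<noteq> j" and l: "l \<in> {1..n}"
  shows "W.e i j (gen l) = (if l = i then gen j \<otimes>\<^sub>F gen i \<otimes>\<^sub>F inv\<^sub>F gen j else gen l)"
proof -
  obtain p where p: "p permutes {1..n}" "p 2 = i" "p 1 = j" using W.index_pair ij by blast
  define k where "k = inv' p l"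
  have k: "k \<in> {1..n}" unfolding k_def using permutes_in_image[OF permutes_inv[OF p(1)]] l by blast
  have pk: "p k = l" unfolding k_def using permutes_inverses(1)[OF p(1)] by simp
  have li: "l = i \<longleftrightarrow> k = 2" using pk p permutes_inj[OF p(1)] by (metis injD)
  have cl: "W.\<rho> p \<in> carrier C" "W.e i j \<in> carrier C" "\<sigma> 1 \<in> carrier C" "\<alpha> 1 \<in> carrier C"
    using p ij n3 by simp_all
  have x: "gen 1 \<in> carrier (F n)" "gen 2 \<in> carrier (F n)" using n3 by simp_all
  have "W.e i j (gen l) = (W.e i j \<otimes>\<^sub>C W.\<rho> p) (gen k)"
    using \<rho>_gen[OF p(1) k] pk cl k by simp
  also have "\<dots> = (W.\<rho> p \<otimes>\<^sub>C (\<sigma> 1 \<otimes>\<^sub>C \<alpha> 1)) (gen k)"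
    using W.conj_base[OF p(1)] p by simp
  also have "\<dots> = W.\<rho> p (\<sigma> 1 (\<alpha> 1 (gen k)))" using cl k n3 by (simp add: \<alpha>_gen)
  also have "\<sigma> 1 (\<alpha> 1 (gen k)) = (if k = 2 then gen 1 \<otimes>\<^sub>F gen 2 \<otimes>\<^sub>F inv\<^sub>F gen 1 else gen k)"
  proof -
    have "adj 1 k \<in> {1..n}" using permutes_in_image[OF adj_permutes[of 1 n], of k] k n3 by simp
    then have "\<sigma> 1 (gen (adj 1 k)) = (if adj 1 k = 1 then gen 1 \<otimes>\<^sub>F gen 2 \<otimes>\<^sub>F inv\<^sub>F gen 1
        else if adj 1 k = 2 then gen 1 else gen (adj 1 k))"
      using \<sigma>_gen[of 1 "adj 1 k"] n3 by simp
    also have "\<dots> = (if k = 2 then gen 1 \<otimes>\<^sub>F gen 2 \<otimes>\<^sub>F inv\<^sub>F gen 1 else gen k)"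
      by (simp add: transpose_def)
    finally show ?thesis using \<alpha>_gen[of 1 k] k n3 by simp
  qed
  also have "W.\<rho> p \<dots> = (if l = i then gen j \<otimes>\<^sub>F gen i \<otimes>\<^sub>F inv\<^sub>F gen j else gen l)"
    using li pk \<rho>_gen[OF p(1)] p C_apply[OF cl(1)] x k n3 by auto
  finally show ?thesis .
qed

lemma inv_e_gen:
  assumes ij: "i \<in> {1..n}" "j \<in> {1..n}" "i \<noteq> j" and l: "l \<in> {1..n}"
  shows "(inv\<^sub>C W.e i j) (gen l)
    = (if l = i then inv\<^sub>F gen j \<otimes>\<^sub>F gen i \<otimes>\<^sub>F gen j else gen l)"
proof -
  let ?w = "if l = i then inv\<^sub>F gen j \<otimes>\<^sub>F gen i \<otimes>\<^sub>F gen j else gen l"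
  have x: "gen i \<in> carrier (F n)" "gen j \<in> carrier (F n)" "gen l \<in> carrier (F n)" using ij l by simp_all
  have cl: "W.e i j \<in> carrier C" using ij by simp
  have w: "?w \<in> carrier (F n)" using x by simp
  have "W.e i j ?w = gen l" using e_gen[OF ij] ij l C_apply[OF cl] x by (simp add: F.m_assoc)
  then have "(inv\<^sub>C W.e i j) (gen l) = (inv\<^sub>C W.e i j \<otimes>\<^sub>C W.e i j) ?w"
    using C_mult[OF C.inv_closed[OF cl] cl w] by (simp only:)
  also have "\<dots> = ?w" using cl w by (simp only: C.l_inv C_one)
  finally show ?thesis .
qed

end



section \<open>Basis conjugations and their inverses\<close>

context group
begin

definition signed :: "bool \<Rightarrow> 'a \<Rightarrow> 'a" where
  "signed b x = (if b then x else inv x)"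

lemma signed_closed [simp]: "x \<in> carrier G \<Longrightarrow> signed b x \<in> carrier G"
  by (simp add: signed_def)

lemma inv_signed: "x \<in> carrier G \<Longrightarrow> inv signed b x = signed (\<not> b) x"
  by (simp add: signed_def)

lemma signed_mult:
  assumes "x \<in> carrier G" "y \<in> carrier G" "x \<otimes> y = y \<otimes> x"
  shows "signed b (x \<otimes> y) = signed b x \<otimes> signed b y"
  using assms inv_mult_group[of y x] by (simp add: signed_def)

lemma signed_commute:
  assumes "x \<in> carrier G" "y \<in> carrier G" "x \<otimes> y = y \<otimes> x"
  shows "signed b x \<otimes> signed c y = signed c y \<otimes> signed b x"
proof -
  have "signed b x \<otimes> y = y \<otimes> signed b x"
    using assms commute_inv by (simp add: signed_def)
  then show ?thesis
    using assms commute_inv[of y "signed b x"] by (auto simp: signed_def[of c])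
qed

lemma signed_conj:
  assumes "p \<in> carrier G" "x \<in> carrier G" "y \<in> carrier G" "p \<otimes> x = y \<otimes> p"
  shows "p \<otimes> signed b x = signed b y \<otimes> p"
proof -
  have "p \<otimes> inv x = inv y \<otimes> (y \<otimes> p) \<otimes> inv x" using assms(1-3) by (simp add: m_assoc)
  also have "\<dots> = inv y \<otimes> p" unfolding assms(4)[symmetric] using assms(1-3) by (simp add: m_assoc)
  finally show ?thesis using assms(4) by (simp add: signed_def)
qed

end

text \<open>
  The triple \<open>(i, j, b)\<close> stands for the basis conjugation of \<open>x\<^sub>i\<close> by \<open>x\<^sub>j\<close>, or for its inverse if
  \<open>b\<close> is false.
\<close>

abbreviation moves :: "nat \<Rightarrow> (nat \<times> nat \<times> bool) set" where
  "moves n \<equiv> {(i, j, b). i \<in> {1..n} \<and> j \<in> {1..n} \<and> i \<noteq> j}"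

context welded
begin

definition move :: "nat \<Rightarrow> nat \<Rightarrow> bool \<Rightarrow> 'a" where
  "move i j b = signed b (e i j)"

lemma move_closed [simp]: "\<lbrakk>i \<in> {1..n}; j \<in> {1..n}; i \<noteq> j\<rbrakk> \<Longrightarrow> move i j b \<in> carrier K"
  by (simp add: move_def)

lemma inv_move: "\<lbrakk>i \<in> {1..n}; j \<in> {1..n}; i \<noteq> j\<rbrakk> \<Longrightarrow> inv move i j b = move i j (\<not> b)"
  by (simp add: move_def inv_signed)

lemma move_disjoint:
  "\<lbrakk>distinct [i, j, k, l]; {i, j, k, l} \<subseteq> {1..n}\<rbrakk> \<Longrightarrow> move i j b \<otimes> move k l c = move k l c \<otimes> move i j b"
  unfolding move_def by (rule signed_commute) (simp_all add: e_disjoint_commute)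

lemma move_same_conjugator:
  "\<lbrakk>distinct [i, j, k]; {i, j, k} \<subseteq> {1..n}\<rbrakk> \<Longrightarrow> move i k b \<otimes> move j k c = move j k c \<otimes> move i k b"
  unfolding move_def by (rule signed_commute) (simp_all add: e_same_conjugator_commute)

text \<open>
  The product \<open>e i k e j k\<close> conjugates both \<open>x\<^sub>i\<close> and \<open>x\<^sub>j\<close> by \<open>x\<^sub>k\<close>, and so commutes with the
  conjugation of \<open>x\<^sub>i\<close> by \<open>x\<^sub>j\<close>. Its two factors commute, so the same sign can be put on both.
\<close>

lemma move_triangle:
  assumes ijk: "distinct [i, j, k]" "{i, j, k} \<subseteq> {1..n}"
  shows "move i k c \<otimes> move j k c \<otimes> move i j b = move i j b \<otimes> (move i k c \<otimes> move j k c)"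
proof -
  have cl: "e i k \<in> carrier K" "e j k \<in> carrier K" "e i j \<in> carrier K" using ijk by simp_all
  have "signed c (e i k \<otimes> e j k) \<otimes> signed b (e i j) = signed b (e i j) \<otimes> signed c (e i k \<otimes> e j k)"
    using cl e_triangle[OF ijk] by (intro signed_commute) simp_all
  then show ?thesis
    using signed_mult[OF cl(1,2) e_same_conjugator_commute[OF ijk]] by (simp add: move_def)
qed

lemma a_move:
  assumes "1 \<le> k" "k < n" "i \<in> {1..n}" "j \<in> {1..n}" "i \<noteq> j"
  shows "a k \<otimes> move i j b = move (adj k i) (adj k j) b \<otimes> a k"
proof -
  have "adj k i \<in> {1..n}" "adj k j \<in> {1..n}"
    using permutes_in_image[OF adj_permutes[OF assms(1,2)]] assms by blast+
  moreover have "adj k i \<noteq> adj k j" using assms(5) permutes_inj[OF adj_permutes[OF assms(1,2)]] by (simp only: inj_eq) simp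
  ultimately show ?thesis
    unfolding move_def using a_e[OF assms] assms by (intro signed_conj) simp_all
qed

end


section \<open>Lengths of the conjugating words\<close>

text \<open>
  Every conjugate of a basis element \<open>p\<close> is a reduced word that is symmetric around its middle
  letter \<open>p\<close>; only the initial letters of \<open>g\<close> that are powers of \<open>p\<close> cancel.
\<close>

lemma conj_gen_word:
  assumes "g \<in> carrier (free_group X)" "p \<in> X"
  defines "w \<equiv> dropWhile (\<lambda>a. fst a = p) g"
  shows "inv\<^bsub>free_group X\<^esub> g \<otimes>\<^bsub>free_group X\<^esub> gen p \<otimes>\<^bsub>free_group X\<^esub> g = winv w @ (p, True) # w"
    and "reduced (winv w @ (p, True) # w)"
proof -
  interpret F: group "free_group X" by (rule group_free_group)
  have "inv\<^bsub>free_group X\<^esub> g \<otimes>\<^bsub>free_group X\<^esub> gen p \<otimes>\<^bsub>free_group X\<^esub> g = winv w @ (p, True) # w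
      \<and> reduced (winv w @ (p, True) # w)"
    unfolding w_def using assms(1)
  proof (induction g)
    case Nil
    then show ?case using assms(2)
      by (simp add: gen_def carrier_free_group flip: one_free_group[of X])
        (simp add: one_free_group gen_def mult_free_group)
  next
    case (Cons a g)
    have cl: "[a] \<in> carrier (free_group X)" "g \<in> carrier (free_group X)" "gen p \<in> carrier (free_group X)"
      and red: "reduced (a # g)"
      using Cons.prems assms(2) by (auto simp: carrier_free_group reduced_Cons gen_def)
    show ?case
    proof (cases "fst a = p")
      case True
      have ag: "a # g = [a] \<otimes>\<^bsub>free_group X\<^esub> g" using red by (simp add: mult_reduced)
      have "[a] = gen p \<or> [a] = inv\<^bsub>free_group X\<^esub> gen p"
        using letter_cases[of a X] True assms(2) by (metis (full_types))
      then have "inv\<^bsub>free_group X\<^esub> [a] \<otimes>\<^bsub>free_group X\<^esub> (gen p \<otimes>\<^bsub>free_group X\<^esub> [a]) = gen p"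
        using cl by (elim disjE) (simp_all only: F.inv_cancel_left F.r_inv F.l_inv F.inv_inv F.inv_closed F.r_one)
      then have "inv\<^bsub>free_group X\<^esub> (a # g) \<otimes>\<^bsub>free_group X\<^esub> gen p \<otimes>\<^bsub>free_group X\<^esub> (a # g)
          = inv\<^bsub>free_group X\<^esub> g \<otimes>\<^bsub>free_group X\<^esub> gen p \<otimes>\<^bsub>free_group X\<^esub> g"
        unfolding ag using cl F.m_assoc[of "inv\<^bsub>free_group X\<^esub> [a]" "gen p \<otimes>\<^bsub>free_group X\<^esub> [a]" g]
        by (simp add: F.m_assoc F.inv_mult_group)
      then show ?thesis using Cons.IH[OF cl(2)] True by simp
    next
      case False
      have r1: "reduced ((p, True) # a # g)" and "reduced ((p, False) # a # g)"
        using red False by (auto simp: flip_def)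
      then have "reduced (winv ((p, False) # a # g))" by (simp only: reduced_winv)
      then have r2: "reduced (winv (a # g) @ [(p, True)])" by (simp add: flip_def)
      have r: "reduced (winv (a # g) @ (p, True) # a # g)" by (rule reduced_join[OF r2 r1])
      have "inv\<^bsub>free_group X\<^esub> (a # g) \<otimes>\<^bsub>free_group X\<^esub> gen p = winv (a # g) @ [(p, True)]"
        using mult_reduced[OF r2, of X] inv_free_group[OF Cons.prems] by (simp only: gen_def)
      then show ?thesis
        using mult_reduced[of "winv (a # g) @ [(p, True)]" "a # g" X] r False by simp
    qed
  qed
  then show "inv\<^bsub>free_group X\<^esub> g \<otimes>\<^bsub>free_group X\<^esub> gen p \<otimes>\<^bsub>free_group X\<^esub> g = winv w @ (p, True) # w"
    "reduced (winv w @ (p, True) # w)" by simp_all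
qed

lemma suffix_dropWhile_Cons:
  assumes "suffix (a # v) w" "\<not> P a"
  shows "suffix (a # v) (dropWhile P w)"
proof -
  obtain u where "w = u @ a # v" using assms(1) by (auto simp: suffix_def)
  then show ?thesis using assms(2) by (induction u arbitrary: w) (auto simp: suffix_def)
qed

text \<open>
  The only obstacle to appending a letter \<open>x\<^sup>\<minusplus>\<^sup>1\<close> to the quotient \<open>w v\<^sup>-\<^sup>1\<close> is that it ends in
  \<open>x\<^sup>\<plusminus>\<^sup>1\<close>, and then \<open>w\<close> itself ends in \<open>x\<^sup>\<plusminus>\<^sup>1 v\<close>. This dichotomy is the source both of the
  criterion for descents and of the absence of cancellation when there are none.
\<close>

lemma quotient_snoc_reduced:
  assumes "reduced w" "reduced v" "reduced ((x, b) # v)"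
  shows "reduced (foldr push w (winv v) @ [(x, \<not> b)]) \<or> suffix ((x, b) # v) w"
proof (cases "reduced (foldr push w (winv v) @ [(x, \<not> b)])")
  case False
  define g where "g = foldr push w (winv v)"
  have red: "reduced g" unfolding g_def by (intro reduced_foldr_push) (simp add: assms)
  have ne: "g \<noteq> []" "last g = (x, b)"
    using False red unfolding g_def[symmetric]
    by (auto simp: reduced_iff_successively successively_append_iff flip_def prod_eq_iff)
  then obtain g' where g': "g = g' @ [(x, b)]" by (metis append_butlast_last_id)
  have "w = foldr push g v"
  proof -
    have "foldr push (winv v) v = []"
      using foldr_push_inverse[of "[]" v] assms by (simp add: foldr_push_Nil)
    then have "foldr push g v = foldr push w []"
      unfolding g_def using foldr_push_assoc[of "winv v" v w] assms by simp
    then show ?thesis using assms by (simp add: foldr_push_Nil)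
  qed
  also have "\<dots> = foldr push g' ((x, b) # v)"
    unfolding g' using push_reduced[OF assms(3)] by simp
  also have "\<dots> = g' @ (x, b) # v"
    using reduced_join[of g' "(x, b)" v] red assms(3) by (intro foldr_push_reduced) (simp add: g')
  finally show ?thesis by (simp add: suffix_def)
qed simp

context conj_auts
begin

text \<open>
  By \<open>conj_gen_word\<close>, the image of a basis element has odd length; its middle letter is the target
  and the second half is the conjugator. Outside of \<open>{1..n}\<close> the target is the identity, so that it
  is a permutation in the sense of \<open>permutes\<close>.
\<close>

definition target :: "word_map \<Rightarrow> nat \<Rightarrow> nat" where
  "target \<phi> i = (if i \<in> {1..n} then fst (\<phi> (gen i) ! (length (\<phi> (gen i)) div 2)) else i)"

definition conjugator :: "word_map \<Rightarrow> nat \<Rightarrow> (nat \<times> bool) list" where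
  "conjugator \<phi> i = drop (Suc (length (\<phi> (gen i)) div 2)) (\<phi> (gen i))"

lemma conjugator_eq:
  assumes "i \<in> {1..n}" "p \<in> {1..n}" "g \<in> carrier (F n)"
    and "\<phi> (gen i) = inv\<^sub>F g \<otimes>\<^sub>F gen p \<otimes>\<^sub>F g"
  shows "target \<phi> i = p" "conjugator \<phi> i = dropWhile (\<lambda>a. fst a = p) g"
    "\<phi> (gen i) = winv (conjugator \<phi> i) @ (p, True) # conjugator \<phi> i"
proof -
  define w where "w = dropWhile (\<lambda>a. fst a = p) g"
  have \<phi>: "\<phi> (gen i) = winv w @ (p, True) # w"
    using conj_gen_word(1)[OF assms(3,2)] assms(4) by (simp add: w_def)
  then have "length (\<phi> (gen i)) div 2 = length (winv w)" by simp
  then show "target \<phi> i = p" and c: "conjugator \<phi> i = dropWhile (\<lambda>a. fst a = p) g"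
    using assms(1) by (simp_all add: target_def conjugator_def \<phi> nth_append flip: w_def)
  show "\<phi> (gen i) = winv (conjugator \<phi> i) @ (p, True) # conjugator \<phi> i"
    using \<phi> unfolding c w_def .
qed

lemma target_permutes:
  assumes "\<phi> \<in> carrier C"
  shows "target \<phi> permutes {1..n}"
    and "i \<in> {1..n} \<Longrightarrow> \<phi> (gen i) = winv (conjugator \<phi> i) @ (target \<phi> i, True) # conjugator \<phi> i"
proof -
  obtain \<pi> f where \<pi>: "\<pi> permutes {1..n}" and f: "f \<in> {1..n} \<rightarrow> carrier (F n)"
    and val: "\<And>i. i \<in> {1..n} \<Longrightarrow> \<phi> (gen i) = inv\<^sub>F f i \<otimes>\<^sub>F gen (\<pi> i) \<otimes>\<^sub>F f i"
    using assms by (auto simp: carrier_C conjugating_def)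
  have *: "\<phi> (gen i) = winv (conjugator \<phi> i) @ (target \<phi> i, True) # conjugator \<phi> i \<and> target \<phi> i = \<pi> i"
    if i: "i \<in> {1..n}" for i
  proof -
    have "\<pi> i \<in> {1..n}" using permutes_in_image[OF \<pi>] i by blast
    then show ?thesis using conjugator_eq[where \<phi> = \<phi>, OF i _ funcset_mem[OF f i] val[OF i]] by simp
  qed
  have "target \<phi> i = \<pi> i" for i
    using * permutes_not_in[OF \<pi>] by (cases "i \<in> {1..n}") (auto simp: target_def)
  then have "target \<phi> = \<pi>" by blast
  then show "target \<phi> permutes {1..n}" using \<pi> by simp
  show "i \<in> {1..n} \<Longrightarrow> \<phi> (gen i) = winv (conjugator \<phi> i) @ (target \<phi> i, True) # conjugator \<phi> i"
    using * by blast
qed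

lemma target_in: "\<lbrakk>\<phi> \<in> carrier C; i \<in> {1..n}\<rbrakk> \<Longrightarrow> target \<phi> i \<in> {1..n}"
  using permutes_in_image[OF target_permutes(1)] by blast

lemma target_neq: "\<lbrakk>\<phi> \<in> carrier C; i \<noteq> j\<rbrakk> \<Longrightarrow> target \<phi> i \<noteq> target \<phi> j"
  using permutes_inj[OF target_permutes(1)] by (simp add: inj_eq)

lemma conjugator_closed:
  assumes "\<phi> \<in> carrier C" "i \<in> {1..n}"
  shows "conjugator \<phi> i \<in> carrier (F n)" "reduced ((target \<phi> i, b) # conjugator \<phi> i)"
    "reduced (winv (conjugator \<phi> i) @ [(target \<phi> i, b)])" "[(target \<phi> i, b)] \<in> carrier (F n)"
proof -
  let ?w = "conjugator \<phi> i" and ?p = "target \<phi> i"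
  have \<phi>: "winv ?w @ (?p, True) # ?w \<in> carrier (F n)"
    using C_apply(1)[OF assms(1) gen_in[OF assms(2)]] target_permutes(2)[OF assms] by simp
  then show "?w \<in> carrier (F n)"
    using reduced_appendD(2)[of "winv ?w @ [(?p, True)]" ?w] by (auto simp: carrier_free_group)
  have red: "reduced (winv ?w @ (?p, True) # ?w)" using \<phi> by (simp add: carrier_free_group)
  have 1: "reduced ((?p, True) # ?w)" using reduced_appendD(2)[OF red] .
  have "reduced (winv ?w @ [(?p, True)])" using reduced_appendD(1)[of "winv ?w @ [(?p, True)]" ?w] red by simp
  then have "reduced (winv ((?p, False) # ?w))" by (simp add: flip_def)
  then have 2: "reduced ((?p, False) # ?w)" by (simp only: reduced_winv)
  show *: "reduced ((?p, b) # ?w)" for b using 1 2 by (cases b) auto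
  have "reduced (winv ((?p, \<not> b) # ?w))" using * by (simp only: reduced_winv)
  then show "reduced (winv ?w @ [(?p, b)])" by (simp add: flip_def)
  show "[(target \<phi> i, b)] \<in> carrier (F n)" using target_in[OF assms] by (simp add: carrier_free_group)
qed

lemma inv_letter: "x \<in> {1..n} \<Longrightarrow> inv\<^sub>F [(x, b)] = [(x, \<not> b)]"
  by (subst inv_free_group) (auto simp: carrier_free_group flip_def)

lemma value_word:
  assumes "\<phi> \<in> carrier C" "i \<in> {1..n}"
  shows "F.signed b (\<phi> (gen i)) = winv (conjugator \<phi> i) @ (target \<phi> i, b) # conjugator \<phi> i"
    and "F.signed b (\<phi> (gen i))
      = inv\<^sub>F conjugator \<phi> i \<otimes>\<^sub>F ([(target \<phi> i, b)] \<otimes>\<^sub>F conjugator \<phi> i)"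
proof -
  let ?w = "conjugator \<phi> i" and ?p = "target \<phi> i"
  note cl = conjugator_closed[OF assms]
  have "inv\<^sub>F \<phi> (gen i) = winv ?w @ (?p, False) # ?w"
    using inv_free_group[OF C_apply(1)[OF assms(1) gen_in[OF assms(2)]]] target_permutes(2)[OF assms]
    by (simp add: flip_def rev_map[symmetric] comp_def)
  then show 1: "F.signed b (\<phi> (gen i)) = winv ?w @ (?p, b) # ?w"
    using target_permutes(2)[OF assms] by (auto simp: F.signed_def)
  have "[(?p, b)] \<otimes>\<^sub>F ?w = (?p, b) # ?w" using cl(2) by (simp add: mult_reduced)
  moreover have "winv ?w \<otimes>\<^sub>F ((?p, b) # ?w) = winv ?w @ (?p, b) # ?w"
    by (rule mult_reduced) (rule reduced_join[OF cl(3,2)])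
  ultimately show "F.signed b (\<phi> (gen i)) = inv\<^sub>F ?w \<otimes>\<^sub>F ([(?p, b)] \<otimes>\<^sub>F ?w)"
    using 1 inv_free_group[OF cl(1)] by simp
qed

lemma value_conj:
  assumes "\<phi> \<in> carrier C" "i \<in> {1..n}"
  shows "\<phi> (gen i) = inv\<^sub>F conjugator \<phi> i \<otimes>\<^sub>F gen (target \<phi> i) \<otimes>\<^sub>F conjugator \<phi> i"
  using value_word(2)[OF assms, of True] conjugator_closed[OF assms] 
  by (simp add: F.signed_def gen_def F.m_assoc)

lemma move_values:
  assumes \<phi>: "\<phi> \<in> carrier C" and ij: "i \<in> {1..n}" "j \<in> {1..n}" "i \<noteq> j"
  shows "\<lbrakk>l \<in> {1..n}; l \<noteq> i\<rbrakk> \<Longrightarrow> (\<phi> \<otimes>\<^sub>C W.move i j b) (gen l) = \<phi> (gen l)"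
    and "(\<phi> \<otimes>\<^sub>C W.move i j b) (gen i) = F.signed b (\<phi> (gen j)) \<otimes>\<^sub>F \<phi> (gen i)
      \<otimes>\<^sub>F inv\<^sub>F F.signed b (\<phi> (gen j))"
proof -
  have m: "W.move i j b \<in> carrier C" using ij by simp
  have x: "gen i \<in> carrier (F n)" "gen j \<in> carrier (F n)" using ij by simp_all
  show "(\<phi> \<otimes>\<^sub>C W.move i j b) (gen l) = \<phi> (gen l)" if "l \<in> {1..n}" "l \<noteq> i"
    using that e_gen[OF ij that(1)] inv_e_gen[OF ij that(1)] C_mult[OF \<phi> m]
    by (simp add: W.move_def C.signed_def)
  show "(\<phi> \<otimes>\<^sub>C W.move i j b) (gen i) = F.signed b (\<phi> (gen j)) \<otimes>\<^sub>F \<phi> (gen i)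
      \<otimes>\<^sub>F inv\<^sub>F F.signed b (\<phi> (gen j))"
    using e_gen[OF ij ij(1)] inv_e_gen[OF ij ij(1)] C_mult[OF \<phi> m] C_apply[OF \<phi>] x
    by (auto simp: W.move_def C.signed_def F.signed_def)
qed

text \<open>
  Stated for an arbitrary conjugating word \<open>g\<close>, not only for the shortest one, so that it can be
  applied twice in a row without shortening in between.
\<close>

lemma move_conjugator:
  fixes b :: bool
  assumes \<phi>: "\<phi> \<in> carrier C" and ij: "i \<in> {1..n}" "j \<in> {1..n}" "i \<noteq> j"
    and g: "g \<in> carrier (F n)" "p \<in> {1..n}" "\<phi> (gen i) = inv\<^sub>F g \<otimes>\<^sub>F gen p \<otimes>\<^sub>F g"
  defines "g' \<equiv> g \<otimes>\<^sub>F inv\<^sub>F F.signed b (\<phi> (gen j))"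
  shows "g' \<in> carrier (F n)"
    "(\<phi> \<otimes>\<^sub>C W.move i j b) (gen i) = inv\<^sub>F g' \<otimes>\<^sub>F gen p \<otimes>\<^sub>F g'"
proof -
  have y: "F.signed b (\<phi> (gen j)) \<in> carrier (F n)" using C_apply(1)[OF \<phi>] ij by simp
  then show "g' \<in> carrier (F n)" using g by (simp add: g'_def)
  show "(\<phi> \<otimes>\<^sub>C W.move i j b) (gen i) = inv\<^sub>F g' \<otimes>\<^sub>F gen p \<otimes>\<^sub>F g'"
    using move_values(2)[OF \<phi> ij] y g gen_in[OF g(2)] by (simp add: g'_def F.inv_mult_group F.m_assoc)
qed

text \<open>
  The criterion for the move \<open>(i, j, b)\<close> to lower the total length; see \<open>total_length_strict\<close>.
\<close>

definition descends :: "word_map \<Rightarrow> nat \<Rightarrow> nat \<Rightarrow> bool \<Rightarrow> bool" where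
  "descends \<phi> i j b \<longleftrightarrow> suffix ((target \<phi> j, b) # conjugator \<phi> j) (conjugator \<phi> i)"

lemma unaffected:
  assumes "\<phi> \<in> carrier C" "i \<in> {1..n}" "j \<in> {1..n}" "i \<noteq> j" "k \<in> {1..n}" "k \<noteq> i"
  shows "conjugator (\<phi> \<otimes>\<^sub>C W.move i j b) k = conjugator \<phi> k"
    and "target (\<phi> \<otimes>\<^sub>C W.move i j b) k = target \<phi> k"
  using move_values(1)[OF assms(1-4), of k b] assms by (simp_all add: conjugator_def target_def)

lemma cancel_conjugator:
  assumes \<phi>: "\<phi> \<in> carrier C" and j: "j \<in> {1..n}" and u: "u @ (target \<phi> j, b) # conjugator \<phi> j \<in> carrier (F n)"
  shows "u \<in> carrier (F n)"
    "(u @ (target \<phi> j, b) # conjugator \<phi> j) \<otimes>\<^sub>F inv\<^sub>F F.signed b (\<phi> (gen j)) = u \<otimes>\<^sub>F conjugator \<phi> j"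
proof -
  let ?w = "conjugator \<phi> j" and ?x = "[(target \<phi> j, b)]"
  note cl = conjugator_closed[OF \<phi> j]
  show ucl: "u \<in> carrier (F n)"
    using u reduced_appendD(1)[of u "(target \<phi> j, b) # ?w"] by (simp add: carrier_free_group image_Un)
  have "u \<otimes>\<^sub>F ((target \<phi> j, b) # ?w) = u @ (target \<phi> j, b) # ?w"
    using u by (intro mult_reduced) (simp add: carrier_free_group)
  moreover have "?x \<otimes>\<^sub>F ?w = (target \<phi> j, b) # ?w" using cl(2) by (simp add: mult_reduced)
  ultimately have "u @ (target \<phi> j, b) # ?w = u \<otimes>\<^sub>F (?x \<otimes>\<^sub>F ?w)" by simp
  then show "(u @ (target \<phi> j, b) # ?w) \<otimes>\<^sub>F inv\<^sub>F F.signed b (\<phi> (gen j)) = u \<otimes>\<^sub>F ?w"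
    using value_word(2)[OF \<phi> j, of b] cl(1) cl(4)[of b] ucl
    by (simp add: F.m_assoc F.inv_mult_group)
qed

definition total_length :: "word_map \<Rightarrow> nat" where
  "total_length \<phi> = (\<Sum>i\<in>{1..n}. length (\<phi> (gen i)))"

lemma length_value:
  assumes "i \<in> {1..n}" "p \<in> {1..n}" "g \<in> carrier (F n)"
    and "\<phi> (gen i) = inv\<^sub>F g \<otimes>\<^sub>F gen p \<otimes>\<^sub>F g"
  shows "length (\<phi> (gen i)) \<le> 2 * length g + 1"
  using conjugator_eq(2,3)[where \<phi> = \<phi>, OF assms] length_dropWhile_le[of "\<lambda>a. fst a = p" g] by simp

lemma length_mult: "length (u \<otimes>\<^sub>F v) \<le> length u + length v"
  by (simp add: mult_free_group length_foldr_push)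

lemma total_length_less:
  assumes "i \<in> {1..n}" "length (\<psi> (gen i)) < length (\<phi> (gen i))"
    and "\<And>l. \<lbrakk>l \<in> {1..n}; l \<noteq> i\<rbrakk> \<Longrightarrow> length (\<psi> (gen l)) \<le> length (\<phi> (gen l))"
  shows "total_length \<psi> < total_length \<phi>"
  unfolding total_length_def
proof (rule sum_strict_mono_ex1)
  show "\<forall>l\<in>{1..n}. length (\<psi> (gen l)) \<le> length (\<phi> (gen l))"
    using assms by (metis less_imp_le)
qed (use assms in auto)

text \<open>
  If \<open>w\<^sub>i = u p\<^sub>j\<^sup>\<plusminus>\<^sup>1 w\<^sub>j\<close>, then multiplication by \<open>w\<^sub>j\<^sup>-\<^sup>1 p\<^sub>j\<^sup>\<minusplus>\<^sup>1 w\<^sub>j\<close> replaces it by \<open>u w\<^sub>j\<close>.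
\<close>

lemma descends_length:
  assumes \<phi>: "\<phi> \<in> carrier C" and ij: "i \<in> {1..n}" "j \<in> {1..n}" "i \<noteq> j" and desc: "descends \<phi> i j b"
  shows "length ((\<phi> \<otimes>\<^sub>C W.move i j b) (gen i)) < length (\<phi> (gen i))"
proof -
  obtain u where u: "conjugator \<phi> i = u @ (target \<phi> j, b) # conjugator \<phi> j"
    using desc by (auto simp: descends_def suffix_def)
  note g = conjugator_closed(1)[OF \<phi> ij(1)] and p = target_in[OF \<phi> ij(1)]
  note mc = move_conjugator[where \<phi> = \<phi>, OF \<phi> ij g p value_conj[OF \<phi> ij(1)], of b]
  have "conjugator \<phi> i \<otimes>\<^sub>F inv\<^sub>F F.signed b (\<phi> (gen j)) = u \<otimes>\<^sub>F conjugator \<phi> j"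
    using cancel_conjugator(2)[OF \<phi> ij(2), of u b] g u by simp
  then have "length ((\<phi> \<otimes>\<^sub>C W.move i j b) (gen i)) \<le> 2 * length (u \<otimes>\<^sub>F conjugator \<phi> j) + 1"
    using length_value[where \<phi> = "\<phi> \<otimes>\<^sub>C W.move i j b", OF ij(1) p mc] by simp
  also have "\<dots> \<le> 2 * (length u + length (conjugator \<phi> j)) + 1" using length_mult[of u "conjugator \<phi> j"] by simp
  also have "\<dots> < 2 * length (conjugator \<phi> i) + 1" by (simp add: u)
  also have "\<dots> = length (\<phi> (gen i))" using target_permutes(2)[OF \<phi> ij(1)] by simp
  finally show ?thesis .
qed

lemma descends_total_length:
  assumes "\<phi> \<in> carrier C" "i \<in> {1..n}" "j \<in> {1..n}" "i \<noteq> j" "descends \<phi> i j b"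
  shows "total_length (\<phi> \<otimes>\<^sub>C W.move i j b) < total_length \<phi>"
  using total_length_less[where \<phi> = \<phi> and \<psi> = "\<phi> \<otimes>\<^sub>C W.move i j b", OF assms(2) descends_length[OF assms]] move_values(1)[OF assms(1-4)] by simp

text \<open>
  If \<open>w\<^sub>i\<close> does not end in \<open>p\<^sub>j\<^sup>\<plusminus>\<^sup>1 w\<^sub>j\<close>, then the new conjugator ends in \<open>p\<^sub>j\<^sup>\<minusplus>\<^sup>1 w\<^sub>j\<close>, even after powers
  of \<open>p\<^sub>i\<close> have been dropped from its beginning, since \<open>p\<^sub>i\<close> and \<open>p\<^sub>j\<close> are different. So a move that
  is not a descent is undone by a descent, and no move preserves the total length.
\<close>

lemma descends_back:
  assumes \<phi>: "\<phi> \<in> carrier C" and ij: "i \<in> {1..n}" "j \<in> {1..n}" "i \<noteq> j" and desc: "\<not> descends \<phi> i j b"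
  shows "descends (\<phi> \<otimes>\<^sub>C W.move i j b) i j (\<not> b)"
proof -
  let ?w = "conjugator \<phi> i" and ?v = "conjugator \<phi> j" and ?q = "target \<phi> j"
  note w = conjugator_closed[OF \<phi> ij(1)] and v = conjugator_closed[OF \<phi> ij(2)]
  define g where "g = foldr push ?w (winv ?v)"
  have "reduced ?w" "reduced ?v" using w(1) v(1) by (simp_all add: carrier_free_group)
  then have snoc: "reduced (g @ [(?q, \<not> b)])"
    using quotient_snoc_reduced[of ?w ?v ?q b] v(2) desc by (simp add: g_def descends_def)
  have g: "g = ?w \<otimes>\<^sub>F inv\<^sub>F ?v" using v(1) by (simp add: g_def mult_free_group inv_free_group)
  have q: "?q \<in> {1..n}" using target_in[OF \<phi> ij(2)] .
  have "?w \<otimes>\<^sub>F inv\<^sub>F F.signed b (\<phi> (gen j)) = ?w \<otimes>\<^sub>F inv\<^sub>F ?v \<otimes>\<^sub>F ([(?q, \<not> b)] \<otimes>\<^sub>F ?v)"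
    using value_word(2)[OF \<phi> ij(2), of b] w(1) v(1) v(4)[of b] v(4)[of "\<not> b"] inv_letter[OF q, of b]
    by (simp add: F.inv_mult_group F.m_assoc)
  also have "[(?q, \<not> b)] \<otimes>\<^sub>F ?v = (?q, \<not> b) # ?v" using v(2) by (simp add: mult_reduced)
  also have "?w \<otimes>\<^sub>F inv\<^sub>F ?v \<otimes>\<^sub>F ((?q, \<not> b) # ?v) = g @ (?q, \<not> b) # ?v"
    unfolding g[symmetric] by (rule mult_reduced) (rule reduced_join[OF snoc v(2)])
  finally have R: "?w \<otimes>\<^sub>F inv\<^sub>F F.signed b (\<phi> (gen j)) = g @ (?q, \<not> b) # ?v" .
  note p = target_in[OF \<phi> ij(1)]
  note mc = move_conjugator[where \<phi> = \<phi>, OF \<phi> ij w(1) p value_conj[OF \<phi> ij(1)], of b]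
  have "conjugator (\<phi> \<otimes>\<^sub>C W.move i j b) i = dropWhile (\<lambda>a. fst a = target \<phi> i) (g @ (?q, \<not> b) # ?v)"
    using conjugator_eq(2)[where \<phi> = "\<phi> \<otimes>\<^sub>C W.move i j b", OF ij(1) p mc] R by simp
  moreover have "suffix ((?q, \<not> b) # ?v) (dropWhile (\<lambda>a. fst a = target \<phi> i) (g @ (?q, \<not> b) # ?v))"
    using target_neq[OF \<phi> ij(3)] by (intro suffix_dropWhile_Cons) (auto simp: suffix_def)
  ultimately show ?thesis using unaffected[OF \<phi> ij ij(2)] ij by (simp add: descends_def)
qed

lemma total_length_strict:
  assumes \<phi>: "\<phi> \<in> carrier C" and ij: "i \<in> {1..n}" "j \<in> {1..n}" "i \<noteq> j"
  shows "descends \<phi> i j b \<longleftrightarrow> total_length (\<phi> \<otimes>\<^sub>C W.move i j b) < total_length \<phi>"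
    and "total_length (\<phi> \<otimes>\<^sub>C W.move i j b) \<noteq> total_length \<phi>"
proof -
  have m: "W.move i j b \<in> carrier C" "W.move i j (\<not> b) \<in> carrier C" using ij by simp_all
  have undo: "\<phi> \<otimes>\<^sub>C W.move i j b \<otimes>\<^sub>C W.move i j (\<not> b) = \<phi>"
    using \<phi> m W.inv_move[OF ij, of b, symmetric] by (simp add: C.m_assoc)
  consider "descends \<phi> i j b" "total_length (\<phi> \<otimes>\<^sub>C W.move i j b) < total_length \<phi>"
    | "\<not> descends \<phi> i j b" "total_length \<phi> < total_length (\<phi> \<otimes>\<^sub>C W.move i j b)"
    using descends_total_length[OF \<phi> ij, of b]
      descends_total_length[OF C.m_closed[OF \<phi> m(1)] ij descends_back[OF \<phi> ij]] undo
    by (cases "descends \<phi> i j b") auto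
  then show "descends \<phi> i j b \<longleftrightarrow> total_length (\<phi> \<otimes>\<^sub>C W.move i j b) < total_length \<phi>"
    "total_length (\<phi> \<otimes>\<^sub>C W.move i j b) \<noteq> total_length \<phi>"
    by (cases; simp)+
qed

end



section \<open>Existence of descents\<close>

context conj_auts
begin

lemma C_letter:
  assumes "\<phi> \<in> carrier C" "i \<in> {1..n}"
  shows "\<phi> [(i, b)] = F.signed b (\<phi> (gen i))"
  using letter_cases[of "(i, b)" "{1..n}"] assms C_apply[OF assms(1)] by (simp add: F.signed_def)

text \<open>
  Multiply out from the right. Between two middle letters \<open>p\<^sub>i\<^sup>\<plusminus>\<^sup>1\<close> and \<open>p\<^sub>j\<^sup>\<plusminus>\<^sup>1\<close> stands the quotient
  \<open>w\<^sub>i w\<^sub>j\<^sup>-\<^sup>1\<close>, and without descents neither of its ends cancels against these letters. So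
  the product starts with \<open>w\<^sub>i\<^sup>-\<^sup>1\<close> followed by the middle letter of its first factor.
\<close>

lemma no_descent_head:
  assumes \<phi>: "\<phi> \<in> carrier C"
    and none: "\<And>i j b. \<lbrakk>i \<in> {1..n}; j \<in> {1..n}; i \<noteq> j\<rbrakk> \<Longrightarrow> \<not> descends \<phi> i j b"
  shows "(i, b) # z \<in> carrier (F n)
    \<Longrightarrow> \<exists>r. \<phi> ((i, b) # z) = winv (conjugator \<phi> i) @ (target \<phi> i, b) # r"
proof (induction z arbitrary: i b)
  case Nil
  then have "i \<in> {1..n}" by (simp add: carrier_free_group)
  then show ?case using value_word(1)[OF \<phi>] C_letter[OF \<phi>] by auto
next
  case (Cons a z)
  obtain j d where a: "a = (j, d)" by (cases a)
  have i: "i \<in> {1..n}" and j: "j \<in> {1..n}" and ne: "(j, d) \<noteq> flip (i, b)"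
    and tail: "(j, d) # z \<in> carrier (F n)" and red: "reduced ([(i, b)] @ (j, d) # z)"
    and i': "[(i, b)] \<in> carrier (F n)"
    using Cons.prems by (auto simp: carrier_free_group a)
  let ?w = "conjugator \<phi> i" and ?v = "conjugator \<phi> j" and ?p = "target \<phi> i" and ?q = "target \<phi> j"
  note w = conjugator_closed[OF \<phi> i] and v = conjugator_closed[OF \<phi> j]
  obtain r where r: "\<phi> ((j, d) # z) = winv ?v @ (?q, d) # r" using Cons.IH[OF tail] by blast
  define t where "t = (?q, d) # r"
  have vt: "winv ?v @ t \<in> carrier (F n)" using C_apply(1)[OF \<phi> tail] r by (simp add: t_def)
  then have rvt: "reduced (winv ?v @ t)" by (simp add: carrier_free_group)
  have t: "t \<in> carrier (F n)" "reduced t"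
    using vt reduced_appendD(2)[OF rvt] by (auto simp: carrier_free_group)
  have "\<phi> ((i, b) # a # z) = \<phi> [(i, b)] \<otimes>\<^sub>F \<phi> ((j, d) # z)"
    using C_apply(2)[OF \<phi> i' tail] mult_reduced[OF red, of "{1..n}"] by (simp add: a)
  also have "\<dots> = inv\<^sub>F ?w \<otimes>\<^sub>F ([(?p, b)] \<otimes>\<^sub>F ?w) \<otimes>\<^sub>F (inv\<^sub>F ?v \<otimes>\<^sub>F t)"
    unfolding C_letter[OF \<phi> i] value_word(2)[OF \<phi> i] r t_def[symmetric]
    using mult_reduced[OF rvt, of "{1..n}"] inv_free_group[OF v(1)] by simp
  also have "\<dots> = inv\<^sub>F ?w \<otimes>\<^sub>F ([(?p, b)] \<otimes>\<^sub>F (?w \<otimes>\<^sub>F inv\<^sub>F ?v \<otimes>\<^sub>F t))"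
    using w(1) w(4)[of b] v(1) t(1) by (simp add: F.m_assoc)
  finally have \<phi>z: "\<phi> ((i, b) # a # z)
      = inv\<^sub>F ?w \<otimes>\<^sub>F ([(?p, b)] \<otimes>\<^sub>F (?w \<otimes>\<^sub>F inv\<^sub>F ?v \<otimes>\<^sub>F t))" .
  define g where "g = ?w \<otimes>\<^sub>F inv\<^sub>F ?v"
  have gcl: "g \<in> carrier (F n)" using w(1) v(1) by (simp add: g_def)
  have "reduced (g @ t) \<and> reduced ((?p, b) # g @ t)"
  proof (cases "i = j")
    case True
    then have "b = d" using ne by (auto simp: flip_def)
    moreover have "g = []" using True v(1) by (simp add: g_def F.r_inv one_free_group)
    ultimately show ?thesis using t(2) True by (simp add: t_def flip_def)
  next
    case False
    have rw: "reduced ?w" "reduced ?v" using w(1) v(1) by (simp_all add: carrier_free_group)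
    have g: "g = foldr push ?w (winv ?v)" using v(1) by (simp add: g_def mult_free_group inv_free_group)
    \<comment> \<open>The first letter of \<open>g\<close> is the inverse of the last letter of its inverse, which is the
      quotient in the opposite order.\<close>
    have "inv\<^sub>F g = ?v \<otimes>\<^sub>F inv\<^sub>F ?w" using w(1) v(1) by (simp add: g_def F.inv_mult_group)
    then have g': "winv g = foldr push ?v (winv ?w)"
      using inv_free_group[OF gcl] w(1) by (simp add: mult_free_group inv_free_group)
    have "\<not> descends \<phi> i j (\<not> d)" "\<not> descends \<phi> j i b" using none i j False by auto
    then have 1: "reduced (g @ [(?q, d)])"
      using quotient_snoc_reduced[OF rw v(2), of "\<not> d"] by (simp add: descends_def g)
    have "reduced (winv g @ [(?p, \<not> b)])"
      using quotient_snoc_reduced[OF rw(2,1) w(2), of b] none[OF j i False[symmetric], of b]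
      unfolding g' by (simp add: descends_def)
    then have "reduced (winv ((?p, b) # g))" by (simp add: flip_def)
    then have 2: "reduced ((?p, b) # g)" by (simp only: reduced_winv)
    have 3: "reduced (g @ t)" using reduced_join[OF 1] t(2) by (simp add: t_def)
    moreover have "reduced ((?p, b) # g @ t)"
    proof (cases g)
      case Nil
      then show ?thesis using t(2) target_neq[OF \<phi> False] by (auto simp: t_def flip_def)
    qed (use 2 3 in auto)
    ultimately show ?thesis by blast
  qed
  then have 1: "g \<otimes>\<^sub>F t = g @ t" and 2: "reduced ((?p, b) # g @ t)" by (simp_all add: mult_reduced)
  have "[(?p, b)] \<otimes>\<^sub>F (g @ t) = (?p, b) # g @ t" using mult_reduced[of "[(?p, b)]" "g @ t"] 2 by simp
  moreover have "winv ?w \<otimes>\<^sub>F ((?p, b) # g @ t) = winv ?w @ (?p, b) # g @ t"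
    by (rule mult_reduced) (rule reduced_join[OF w(3) 2])
  ultimately have "\<phi> ((i, b) # a # z) = winv ?w @ (?p, b) # g @ t"
    unfolding \<phi>z g_def[symmetric] 1 using inv_free_group[OF w(1)] by simp
  then show ?case by blast
qed

definition perm_auts :: "word_map set" where
  "perm_auts = {\<phi> \<in> carrier C. \<forall>i\<in>{1..n}. conjugator \<phi> i = []}"

lemma perm_auts_eq:
  assumes "\<phi> \<in> perm_auts"
  shows "\<phi> = W.\<rho> (target \<phi>)"
proof (rule C_eqI)
  have \<phi>: "\<phi> \<in> carrier C" using assms by (simp add: perm_auts_def)
  then show "\<phi> \<in> carrier C" "W.\<rho> (target \<phi>) \<in> carrier C" using target_permutes(1) by auto
  show "\<phi> (gen l) = W.\<rho> (target \<phi>) (gen l)" if "l \<in> {1..n}" for l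
    using target_permutes(2)[OF \<phi> that] \<rho>_gen[OF target_permutes(1)[OF \<phi>] that] assms that
    by (simp add: perm_auts_def gen_def)
qed

lemma perm_autsI:
  assumes \<phi>: "\<phi> \<in> carrier C" and val: "\<And>i. i \<in> {1..n} \<Longrightarrow> \<phi> (gen i) = gen (p i)"
  shows "\<phi> \<in> perm_auts"
  unfolding perm_auts_def using \<phi> val by (simp add: conjugator_def gen_def)

text \<open>
  As \<open>\<phi>\<close> is surjective, each basis element \<open>p\<^sub>i\<close> is the image of a nonempty word. By the previous
  lemma this image is a single letter only if the conjugator for the first letter of the word is
  empty and its target is \<open>p\<^sub>i\<close>; then this first letter belongs to \<open>x\<^sub>i\<close>.
\<close>

lemma no_descent_perm_aut:
  assumes \<phi>: "\<phi> \<in> carrier C"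
    and none: "\<And>i j b. \<lbrakk>i \<in> {1..n}; j \<in> {1..n}; i \<noteq> j\<rbrakk> \<Longrightarrow> \<not> descends \<phi> i j b"
  shows "\<phi> \<in> perm_auts"
proof -
  have "conjugator \<phi> i = []" if i: "i \<in> {1..n}" for i
  proof -
    have "gen (target \<phi> i) \<in> \<phi> ` carrier (F n)"
      using autD(3)[OF C_auto[OF \<phi>]] target_in[OF \<phi> i] by (simp add: bij_betw_def)
    then obtain z where z: "z \<in> carrier (F n)" "\<phi> z = gen (target \<phi> i)" by auto
    interpret group_hom "F n" "F n" \<phi> by (rule C_hom[OF \<phi>])
    have "z \<noteq> []" using hom_one z(2) by (auto simp: one_free_group gen_def)
    then obtain k b z' where z': "z = (k, b) # z'" by (metis list.exhaust surj_pair)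
    have k: "k \<in> {1..n}" using z(1) by (simp add: z' carrier_free_group)
    obtain r where "\<phi> z = winv (conjugator \<phi> k) @ (target \<phi> k, b) # r"
      using no_descent_head[OF \<phi> none] z(1) z' by blast
    then have "conjugator \<phi> k = []" "target \<phi> k = target \<phi> i"
      using z(2) by (auto simp: gen_def Cons_eq_append_conv)
    moreover from this have "k = i" using target_neq[OF \<phi>] by blast
    ultimately show ?thesis by simp
  qed
  then show ?thesis using \<phi> by (simp add: perm_auts_def)
qed

lemma perm_aut_no_descent:
  assumes "\<phi> \<in> perm_auts" "i \<in> {1..n}"
  shows "\<not> descends \<phi> i j b"
  using assms by (auto simp: perm_auts_def descends_def)

lemma descends_unaffected:
  assumes "\<phi> \<in> carrier C" "i \<in> {1..n}" "j \<in> {1..n}" "i \<noteq> j" "k \<in> {1..n}" "k \<noteq> i" "l \<in> {1..n}" "l \<noteq> i"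
  shows "descends (\<phi> \<otimes>\<^sub>C W.move i j b) k l c \<longleftrightarrow> descends \<phi> k l c"
  using unaffected[OF assms(1-6)] unaffected[OF assms(1-4,7,8)] by (simp add: descends_def)

text \<open>
  With \<open>w\<^sub>j = u' p\<^sub>l\<^sup>\<plusminus>\<^sup>1 w\<^sub>l\<close> and \<open>w\<^sub>i = u p\<^sub>j\<^sup>\<plusminus>\<^sup>1 w\<^sub>j\<close>, the three moves replace \<open>w\<^sub>j\<close> by \<open>u' w\<^sub>l\<close> and \<open>w\<^sub>i\<close> by
  \<open>u u' w\<^sub>l\<close>. The last of them need not be a descent, but the length stays below that of \<open>\<phi>\<close>.
\<close>

lemma triangle_length:
  assumes \<phi>: "\<phi> \<in> carrier C" and ijl: "i \<in> {1..n}" "j \<in> {1..n}" "l \<in> {1..n}" "distinct [i, j, l]"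
    and desc: "descends \<phi> i j b" "descends \<phi> j l c"
  shows "total_length (\<phi> \<otimes>\<^sub>C W.move i j b \<otimes>\<^sub>C W.move j l c \<otimes>\<^sub>C W.move i l c) < total_length \<phi>"
proof -
  define A where "A = \<phi> \<otimes>\<^sub>C W.move i j b"
  define A' where "A' = A \<otimes>\<^sub>C W.move j l c"
  define D where "D = A' \<otimes>\<^sub>C W.move i l c"
  have ne: "i \<noteq> j" "j \<noteq> l" "i \<noteq> l" using ijl(4) by auto
  have A: "A \<in> carrier C" and A': "A' \<in> carrier C" using \<phi> ijl ne by (simp_all add: A_def A'_def)
  let ?p = "target \<phi> i"
  note p = target_in[OF \<phi> ijl(1)]
  have A_val: "A (gen k) = \<phi> (gen k)" if "k \<in> {1..n}" "k \<noteq> i" for k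
    using move_values(1)[OF \<phi> ijl(1,2) ne(1) that] by (simp add: A_def)
  have A'_val: "A' (gen k) = A (gen k)" if "k \<in> {1..n}" "k \<noteq> j" for k
    using move_values(1)[OF A ijl(2,3) ne(2) that] by (simp add: A'_def)
  have D_val: "D (gen k) = A' (gen k)" if "k \<in> {1..n}" "k \<noteq> i" for k
    using move_values(1)[OF A' ijl(1,3) ne(3) that] by (simp add: D_def)
  obtain u where u: "conjugator \<phi> i = u @ (target \<phi> j, b) # conjugator \<phi> j"
    using desc(1) by (auto simp: descends_def suffix_def)
  obtain u' where u': "conjugator \<phi> j = u' @ (target \<phi> l, c) # conjugator \<phi> l"
    using desc(2) by (auto simp: descends_def suffix_def)
  have ucl: "u \<in> carrier (F n)" "u' \<in> carrier (F n)"
    using cancel_conjugator(1)[OF \<phi> ijl(2), of u b] cancel_conjugator(1)[OF \<phi> ijl(3), of u' c]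
      conjugator_closed(1)[OF \<phi>] ijl u u' by metis+
  let ?g = "u \<otimes>\<^sub>F conjugator \<phi> j"
  have gcl: "?g \<in> carrier (F n)" using ucl conjugator_closed(1)[OF \<phi> ijl(2)] by simp
  have "conjugator \<phi> i \<otimes>\<^sub>F inv\<^sub>F F.signed b (\<phi> (gen j)) = ?g"
    using cancel_conjugator(2)[OF \<phi> ijl(2), of u b] conjugator_closed(1)[OF \<phi> ijl(1)] u by simp
  then have "A (gen i) = inv\<^sub>F ?g \<otimes>\<^sub>F gen ?p \<otimes>\<^sub>F ?g"
    using move_conjugator(2)[where \<phi> = \<phi>, OF \<phi> ijl(1,2) ne(1) conjugator_closed(1)[OF \<phi> ijl(1)] p
      value_conj[OF \<phi> ijl(1)], of b] by (simp add: A_def)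
  then have A'_i: "A' (gen i) = inv\<^sub>F ?g \<otimes>\<^sub>F gen ?p \<otimes>\<^sub>F ?g" using A'_val[OF ijl(1) ne(1)] by simp
  note D_i = move_conjugator[where \<phi> = A', OF A' ijl(1,3) ne(3) gcl p A'_i, of c]
  have "?g \<otimes>\<^sub>F inv\<^sub>F F.signed c (A' (gen l)) = u \<otimes>\<^sub>F (u' \<otimes>\<^sub>F conjugator \<phi> l)"
  proof -
    have "A' (gen l) = \<phi> (gen l)" using A'_val[of l] A_val[of l] ijl by auto
    moreover have "conjugator \<phi> j \<otimes>\<^sub>F inv\<^sub>F F.signed c (\<phi> (gen l)) = u' \<otimes>\<^sub>F conjugator \<phi> l"
      using cancel_conjugator(2)[OF \<phi> ijl(3), of u' c] conjugator_closed(1)[OF \<phi> ijl(2)] u' by simp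
    ultimately show ?thesis
      using ucl conjugator_closed(1)[OF \<phi> ijl(2)] C_apply(1)[OF \<phi> gen_in[OF ijl(3)]] by (simp add: F.m_assoc)
  qed
  then have "length (D (gen i)) \<le> 2 * length (u \<otimes>\<^sub>F (u' \<otimes>\<^sub>F conjugator \<phi> l)) + 1"
    using length_value[where \<phi> = D, OF ijl(1) p D_i(1)] D_i(2) by (simp add: D_def)
  also have "\<dots> \<le> 2 * (length u + (length u' + length (conjugator \<phi> l))) + 1"
    using length_mult[of u "u' \<otimes>\<^sub>F conjugator \<phi> l"] length_mult[of u' "conjugator \<phi> l"] by simp
  also have "\<dots> \<le> 2 * length (conjugator \<phi> i) + 1" by (simp add: u u')
  also have "\<dots> = length (\<phi> (gen i))" using target_permutes(2)[OF \<phi> ijl(1)] by simp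
  finally have Di: "length (D (gen i)) \<le> length (\<phi> (gen i))" .
  have "descends A j l c"
    using desc(2) descends_unaffected[OF \<phi> ijl(1,2) ne(1) ijl(2) _ ijl(3)] ne by (simp add: A_def)
  then have "length (A' (gen j)) < length (A (gen j))"
    using descends_length[OF A ijl(2,3) ne(2)] by (simp add: A'_def)
  then have Dj: "length (D (gen j)) < length (\<phi> (gen j))" using D_val[of j] A_val[of j] ijl by auto
  have "length (D (gen k)) \<le> length (\<phi> (gen k))" if "k \<in> {1..n}" "k \<noteq> j" for k
    using Di D_val[OF that(1)] A'_val[OF that] A_val[OF that(1)] by (cases "k = i") simp_all
  from total_length_less[where \<phi> = \<phi> and \<psi> = D, OF ijl(2) Dj this] show ?thesis
    by (simp add: D_def A'_def A_def)
qed

end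


section \<open>Resolving peaks\<close>

context group
begin

text \<open>
  Here \<open>A\<close> and \<open>B\<close> are the values at the lower neighbours of a peak, reached by the moves with
  labels \<open>x\<close> and \<open>y\<close>. The equation between them comes from the common vertex at the bottom of a
  square, or of a hexagon whose two middle edges both have the label \<open>z\<close>.
\<close>

lemma square_labels:
  assumes "x \<in> carrier G" "y \<in> carrier G" "A \<in> carrier G" "B \<in> carrier G"
    and "A \<otimes> y = B \<otimes> x" "x \<otimes> y = y \<otimes> x"
  shows "A \<otimes> inv x = B \<otimes> inv y"
proof -
  have "A \<otimes> inv x \<otimes> (x \<otimes> y) = A \<otimes> y" "B \<otimes> inv y \<otimes> (y \<otimes> x) = B \<otimes> x"
    using assms(1-4) by (simp_all add: m_assoc)
  then have "A \<otimes> inv x \<otimes> (x \<otimes> y) = B \<otimes> inv y \<otimes> (x \<otimes> y)" using assms(5,6) by simp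
  then show ?thesis using assms(1-4) by simp
qed

lemma triangle_labels:
  assumes "x \<in> carrier G" "y \<in> carrier G" "z \<in> carrier G" "A \<in> carrier G" "B \<in> carrier G"
    and "A \<otimes> z \<otimes> y = B \<otimes> z \<otimes> x" "y \<otimes> z = z \<otimes> y" "y \<otimes> z \<otimes> x = x \<otimes> (y \<otimes> z)"
  shows "A \<otimes> inv x = B \<otimes> inv y"
proof -
  have "A \<otimes> inv x \<otimes> (x \<otimes> (y \<otimes> z)) = A \<otimes> (y \<otimes> z)" "B \<otimes> inv y \<otimes> (y \<otimes> z \<otimes> x) = B \<otimes> z \<otimes> x"
    using assms(1-5) by (simp_all add: m_assoc)
  moreover have "A \<otimes> (y \<otimes> z) = A \<otimes> z \<otimes> y" unfolding assms(7) using assms(2-4) by (simp add: m_assoc)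
  ultimately have "A \<otimes> inv x \<otimes> (x \<otimes> (y \<otimes> z)) = B \<otimes> inv y \<otimes> (x \<otimes> (y \<otimes> z))" using assms(6,8) by simp
  then show ?thesis using assms(1-5) by simp
qed

end

locale conj_aut_labels = conj_auts n + H: welded H n a s
  for n :: nat and H :: "('h, 'x) monoid_scheme" and a s :: "nat \<Rightarrow> 'h"
begin

abbreviation H_times (infixl "\<otimes>\<^sub>H" 70) where "x \<otimes>\<^sub>H y \<equiv> x \<otimes>\<^bsub>H\<^esub> y"
abbreviation H_inverse ("inv\<^sub>H _" [81] 80) where "inv\<^sub>H x \<equiv> inv\<^bsub>H\<^esub> x"

context
  fixes v :: word_map
    and f :: "word_map \<Rightarrow> 'h"
  assumes v: "v \<in> carrier C" and f: "f \<in> carrier C \<rightarrow> carrier H"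
    and below: "\<And>u i j b. \<lbrakk>u \<in> carrier C; i \<in> {1..n}; j \<in> {1..n}; i \<noteq> j; total_length u < total_length v;
      total_length (u \<otimes>\<^sub>C W.move i j b) < total_length v\<rbrakk>
      \<Longrightarrow> f (u \<otimes>\<^sub>C W.move i j b) = f u \<otimes>\<^sub>H H.move i j b"
begin

text \<open>
  The value at \<open>v\<close> that is forced by the value at its lower neighbour along the move \<open>(i, j, b)\<close>.
\<close>

abbreviation "via i j b \<equiv> f (v \<otimes>\<^sub>C W.move i j b) \<otimes>\<^sub>H inv\<^sub>H H.move i j b"

lemma below_descent:
  assumes "u \<in> carrier C" "i \<in> {1..n}" "j \<in> {1..n}" "i \<noteq> j" "total_length u \<le> total_length v"
    and "descends u i j b"
  shows "total_length (u \<otimes>\<^sub>C W.move i j b) < total_length v"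
  using descends_total_length[OF assms(1-4,6)] assms(5) by simp

text \<open>
  The two moves change different words of the tuple and do not conjugate by a word that the other
  one changes, so each remains a descent after the other one; \<open>j = l\<close> is allowed.
\<close>

lemma square_peak:
  assumes ij: "i \<in> {1..n}" "j \<in> {1..n}" "i \<noteq> j" and kl: "k \<in> {1..n}" "l \<in> {1..n}" "k \<noteq> l"
    and desc: "descends v i j b" "descends v k l c"
    and indep: "i \<noteq> k" "i \<noteq> l" "j \<noteq> k"
  shows "via i j b = via k l c"
proof -
  let ?m = "W.move i j b" and ?m' = "W.move k l c"
  have m: "?m \<in> carrier C" "?m' \<in> carrier C" using ij kl by simp_all
  have comm: "?m \<otimes>\<^sub>C ?m' = ?m' \<otimes>\<^sub>C ?m" "H.move i j b \<otimes>\<^sub>H H.move k l c = H.move k l c \<otimes>\<^sub>H H.move i j b"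
    if "j = l"
    using W.move_same_conjugator[of i k j b c] H.move_same_conjugator[of i k j b c] that ij kl indep
    by simp_all
  have comm': "?m \<otimes>\<^sub>C ?m' = ?m' \<otimes>\<^sub>C ?m" "H.move i j b \<otimes>\<^sub>H H.move k l c = H.move k l c \<otimes>\<^sub>H H.move i j b"
    if "j \<noteq> l"
    using W.move_disjoint[of i j k l b c] H.move_disjoint[of i j k l b c] that ij kl indep
    by simp_all
  note comm = comm comm'
  have less: "total_length (v \<otimes>\<^sub>C ?m) < total_length v" "total_length (v \<otimes>\<^sub>C ?m') < total_length v"
    using below_descent[OF v] ij kl desc by simp_all
  have "descends (v \<otimes>\<^sub>C ?m) k l c" using descends_unaffected[OF v ij kl(1) _ kl(2)] indep desc by simp
  then have top: "total_length (v \<otimes>\<^sub>C ?m \<otimes>\<^sub>C ?m') < total_length v"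
    using below_descent[OF _ kl, of "v \<otimes>\<^sub>C ?m"] less v m by simp
  have same: "v \<otimes>\<^sub>C ?m \<otimes>\<^sub>C ?m' = v \<otimes>\<^sub>C ?m' \<otimes>\<^sub>C ?m" using v m comm(1,3) by (cases "j = l") (simp_all add: C.m_assoc)
  have "f (v \<otimes>\<^sub>C ?m) \<otimes>\<^sub>H H.move k l c = f (v \<otimes>\<^sub>C ?m') \<otimes>\<^sub>H H.move i j b"
    using below[OF _ kl less(1) top] below[OF _ ij less(2)] top v m by (simp add: same)
  then show ?thesis
    using comm(2,4) f v m ij kl by (intro H.square_labels) auto
qed

lemma triangle_peak:
  assumes ijl: "i \<in> {1..n}" "j \<in> {1..n}" "l \<in> {1..n}" "distinct [i, j, l]"
    and desc: "descends v i j b" "descends v i l c" "descends v j l c"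
  shows "via i j b = via i l c"
proof -
  let ?ij = "W.move i j b" and ?il = "W.move i l c" and ?jl = "W.move j l c"
  have ne: "i \<noteq> j" "j \<noteq> l" "i \<noteq> l" "j \<noteq> i" using ijl(4) by auto
  have m: "?ij \<in> carrier C" "?il \<in> carrier C" "?jl \<in> carrier C" using ijl by simp_all
  have set: "{i, j, l} \<subseteq> {1..n}" using ijl by simp
  have comm: "?il \<otimes>\<^sub>C ?jl = ?jl \<otimes>\<^sub>C ?il" using W.move_same_conjugator[OF ijl(4) set] .
  have "?ij \<otimes>\<^sub>C ?jl \<otimes>\<^sub>C ?il = ?il \<otimes>\<^sub>C ?jl \<otimes>\<^sub>C ?ij"
    using W.move_triangle[OF ijl(4) set, of c b] comm m by (simp add: C.m_assoc)
  then have same: "v \<otimes>\<^sub>C ?ij \<otimes>\<^sub>C ?jl \<otimes>\<^sub>C ?il = v \<otimes>\<^sub>C ?il \<otimes>\<^sub>C ?jl \<otimes>\<^sub>C ?ij"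
    using v m by (simp add: C.m_assoc)
  have cl: "v \<otimes>\<^sub>C ?ij \<in> carrier C" "v \<otimes>\<^sub>C ?il \<in> carrier C" using v m by simp_all
  have less: "total_length (v \<otimes>\<^sub>C ?ij) < total_length v" "total_length (v \<otimes>\<^sub>C ?il) < total_length v"
    using below_descent[OF v ijl(1,2) ne(1)] below_descent[OF v ijl(1,3) ne(3)] desc by simp_all
  have "descends (v \<otimes>\<^sub>C ?ij) j l c" "descends (v \<otimes>\<^sub>C ?il) j l c"
    using descends_unaffected[OF v ijl(1,2) ne(1) ijl(2) ne(4) ijl(3) ne(3)[symmetric]]
      descends_unaffected[OF v ijl(1,3) ne(3) ijl(2) ne(4) ijl(3) ne(3)[symmetric]] desc by simp_all
  then have less': "total_length (v \<otimes>\<^sub>C ?ij \<otimes>\<^sub>C ?jl) < total_length v"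
      "total_length (v \<otimes>\<^sub>C ?il \<otimes>\<^sub>C ?jl) < total_length v"
    using below_descent[OF cl(1) ijl(2,3) ne(2)] below_descent[OF cl(2) ijl(2,3) ne(2)] less by simp_all
  have cl': "v \<otimes>\<^sub>C ?ij \<otimes>\<^sub>C ?jl \<in> carrier C" "v \<otimes>\<^sub>C ?il \<otimes>\<^sub>C ?jl \<in> carrier C" using v m by simp_all
  have top: "total_length (v \<otimes>\<^sub>C ?ij \<otimes>\<^sub>C ?jl \<otimes>\<^sub>C ?il) < total_length v"
    by (rule triangle_length[OF v ijl desc(1,3)])
  have "f (v \<otimes>\<^sub>C ?ij) \<otimes>\<^sub>H H.move j l c \<otimes>\<^sub>H H.move i l c
      = f (v \<otimes>\<^sub>C ?ij \<otimes>\<^sub>C ?jl \<otimes>\<^sub>C ?il)"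
    using below[OF cl(1) ijl(2,3) ne(2) less(1) less'(1)] below[OF cl'(1) ijl(1,3) ne(3) less'(1) top] by simp
  moreover have "f (v \<otimes>\<^sub>C ?il) \<otimes>\<^sub>H H.move j l c \<otimes>\<^sub>H H.move i j b
      = f (v \<otimes>\<^sub>C ?il \<otimes>\<^sub>C ?jl \<otimes>\<^sub>C ?ij)"
    using below[OF cl(2) ijl(2,3) ne(2) less(2) less'(2)] below[OF cl'(2) ijl(1,2) ne(1) less'(2)] top
    by (simp add: same)
  ultimately have "f (v \<otimes>\<^sub>C ?ij) \<otimes>\<^sub>H H.move j l c \<otimes>\<^sub>H H.move i l c
      = f (v \<otimes>\<^sub>C ?il) \<otimes>\<^sub>H H.move j l c \<otimes>\<^sub>H H.move i j b"
    by (simp only: same)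
  then show ?thesis
    by (rule H.triangle_labels[OF H.move_closed[OF ijl(1,2) ne(1)] H.move_closed[OF ijl(1,3) ne(3)]
      H.move_closed[OF ijl(2,3) ne(2)] funcset_mem[OF f cl(1)] funcset_mem[OF f cl(2)] _
      H.move_same_conjugator[OF ijl(4) set] H.move_triangle[OF ijl(4) set]])
qed

text \<open>
  Two moves shorten the same word \<open>w\<^sub>i\<close>. Unless the moves coincide, one of the two suffixes of
  \<open>w\<^sub>i\<close> properly contains the other, so that one of the conjugating words \<open>w\<^sub>j\<close>, \<open>w\<^sub>l\<close> can be
  shortened by the other one: this is a triangle.
\<close>

lemma fork_peak:
  assumes ij: "i \<in> {1..n}" "j \<in> {1..n}" "i \<noteq> j" and l: "l \<in> {1..n}" "i \<noteq> l"
    and desc: "descends v i j b" "descends v i l c"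
  shows "via i j b = via i l c"
proof (cases "j = l")
  case True
  then have "b = c"
    using desc suffix_same_cases[of "(target v j, b) # conjugator v j" "conjugator v i"]
    by (auto simp: descends_def suffix_def)
  then show ?thesis using True by simp
next
  case False
  have "descends v j l c \<or> descends v l j b"
    using desc suffix_same_cases[of "(target v j, b) # conjugator v j" "conjugator v i"
      "(target v l, c) # conjugator v l"] target_neq[OF v False]
    by (auto simp: descends_def suffix_Cons)
  then show ?thesis
    using triangle_peak[of i j l b c] triangle_peak[of i l j c b] ij l desc False by auto
qed

text \<open>
  Here \<open>w\<^sub>k\<close> can be shortened by \<open>w\<^sub>i\<close> and \<open>w\<^sub>i\<close> by \<open>w\<^sub>j\<close>. Then \<open>w\<^sub>k\<close> can also be shortened by \<open>w\<^sub>j\<close>, and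
  comparing with this third move reduces the peak to a triangle and a square.
\<close>

lemma chain_peak:
  assumes ij: "i \<in> {1..n}" "j \<in> {1..n}" "i \<noteq> j" and k: "k \<in> {1..n}" "k \<noteq> i"
    and desc: "descends v i j b" "descends v k i c"
  shows "via k i c = via i j b"
proof -
  have kj: "descends v k j b"
    using desc by (auto simp: descends_def suffix_Cons intro: suffix_order.trans suffix_ConsI)
  have "k \<noteq> j"
    using kj by (auto simp: descends_def suffix_def)
  then have "via k i c = via k j b" "via k j b = via i j b"
    using triangle_peak[of k i j c b] square_peak[of k j i j b b] ij k desc kj by auto
  then show ?thesis by simp
qed

lemma moves_peak:
  assumes ij: "i \<in> {1..n}" "j \<in> {1..n}" "i \<noteq> j" and kl: "k \<in> {1..n}" "l \<in> {1..n}" "k \<noteq> l"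
    and desc: "descends v i j b" "descends v k l c"
  shows "via i j b = via k l c"
proof -
  consider "i = k" | "i \<noteq> k" "i = l" | "i \<noteq> k" "j = k" | "i \<noteq> k" "i \<noteq> l" "j \<noteq> k" by blast
  then show ?thesis
  proof cases
    case 1
    then show ?thesis using fork_peak[OF ij kl(2)] kl desc by simp
  next
    case 2
    then show ?thesis using chain_peak[OF ij kl(1)] kl desc by simp
  next
    case 3
    then show ?thesis using chain_peak[OF kl ij(1)] ij desc by simp
  next
    case 4
    then show ?thesis using square_peak[OF ij kl desc] by simp
  qed
qed

end

sublocale D: descent C H "moves n" "\<lambda>(i, j, b). W.move i j b" "\<lambda>(i, j, b). H.move i j b" total_length
  perm_auts "\<lambda>\<phi>. H.\<rho> (target \<phi>)"
proof
  fix m assume m: "m \<in> moves n"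
  then obtain i j b where ij: "m = (i, j, b)" "i \<in> {1..n}" "j \<in> {1..n}" "i \<noteq> j" by auto
  then show "(\<lambda>(i, j, b). W.move i j b) m \<in> carrier C" "(\<lambda>(i, j, b). H.move i j b) m \<in> carrier H"
    by simp_all
  show "\<exists>m'\<in>moves n. (\<lambda>(i, j, b). W.move i j b) m' = inv\<^sub>C (\<lambda>(i, j, b). W.move i j b) m
      \<and> (\<lambda>(i, j, b). H.move i j b) m' = inv\<^sub>H (\<lambda>(i, j, b). H.move i j b) m"
    using ij W.inv_move[of i j b] H.inv_move[of i j b] by (intro bexI[of _ "(i, j, \<not> b)"]) auto
  show "total_length (v \<otimes>\<^sub>C (\<lambda>(i, j, b). W.move i j b) m) \<noteq> total_length v" if "v \<in> carrier C" for v
    using total_length_strict(2)[OF that ij(2-4)] ij(1) by simp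
  show "total_length v < total_length (v \<otimes>\<^sub>C (\<lambda>(i, j, b). W.move i j b) m)" if "v \<in> perm_auts" for v
    using total_length_strict[of v i j b] perm_aut_no_descent[OF that ij(2), of j b] ij that
    by (auto simp: perm_auts_def)
next
  fix v assume "v \<in> perm_auts"
  then show "v \<in> carrier C" "H.\<rho> (target v) \<in> carrier H"
    using target_permutes(1) by (auto simp: perm_auts_def)
next
  fix v assume "v \<in> carrier C" "v \<notin> perm_auts"
  then obtain i j b where "i \<in> {1..n}" "j \<in> {1..n}" "i \<noteq> j" "descends v i j b"
    using no_descent_perm_aut by blast
  then show "\<exists>m\<in>moves n. total_length (v \<otimes>\<^sub>C (\<lambda>(i, j, b). W.move i j b) m) < total_length v"
    using descends_total_length[OF \<open>v \<in> carrier C\<close>] by (intro bexI[of _ "(i, j, b)"]) auto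
next
  fix v m m' and f :: "word_map \<Rightarrow> 'h"
  assume v: "v \<in> carrier C" and m: "m \<in> moves n" "m' \<in> moves n"
    and less: "total_length (v \<otimes>\<^sub>C (\<lambda>(i, j, b). W.move i j b) m) < total_length v"
      "total_length (v \<otimes>\<^sub>C (\<lambda>(i, j, b). W.move i j b) m') < total_length v"
    and f: "f \<in> carrier C \<rightarrow> carrier H"
    and below: "\<And>u m. \<lbrakk>u \<in> carrier C; m \<in> moves n; total_length u < total_length v;
      total_length (u \<otimes>\<^sub>C (\<lambda>(i, j, b). W.move i j b) m) < total_length v\<rbrakk>
      \<Longrightarrow> f (u \<otimes>\<^sub>C (\<lambda>(i, j, b). W.move i j b) m) = f u \<otimes>\<^sub>H (\<lambda>(i, j, b). H.move i j b) m"
  obtain i j b where ij: "m = (i, j, b)" "i \<in> {1..n}" "j \<in> {1..n}" "i \<noteq> j" using m(1) by auto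
  obtain k l c where kl: "m' = (k, l, c)" "k \<in> {1..n}" "l \<in> {1..n}" "k \<noteq> l" using m(2) by auto
  have below': "f (u \<otimes>\<^sub>C W.move i j b) = f u \<otimes>\<^sub>H H.move i j b"
    if "u \<in> carrier C" "i \<in> {1..n}" "j \<in> {1..n}" "i \<noteq> j" "total_length u < total_length v"
      "total_length (u \<otimes>\<^sub>C W.move i j b) < total_length v" for u i j b
    using below[of u "(i, j, b)"] that by simp
  have "descends v i j b" "descends v k l c"
    using less total_length_strict(1)[OF v ij(2-4)] total_length_strict(1)[OF v kl(2-4)] ij(1) kl(1) by simp_all
  from moves_peak[OF v f below' ij(2-4) kl(2-4) this]
  show "f (v \<otimes>\<^sub>C (\<lambda>(i, j, b). W.move i j b) m) \<otimes>\<^sub>H inv\<^sub>H (\<lambda>(i, j, b). H.move i j b) m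
    = f (v \<otimes>\<^sub>C (\<lambda>(i, j, b). W.move i j b) m') \<otimes>\<^sub>H inv\<^sub>H (\<lambda>(i, j, b). H.move i j b) m'"
    unfolding ij(1) kl(1) prod.case .
qed

lemma target_\<alpha>:
  assumes \<phi>: "\<phi> \<in> carrier C" and k: "1 \<le> k" "k < n"
  shows "target (\<phi> \<otimes>\<^sub>C \<alpha> k) = target \<phi> \<circ> adj k"
    and "i \<in> {1..n} \<Longrightarrow> conjugator (\<phi> \<otimes>\<^sub>C \<alpha> k) i = conjugator \<phi> (adj k i)"
proof -
  have val: "(\<phi> \<otimes>\<^sub>C \<alpha> k) (gen i) = \<phi> (gen (adj k i))" if "i \<in> {1..n}" for i
    using \<phi> \<alpha>_gen[OF k that] C_mult[OF \<phi> \<alpha>_C[OF k] gen_in[OF that]] by simp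
  have in_iff: "adj k i \<in> {1..n} \<longleftrightarrow> i \<in> {1..n}" for i
    by (rule permutes_in_image[OF adj_permutes[OF k]])
  have out: "adj k i = i" if "i \<notin> {1..n}" for i
    by (rule permutes_not_in[OF adj_permutes[OF k] that])
  show "target (\<phi> \<otimes>\<^sub>C \<alpha> k) = target \<phi> \<circ> adj k"
  proof
    fix i
    show "target (\<phi> \<otimes>\<^sub>C \<alpha> k) i = (target \<phi> \<circ> adj k) i"
    proof (cases "i \<in> {1..n}")
      case True
      then show ?thesis using val[OF True] in_iff[of i] by (simp only: target_def comp_apply if_True)
    next
      case False
      then show ?thesis using out[OF False] by (simp only: target_def comp_apply if_False)
    qed
  qed
  show "i \<in> {1..n} \<Longrightarrow> conjugator (\<phi> \<otimes>\<^sub>C \<alpha> k) i = conjugator \<phi> (adj k i)"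
    using val by (simp add: conjugator_def)
qed

text \<open>
  The function given by the descents respects the moves by construction. For \<open>\<alpha> k\<close> this is
  checked on permutations of the basis and propagated upwards along the moves, which \<open>\<alpha> k\<close> permutes.
  For \<open>\<sigma> k\<close> it follows, as \<open>\<sigma> k\<close> is the product of a basis conjugation and \<open>\<alpha> k\<close>.
\<close>

theorem labelling:
  obtains f where "f \<in> carrier C \<rightarrow> carrier H" "f \<one>\<^sub>C = \<one>\<^bsub>H\<^esub>"
    "\<And>\<phi> k. \<lbrakk>\<phi> \<in> carrier C; 1 \<le> k; k < n\<rbrakk> \<Longrightarrow> f (\<phi> \<otimes>\<^sub>C \<alpha> k) = f \<phi> \<otimes>\<^sub>H a k"
    "\<And>\<phi> k. \<lbrakk>\<phi> \<in> carrier C; 1 \<le> k; k < n\<rbrakk> \<Longrightarrow> f (\<phi> \<otimes>\<^sub>C \<sigma> k) = f \<phi> \<otimes>\<^sub>H s k"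
proof (rule D.labelling_exists)
  fix f assume f: "f \<in> carrier C \<rightarrow> carrier H" and base: "\<And>v. v \<in> perm_auts \<Longrightarrow> f v = H.\<rho> (target v)"
    and step: "\<And>v m. \<lbrakk>v \<in> carrier C; m \<in> moves n\<rbrakk> \<Longrightarrow> f (v \<otimes>\<^sub>C (\<lambda>(i, j, b). W.move i j b) m)
      = f v \<otimes>\<^sub>H (\<lambda>(i, j, b). H.move i j b) m"
  have step': "f (\<phi> \<otimes>\<^sub>C W.move i j b) = f \<phi> \<otimes>\<^sub>H H.move i j b"
    if "\<phi> \<in> carrier C" "i \<in> {1..n}" "j \<in> {1..n}" "i \<noteq> j" for \<phi> i j b
    using step[of \<phi> "(i, j, b)"] that by simp
  have \<alpha>: "f (\<phi> \<otimes>\<^sub>C \<alpha> k) = f \<phi> \<otimes>\<^sub>H a k" if "\<phi> \<in> carrier C" and k: "1 \<le> k" "k < n" for \<phi> k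
    using that(1)
  proof (induction rule: D.descent_induct)
    case (base v)
    then have v: "v \<in> carrier C" by (simp add: perm_auts_def)
    have "conjugator (v \<otimes>\<^sub>C \<alpha> k) i = []" if "i \<in> {1..n}" for i
      using target_\<alpha>(2)[OF v k that] base permutes_in_image[OF adj_permutes[OF k], of i] that
      by (simp add: perm_auts_def)
    then have "v \<otimes>\<^sub>C \<alpha> k \<in> perm_auts" using v k by (simp add: perm_auts_def)
    then show ?case
      using \<open>\<And>v. v \<in> perm_auts \<Longrightarrow> f v = H.\<rho> (target v)\<close> base target_\<alpha>(1)[OF v k]
        H.\<rho>_comp[OF target_permutes(1)[OF v] adj_permutes[OF k]] H.\<rho>_adj[OF k] by simp
  next
    case (step v m)
    then obtain i j b where ij: "m = (i, j, b)" "i \<in> {1..n}" "j \<in> {1..n}" "i \<noteq> j" by auto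
    let ?i = "adj k i" and ?j = "adj k j"
    have ij': "?i \<in> {1..n}" "?j \<in> {1..n}" using permutes_in_image[OF adj_permutes[OF k]] ij by blast+
    have ne: "?i \<noteq> ?j" using permutes_inj[OF adj_permutes[OF k]] ij(4) by (simp only: inj_eq) simp
    have cl: "W.move i j b \<in> carrier C" "W.move ?i ?j b \<in> carrier C" "\<alpha> k \<in> carrier C"
      "H.move i j b \<in> carrier H" "H.move ?i ?j b \<in> carrier H" "a k \<in> carrier H"
      using ij ij' ne k by simp_all
    have fv: "f v \<in> carrier H" "f (v \<otimes>\<^sub>C \<alpha> k) \<in> carrier H" using f step(1) cl by auto
    have W: "W.move i j b \<otimes>\<^sub>C \<alpha> k = \<alpha> k \<otimes>\<^sub>C W.move ?i ?j b"
      and H: "H.move i j b \<otimes>\<^sub>H a k = a k \<otimes>\<^sub>H H.move ?i ?j b"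
      using W.a_move[OF k ij' ne, of b] H.a_move[OF k ij' ne, of b] by simp_all
    have "v \<otimes>\<^sub>C \<alpha> k \<otimes>\<^sub>C W.move ?i ?j b = v \<otimes>\<^sub>C W.move i j b \<otimes>\<^sub>C \<alpha> k"
      using step(1) cl W by (simp add: C.m_assoc)
    then have "f (v \<otimes>\<^sub>C \<alpha> k) \<otimes>\<^sub>H H.move ?i ?j b = f (v \<otimes>\<^sub>C W.move i j b \<otimes>\<^sub>C \<alpha> k)"
      using step'[OF _ ij' ne, of "v \<otimes>\<^sub>C \<alpha> k" b] step(1) cl by simp
    also have "\<dots> = f v \<otimes>\<^sub>H H.move i j b \<otimes>\<^sub>H a k"
      using step(5) step'[OF step(1) ij(2-4)] ij(1) by simp
    also have "\<dots> = f v \<otimes>\<^sub>H a k \<otimes>\<^sub>H H.move ?i ?j b" using H fv cl by (simp add: H.m_assoc)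
    finally show ?case using fv cl by simp
  qed
  have \<sigma>: "f (\<phi> \<otimes>\<^sub>C \<sigma> k) = f \<phi> \<otimes>\<^sub>H s k" if \<phi>: "\<phi> \<in> carrier C" and k: "1 \<le> k" "k < n" for \<phi> k
  proof -
    have ij: "Suc k \<in> {1..n}" "k \<in> {1..n}" "Suc k \<noteq> k" using k by auto
    have cl: "W.move (Suc k) k True \<in> carrier C" "H.move (Suc k) k True \<in> carrier H" "\<alpha> k \<in> carrier C" "a k \<in> carrier H"
      using ij k by simp_all
    have W: "\<sigma> k = W.move (Suc k) k True \<otimes>\<^sub>C \<alpha> k" and H: "s k = H.move (Suc k) k True \<otimes>\<^sub>H a k"
      using W.s_eq[OF k] H.s_eq[OF k] by (simp_all add: W.move_def H.move_def C.signed_def H.signed_def)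
    have "f \<phi> \<in> carrier H" using f \<phi> by auto
    then show ?thesis
      unfolding W H using \<alpha>[of "\<phi> \<otimes>\<^sub>C W.move (Suc k) k True", OF _ k] step'[OF \<phi> ij] \<phi> cl
      by (simp add: C.m_assoc H.m_assoc)
  qed
  have one: "\<one>\<^sub>C \<in> perm_auts" by (rule perm_autsI[of _ "\<lambda>i. i"]) simp_all
  have "target \<one>\<^sub>C = id" by (simp add: target_def fun_eq_iff) (simp add: gen_def)
  then have "f \<one>\<^sub>C = \<one>\<^bsub>H\<^esub>" using base[OF one] H.\<rho>_id by simp
  from that[OF f this \<alpha> \<sigma>] show thesis by blast
qed

end



section \<open>The relations between the two-generator elements\<close>

context group
begin

lemma twist_inv: "x \<in> carrier G \<Longrightarrow> twist (inv x) y j = x [^] (- j) \<otimes> y \<otimes> x [^] j"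
  by (simp add: twist_def int_pow_inv int_pow_neg)

lemma twist_mult_twist_Suc:
  assumes "x \<in> carrier G" "y \<in> carrier G"
  shows "twist x y (i - 1) \<otimes> twist x y i = x [^] (i - 1) \<otimes> y \<otimes> x \<otimes> y \<otimes> x [^] (- i)"
proof -
  have "x [^] (- (i - 1)) \<otimes> x [^] i = x [^] (1 :: int)"
    using assms(1) by (simp flip: int_pow_mult)
  then have "x [^] (- (i - 1)) \<otimes> (x [^] i \<otimes> w) = x \<otimes> w" if "w \<in> carrier G" for w
    using that assms m_assoc[of "x [^] (- (i - 1))" "x [^] i" w] by simp
  then show ?thesis using assms by (simp add: twist_def m_assoc)
qed

lemma twist_inv_mult_twist_inv:
  assumes "x \<in> carrier G" "y \<in> carrier G"
  shows "twist (inv x) y i \<otimes> twist (inv x) y (i - 1) = x [^] (- i) \<otimes> y \<otimes> x \<otimes> y \<otimes> x [^] (i - 1)"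
proof -
  have "x [^] i \<otimes> x [^] (- (i - 1)) = x [^] (1 :: int)"
    using assms(1) by (simp flip: int_pow_mult)
  then have "x [^] i \<otimes> (x [^] (- (i - 1)) \<otimes> w) = x \<otimes> w" if "w \<in> carrier G" for w
    using that assms m_assoc[of "x [^] i" "x [^] (- (i - 1))" w] by simp
  then show ?thesis using assms by (simp add: twist_inv m_assoc)
qed

text \<open>
  The relations in terms of the elements \<open>\<S> i = \<sigma>\<^sub>i\<^sub>+\<^sub>1\<close> and \<open>\<A> i = \<alpha>\<^sub>i\<^sub>+\<^sub>1\<close>. For the \<open>\<alpha>\<close> part,
  Artin's relations hold with \<open>\<alpha>\<^sup>-\<^sup>1\<close> in the place of \<open>\<sigma>\<close>: inverting \<open>\<alpha>\<^sup>n = (\<alpha>\<^sub>1 \<alpha>)\<^sup>n\<^sup>-\<^sup>1\<close> gives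
  the required form since \<open>\<alpha>\<^sub>1\<close> is an involution.
\<close>

lemma relations_hold_iff:
  assumes n: "3 \<le> n"
    and cl: "a1 \<in> carrier G" "a \<in> carrier G" "s1 \<in> carrier G" "s \<in> carrier G"
  defines "\<A> \<equiv> twist (inv a) a1" and "\<S> \<equiv> twist s s1"
  shows "(\<forall>(u, v)\<in>relations G n a1 a s1 s. u = v) \<longleftrightarrow>
    artin G n s s1 \<and> a1 \<otimes> a1 = \<one> \<and> artin G n (inv a) a1 \<and>
    (\<forall>i j. 0 \<le> i \<and> i \<le> int n - 2 \<and> 0 \<le> j \<and> j \<le> int n - 2 \<and> 2 \<le> \<bar>i - j\<bar> \<longrightarrow> \<A> i \<otimes> \<S> j = \<S> j \<otimes> \<A> i) \<and>
    (\<forall>i. 1 \<le> i \<and> i \<le> int n - 2 \<longrightarrow> \<S> (i - 1) \<otimes> (\<A> i \<otimes> \<A> (i - 1)) = \<A> i \<otimes> \<A> (i - 1) \<otimes> \<S> i) \<and>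
    (\<forall>i. 1 \<le> i \<and> i \<le> int n - 2 \<longrightarrow> \<S> (i - 1) \<otimes> \<S> i \<otimes> \<A> (i - 1) = \<A> i \<otimes> (\<S> (i - 1) \<otimes> \<S> i))"
proof -
  have Acl: "\<A> i \<in> carrier G" and Scl: "\<S> i \<in> carrier G" for i using cl by (simp_all add: \<A>_def \<S>_def)
  have s_artin: "artin G n s s1 \<longleftrightarrow> s [^] n = (s \<otimes> s1) [^] (n - 1) \<and>
      (\<forall>j :: int. 2 \<le> j \<and> 2 * j \<le> int n \<longrightarrow> s1 \<otimes> \<S> (- j) = \<S> (- j) \<otimes> s1)"
  proof -
    have "s1 \<otimes> \<S> j = \<S> j \<otimes> s1 \<longleftrightarrow> s1 \<otimes> \<S> (- j) = \<S> (- j) \<otimes> s1" for j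
      using twist_commute_shift[of s s1 0 j "- j"] cl by (auto simp: \<S>_def)
    then show ?thesis
      using n cl is_group by (auto simp: artin_def artin_axioms_def \<S>_def)
  qed
  have a_artin: "artin G n (inv a) a1 \<longleftrightarrow> a [^] n = (a1 \<otimes> a) [^] (n - 1) \<and>
      (\<forall>j :: int. 2 \<le> j \<and> 2 * j \<le> int n \<longrightarrow> a1 \<otimes> \<A> j = \<A> j \<otimes> a1)" if sq: "a1 \<otimes> a1 = \<one>"
  proof -
    have "inv a1 = a1" using inv_equality[OF sq] cl by simp
    then have "inv a \<otimes> a1 = inv (a1 \<otimes> a)" using cl by (simp add: inv_mult_group)
    then have "(inv a) [^] n = (inv a \<otimes> a1) [^] (n - 1) \<longleftrightarrow> inv (a [^] n) = inv ((a1 \<otimes> a) [^] (n - 1))"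
      using cl by (simp add: nat_pow_inv)
    also have "\<dots> \<longleftrightarrow> a [^] n = (a1 \<otimes> a) [^] (n - 1)"
      using cl by (metis inv_inv m_closed nat_pow_closed)
    finally show ?thesis using n cl is_group by (auto simp: artin_def artin_axioms_def \<A>_def)
  qed
  have sq: "a1 [^] (2 :: nat) = a1 \<otimes> a1" using cl by (simp add: numeral_2_eq_2)
  have SS: "s [^] (i - 1) \<otimes> s1 \<otimes> s \<otimes> s1 \<otimes> s [^] (- i) = \<S> (i - 1) \<otimes> \<S> i" for i
    using twist_mult_twist_Suc[of s s1 i] cl by (simp add: \<S>_def)
  have AA: "a [^] (- i) \<otimes> a1 \<otimes> a \<otimes> a1 \<otimes> a [^] (i - 1) = \<A> i \<otimes> \<A> (i - 1)" for i
    using twist_inv_mult_twist_inv[of a a1 i] cl by (simp add: \<A>_def)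
  have S: "s [^] j \<otimes> s1 \<otimes> s [^] (- j) = \<S> j" and A: "a [^] (- j) \<otimes> a1 \<otimes> a [^] j = \<A> j"
    and S': "s [^] (- j) \<otimes> s1 \<otimes> s [^] j = \<S> (- j)" for j
    using cl by (simp_all add: \<A>_def \<S>_def twist_inv) (simp_all add: twist_def)
  have r6: "a [^] (- i) \<otimes> a1 \<otimes> a [^] i \<otimes> s [^] j \<otimes> s1 \<otimes> s [^] (- j) = \<A> i \<otimes> \<S> j"
      "s [^] j \<otimes> s1 \<otimes> s [^] (- j) \<otimes> a [^] (- i) \<otimes> a1 \<otimes> a [^] i = \<S> j \<otimes> \<A> i" for i j
    unfolding A[symmetric] S[symmetric] using cl by (simp_all add: m_assoc)
  have r7: "s [^] (i - 1) \<otimes> s1 \<otimes> s [^] (- (i - 1)) \<otimes> a [^] (- i) \<otimes> a1 \<otimes> a \<otimes> a1 \<otimes> a [^] (i - 1)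
      = \<S> (i - 1) \<otimes> (\<A> i \<otimes> \<A> (i - 1))"
      "a [^] (- i) \<otimes> a1 \<otimes> a \<otimes> a1 \<otimes> a [^] (i - 1) \<otimes> s [^] i \<otimes> s1 \<otimes> s [^] (- i) = \<A> i \<otimes> \<A> (i - 1) \<otimes> \<S> i" for i
    unfolding AA[symmetric] S[symmetric] using cl by (simp_all add: m_assoc)
  have r8: "s [^] (i - 1) \<otimes> s1 \<otimes> s \<otimes> s1 \<otimes> s [^] (- i) \<otimes> a [^] (- (i - 1)) \<otimes> a1 \<otimes> a [^] (i - 1)
      = \<S> (i - 1) \<otimes> \<S> i \<otimes> \<A> (i - 1)"
      "a [^] (- i) \<otimes> a1 \<otimes> a [^] i \<otimes> s [^] (i - 1) \<otimes> s1 \<otimes> s \<otimes> s1 \<otimes> s [^] (- i) = \<A> i \<otimes> (\<S> (i - 1) \<otimes> \<S> i)" for i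
    unfolding SS[symmetric] A[symmetric] using cl by (simp_all add: m_assoc)
  have single: "(\<forall>(u, v)\<in>{(L j, R j) | j. P j}. u = v) \<longleftrightarrow> (\<forall>j. P j \<longrightarrow> L j = R j)"
    for L R :: "int \<Rightarrow> 'a" and P by auto
  have double: "(\<forall>(u, v)\<in>{(L i j, R i j) | i j. P i j}. u = v) \<longleftrightarrow> (\<forall>i j. P i j \<longrightarrow> L i j = R i j)"
    for L R :: "int \<Rightarrow> int \<Rightarrow> 'a" and P by auto
  have pair: "(\<forall>(u, v)\<in>{p}. u = v) \<longleftrightarrow> fst p = snd p"
    and pair2: "(\<forall>(u, v)\<in>{p, q}. u = v) \<longleftrightarrow> fst p = snd p \<and> fst q = snd q" for p q :: "'a \<times> 'a"
    by (auto simp: case_prod_beta)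
  show ?thesis
    unfolding relations_def ball_Un pair pair2 single double fst_conv snd_conv
    unfolding r6 r7 r8
    unfolding S' A sq s_artin
    using a_artin by blast
qed

lemma relations_welded:
  assumes n: "3 \<le> n"
    and cl: "a1 \<in> carrier G" "a \<in> carrier G" "s1 \<in> carrier G" "s \<in> carrier G"
    and rel: "\<forall>(u, v)\<in>relations G n a1 a s1 s. u = v"
  defines "A \<equiv> \<lambda>i. twist (inv a) a1 (int i - 1)" and "S \<equiv> \<lambda>i. twist s s1 (int i - 1)"
  shows "welded G n A S" "ordered_prod G S [1..<n] = s" "ordered_prod G A [1..<n] = inv a"
    "A 1 = a1" "S 1 = s1"
proof -
  let ?A = "twist (inv a) a1" and ?S = "twist s s1"
  note * = iffD1[OF relations_hold_iff[OF n cl] rel]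
  interpret s: artin G n s s1 using * by blast
  interpret a: artin G n "inv a" a1 using * by blast
  have sq: "a1 \<otimes> a1 = \<one>" using * by blast
  show "ordered_prod G S [1..<n] = s" "ordered_prod G A [1..<n] = inv a"
    using s.t_prod a.t_prod by (simp_all add: A_def S_def)
  show "A 1 = a1" "S 1 = s1" using cl by (simp_all add: A_def S_def)
  show "welded G n A S"
  proof
    fix i assume i: "1 \<le> i" "i < n"
    show "A i \<in> carrier G" "S i \<in> carrier G" using cl by (simp_all add: A_def S_def)
    have "inv a [^] (int i - 1) \<otimes> a1 = ?A (int i - 1) \<otimes> inv a [^] (int i - 1)"
      using int_pow_twist[of "inv a" a1 "int i - 1" 0] cl by simp
    then have "?A (int i - 1) = inv a [^] (int i - 1) \<otimes> a1 \<otimes> inv (inv a [^] (int i - 1))"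
      using cl by (simp add: inv_solve_right)
    moreover have "p \<otimes> a1 \<otimes> inv p \<otimes> (p \<otimes> a1 \<otimes> inv p) = p \<otimes> (a1 \<otimes> a1) \<otimes> inv p"
      if "p \<in> carrier G" for p using that cl by (simp add: m_assoc)
    ultimately show "A i \<otimes> A i = \<one>" using cl sq by (simp add: A_def)
  next
    fix i j assume ij: "1 \<le> i" "i + 2 \<le> j" "j < n"
    show "A i \<otimes> A j = A j \<otimes> A i" "S i \<otimes> S j = S j \<otimes> S i"
      unfolding A_def S_def using ij by (intro a.t_commute s.t_commute; simp)+
  next
    fix i assume i: "1 \<le> i" "Suc i < n"
    show "A i \<otimes> A (Suc i) \<otimes> A i = A (Suc i) \<otimes> A i \<otimes> A (Suc i)"
      "S i \<otimes> S (Suc i) \<otimes> S i = S (Suc i) \<otimes> S i \<otimes> S (Suc i)"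
      using a.t_braid[of "int i - 1"] s.t_braid[of "int i - 1"] by (simp_all add: A_def S_def)
    have "?S (int i - 1) \<otimes> (?A (int i) \<otimes> ?A (int i - 1)) = ?A (int i) \<otimes> ?A (int i - 1) \<otimes> ?S (int i)"
      "?S (int i - 1) \<otimes> ?S (int i) \<otimes> ?A (int i - 1) = ?A (int i) \<otimes> (?S (int i - 1) \<otimes> ?S (int i))"
      using * i by auto
    then show "S i \<otimes> A (Suc i) \<otimes> A i = A (Suc i) \<otimes> A i \<otimes> S (Suc i)"
      "S i \<otimes> S (Suc i) \<otimes> A i = A (Suc i) \<otimes> S i \<otimes> S (Suc i)"
      using cl by (simp_all add: A_def S_def m_assoc)
  next
    fix i j assume "1 \<le> i" "i < n" "1 \<le> j" "j < n" "i + 2 \<le> j \<or> j + 2 \<le> i"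
    then have "0 \<le> int i - 1 \<and> int i - 1 \<le> int n - 2 \<and> 0 \<le> int j - 1 \<and> int j - 1 \<le> int n - 2 \<and>
      2 \<le> \<bar>(int i - 1) - (int j - 1)\<bar>" by auto
    then show "A i \<otimes> S j = S j \<otimes> A i" unfolding A_def S_def using * by blast
  qed (rule n)
qed

end

text \<open>
  This transports the relations both to \<open>C\<^sub>n\<close>, where they are verified, and to a quotient of the
  free group, where they hold because the relators lie in the normal subgroup.
\<close>

lemma relations_hom:
  assumes G: "group G" and K: "group K" and h: "h \<in> hom G K"
    and cl: "a1 \<in> carrier G" "a \<in> carrier G" "s1 \<in> carrier G" "s \<in> carrier G"
  shows "relations K n (h a1) (h a) (h s1) (h s) = map_prod h h ` relations G n a1 a s1 s"
proof -
  interpret group_hom G K h by (intro group_hom.intro group_hom_axioms.intro G K h)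
  have single: "map_prod h h ` {(L j, R j) | j. P j} = {(h (L j), h (R j)) | j. P j}"
    for L R and P :: "int \<Rightarrow> bool" by auto
  have double: "map_prod h h ` {(L i j, R i j) | i j. P i j} = {(h (L i j), h (R i j)) | i j. P i j}"
    for L R and P :: "int \<Rightarrow> int \<Rightarrow> bool" by auto
  show ?thesis
    unfolding relations_def image_Un single double
    by (simp only: image_insert image_empty map_prod_simp hom_mult hom_int_pow hom_nat_pow hom_one cl
      G.m_closed G.int_pow_closed G.nat_pow_closed)
qed

lemma relations_closed:
  assumes "group G" "a1 \<in> carrier G" "a \<in> carrier G" "s1 \<in> carrier G" "s \<in> carrier G"
  shows "relations G n a1 a s1 s \<subseteq> carrier G \<times> carrier G"
proof -
  interpret group G by (rule assms(1))
  have single: "{(L j, R j) | j. P j} \<subseteq> carrier G \<times> carrier G"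
    if "\<And>j. L j \<in> carrier G" "\<And>j. R j \<in> carrier G" for L R and P :: "int \<Rightarrow> bool" using that by auto
  have double: "{(L i j, R i j) | i j. P i j} \<subseteq> carrier G \<times> carrier G"
    if "\<And>i j. L i j \<in> carrier G" "\<And>i j. R i j \<in> carrier G" for L R and P :: "int \<Rightarrow> int \<Rightarrow> bool"
    using that by auto
  show ?thesis
    unfolding relations_def
    by (intro Un_least single double)
      (simp_all only: insert_subset empty_subsetI mem_Sigma_iff simp_thms assms(2-5)
        m_closed int_pow_closed nat_pow_closed one_closed)
qed


section \<open>The presentation\<close>

context conj_auts
begin

sublocale B\<sigma>: braid_elements C n \<sigma>
  by unfold_locales (use n3 W.s_commute W.s_braid in simp_all)

sublocale B\<alpha>: braid_elements C n \<alpha>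
  by unfold_locales (use n3 W.a_commute W.a_braid in simp_all)

lemma sigma_prod: "sigma n = ordered_prod C \<sigma> [1..<n]"
  by (simp add: sigma_def)

lemma alpha_prod: "inv\<^sub>C alpha n = ordered_prod C \<alpha> [1..<n]"
proof -
  have "alpha n = ordered_prod C \<alpha> (rev [1..<n])" by (simp add: alpha_def)
  also have "\<dots> = inv\<^sub>C ordered_prod C \<alpha> [1..<n]"
    by (rule C.ordered_prod_rev_inv[symmetric]) (simp add: W.a_inv)
  finally show ?thesis
    using C.ordered_prod_closed[of "[1..<n]" \<alpha>] by simp
qed

lemma sigma_alpha_closed [simp]: "sigma n \<in> carrier C" "alpha n \<in> carrier C"
proof -
  show "sigma n \<in> carrier C" unfolding sigma_prod by (rule C.ordered_prod_closed) simp
  show "alpha n \<in> carrier C" unfolding alpha_def by (rule C.ordered_prod_closed) simp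
qed

lemma recover_\<sigma>: "\<lbrakk>1 \<le> i; i < n\<rbrakk> \<Longrightarrow> \<sigma> i = C.twist (sigma n) (\<sigma> 1) (int i - 1)"
  using B\<sigma>.z_twist unfolding B\<sigma>.zprod_def sigma_prod .

lemma recover_\<alpha>: "\<lbrakk>1 \<le> i; i < n\<rbrakk> \<Longrightarrow> \<alpha> i = C.twist (inv\<^sub>C alpha n) (\<alpha> 1) (int i - 1)"
  using B\<alpha>.z_twist unfolding B\<alpha>.zprod_def alpha_prod .

lemma relations_C: "\<forall>(u, v)\<in>relations C n (\<alpha> 1) (alpha n) (\<sigma> 1) (sigma n). u = v"
proof -
  have cl: "\<alpha> 1 \<in> carrier C" "\<sigma> 1 \<in> carrier C" using n3 by simp_all
  let ?A = "C.twist (inv\<^sub>C alpha n) (\<alpha> 1)" and ?S = "C.twist (sigma n) (\<sigma> 1)"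
  have A: "?A i = \<alpha> (nat (i + 1))" and S: "?S i = \<sigma> (nat (i + 1))" if "0 \<le> i" "i \<le> int n - 2" for i
    using recover_\<alpha>[of "nat (i + 1)"] recover_\<sigma>[of "nat (i + 1)"] that by simp_all
  have artin: "artin C n (sigma n) (\<sigma> 1)" "artin C n (inv\<^sub>C alpha n) (\<alpha> 1)"
    using B\<sigma>.artin B\<alpha>.artin by (simp_all add: B\<sigma>.zprod_def sigma_prod B\<alpha>.zprod_def alpha_prod)
  have square: "\<alpha> 1 \<otimes>\<^sub>C \<alpha> 1 = \<one>\<^sub>C" using W.a_square n3 by simp
  have commute: "?A i \<otimes>\<^sub>C ?S j = ?S j \<otimes>\<^sub>C ?A i"
    if "0 \<le> i \<and> i \<le> int n - 2 \<and> 0 \<le> j \<and> j \<le> int n - 2 \<and> 2 \<le> \<bar>i - j\<bar>" for i j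
  proof -
    have "1 \<le> nat (i + 1)" "nat (i + 1) < n" "1 \<le> nat (j + 1)" "nat (j + 1) < n" using that by auto
    moreover have "nat (i + 1) + 2 \<le> nat (j + 1) \<or> nat (j + 1) + 2 \<le> nat (i + 1)"
      using that by (cases "i \<le> j") auto
    ultimately have "\<alpha> (nat (i + 1)) \<otimes>\<^sub>C \<sigma> (nat (j + 1)) = \<sigma> (nat (j + 1)) \<otimes>\<^sub>C \<alpha> (nat (i + 1))"
      by (rule W.sa_commute)
    then show ?thesis using A[of i] S[of j] that by simp
  qed
  have mixed: "?S (i - 1) \<otimes>\<^sub>C (?A i \<otimes>\<^sub>C ?A (i - 1)) = ?A i \<otimes>\<^sub>C ?A (i - 1) \<otimes>\<^sub>C ?S i"
    "?S (i - 1) \<otimes>\<^sub>C ?S i \<otimes>\<^sub>C ?A (i - 1) = ?A i \<otimes>\<^sub>C (?S (i - 1) \<otimes>\<^sub>C ?S i)"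
    if i: "1 \<le> i \<and> i \<le> int n - 2" for i
  proof -
    have k: "1 \<le> nat i" "Suc (nat i) < n" using i by auto
    have val: "?S (i - 1) = \<sigma> (nat i)" "?A (i - 1) = \<alpha> (nat i)" "?S i = \<sigma> (Suc (nat i))" "?A i = \<alpha> (Suc (nat i))"
      using S[of "i - 1"] A[of "i - 1"] S[of i] A[of i] i by (simp_all add: nat_add_distrib)
    have "\<sigma> (nat i) \<in> carrier C" "\<alpha> (nat i) \<in> carrier C" "\<sigma> (Suc (nat i)) \<in> carrier C" "\<alpha> (Suc (nat i)) \<in> carrier C"
      using k by simp_all
    then show "?S (i - 1) \<otimes>\<^sub>C (?A i \<otimes>\<^sub>C ?A (i - 1)) = ?A i \<otimes>\<^sub>C ?A (i - 1) \<otimes>\<^sub>C ?S i"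
      "?S (i - 1) \<otimes>\<^sub>C ?S i \<otimes>\<^sub>C ?A (i - 1) = ?A i \<otimes>\<^sub>C (?S (i - 1) \<otimes>\<^sub>C ?S i)"
      unfolding val using W.saa[OF k] W.ssa[OF k] by (simp_all add: C.m_assoc)
  qed
  show ?thesis
    by (rule iffD2[OF C.relations_hold_iff[OF n3 cl(1) sigma_alpha_closed(2) cl(2) sigma_alpha_closed(1)]])
      (intro conjI allI impI; (rule artin square | (rule commute mixed, assumption)))
qed

text \<open>
  Descending moves lead from any element to a permutation of the basis, so the moves and the
  permutations generate.
\<close>

lemma generate_C:
  assumes S: "S \<subseteq> carrier C"
    and gens: "alpha n \<in> generate C S" "\<alpha> 1 \<in> generate C S" "sigma n \<in> generate C S" "\<sigma> 1 \<in> generate C S"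
  shows "generate C S = carrier C"
proof
  show "generate C S \<subseteq> carrier C" using C.generate_incl[OF S] .
  interpret L: conj_aut_labels n C \<alpha> \<sigma> by unfold_locales
  interpret sub: subgroup "generate C S" C by (rule C.generate_is_subgroup[OF S])
  have pow: "x [^]\<^bsub>C\<^esub> (k :: int) \<in> generate C S" if "x \<in> generate C S" for x k
    using C.subgroup_int_pow_closed[OF sub.subgroup_axioms that] .
  have \<alpha>: "\<alpha> k \<in> generate C S" and \<sigma>: "\<sigma> k \<in> generate C S" if "1 \<le> k" "k < n" for k
    using recover_\<alpha>[OF that] recover_\<sigma>[OF that] gens pow
    by (simp_all add: C.twist_def)
  have \<rho>: "W.\<rho> p \<in> generate C S" if "p permutes {1..n}" for p
    using that
  proof (induction rule: permutes_adj_induct)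
    case id
    then show ?case using W.\<rho>_id by (simp flip: id_def)
  next
    case (adj p k)
    have "W.\<rho> (p \<circ> adj k) = W.\<rho> p \<otimes>\<^sub>C \<alpha> k"
      using W.\<rho>_comp[OF adj(1) adj_permutes[OF adj(2,3)]] W.\<rho>_adj[OF adj(2,3)] by simp
    then show ?case using sub.m_closed[OF adj.IH \<alpha>[OF adj(2,3)]] by (simp only:)
  qed
  have e: "W.move i j b \<in> generate C S" if ij: "i \<in> {1..n}" "j \<in> {1..n}" "i \<noteq> j" for i j b
  proof -
    obtain p where p: "p permutes {1..n}" "p 2 = i" "p 1 = j" using W.index_pair ij by blast
    have cl: "W.\<rho> p \<in> carrier C" "\<sigma> 1 \<in> carrier C" "\<alpha> 1 \<in> carrier C" using p n3 by simp_all
    have "W.\<rho> p \<otimes>\<^sub>C (\<sigma> 1 \<otimes>\<^sub>C \<alpha> 1) = W.e i j \<otimes>\<^sub>C W.\<rho> p" using W.conj_base[OF p(1)] p by simp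
    then have "W.e i j = W.\<rho> p \<otimes>\<^sub>C (\<sigma> 1 \<otimes>\<^sub>C \<alpha> 1) \<otimes>\<^sub>C inv\<^sub>C W.\<rho> p"
      using cl ij by (simp add: C.m_assoc)
    then have "W.e i j \<in> generate C S" using \<rho>[OF p(1)] gens by simp
    then show ?thesis by (simp add: W.move_def C.signed_def)
  qed
  show "carrier C \<subseteq> generate C S"
  proof
    fix \<phi> assume "\<phi> \<in> carrier C"
    then show "\<phi> \<in> generate C S"
    proof (induction rule: L.D.descent_induct)
      case (base v)
      then show ?case using perm_auts_eq \<rho> target_permutes(1) by (metis (mono_tags, lifting) mem_Collect_eq perm_auts_def)
    next
      case (step v m)
      then obtain i j b where ij: "m = (i, j, b)" "i \<in> {1..n}" "j \<in> {1..n}" "i \<noteq> j" by auto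
      have m: "W.move i j b \<in> carrier C" "W.move i j b \<in> generate C S" using e ij by simp_all
      have "v \<otimes>\<^sub>C W.move i j b \<otimes>\<^sub>C inv\<^sub>C W.move i j b \<in> generate C S"
        using step(5) m ij(1) by simp
      then show ?case using m(1) step(1) by (simp add: C.m_assoc)
    qed
  qed
qed

end

context conj_aut_labels
begin

lemma labelling_ordered_prod:
  assumes "\<And>\<phi> k. \<lbrakk>\<phi> \<in> carrier C; k \<in> set js\<rbrakk> \<Longrightarrow> f (\<phi> \<otimes>\<^sub>C x k) = f \<phi> \<otimes>\<^sub>H y k"
    and "f \<in> carrier C \<rightarrow> carrier H"
    and "\<And>k. k \<in> set js \<Longrightarrow> x k \<in> carrier C" "\<And>k. k \<in> set js \<Longrightarrow> y k \<in> carrier H"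
    and "\<phi> \<in> carrier C"
  shows "f (\<phi> \<otimes>\<^sub>C ordered_prod C x js) = f \<phi> \<otimes>\<^sub>H ordered_prod H y js"
  using assms(1,3,4,5)
proof (induction js arbitrary: \<phi>)
  case Nil
  then show ?case using funcset_mem[OF assms(2)] by simp
next
  case (Cons j js)
  have cl: "x j \<in> carrier C" "y j \<in> carrier H" "f \<phi> \<in> carrier H"
      "ordered_prod C x js \<in> carrier C" "ordered_prod H y js \<in> carrier H"
    using Cons.prems funcset_mem[OF assms(2)] by (auto intro!: C.ordered_prod_closed H.ordered_prod_closed)
  have "f (\<phi> \<otimes>\<^sub>C x j \<otimes>\<^sub>C ordered_prod C x js) = f (\<phi> \<otimes>\<^sub>C x j) \<otimes>\<^sub>H ordered_prod H y js"
    using Cons.prems cl by (intro Cons.IH) auto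
  then show ?case using Cons.prems cl by (simp add: C.m_assoc H.m_assoc)
qed

end

text \<open>
  Passing from generators to words, one letter at a time from the left. The element \<open>\<phi>\<close> has to be
  arbitrary, because the letters already read are absorbed into it.
\<close>

lemma right_factor_free_ext:
  assumes C: "group C" and H: "group H" and f: "f \<in> carrier C \<rightarrow> carrier H"
    and x: "x \<in> X \<rightarrow> carrier C" and y: "y \<in> X \<rightarrow> carrier H"
    and step: "\<And>\<phi> k. \<lbrakk>\<phi> \<in> carrier C; k \<in> X\<rbrakk> \<Longrightarrow> f (\<phi> \<otimes>\<^bsub>C\<^esub> x k) = f \<phi> \<otimes>\<^bsub>H\<^esub> y k"
    and w: "fst ` set w \<subseteq> X" and \<phi>: "\<phi> \<in> carrier C"
  shows "f (\<phi> \<otimes>\<^bsub>C\<^esub> free_ext C x w) = f \<phi> \<otimes>\<^bsub>H\<^esub> free_ext H y w"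
  using w \<phi>
proof (induction w arbitrary: \<phi>)
  interpret C: group C by (rule C)
  interpret H: group H by (rule H)
  {
    case Nil
    then show ?case using funcset_mem[OF f] by (simp add: free_ext_def)
  next
    case (Cons c w)
    obtain k b where c: "c = (k, b)" by (cases c)
    then have k: "k \<in> X" using Cons.prems by simp
    have cl: "x k \<in> carrier C" "y k \<in> carrier H" using x y k by auto
    define u v where "u = (if b then x k else inv\<^bsub>C\<^esub> x k)" and "v = (if b then y k else inv\<^bsub>H\<^esub> y k)"
    have uv: "u \<in> carrier C" "v \<in> carrier H" using cl by (simp_all add: u_def v_def)
    have w: "free_ext C x w \<in> carrier C" "free_ext H y w \<in> carrier H"
      using C.free_ext_closed[OF x] H.free_ext_closed[OF y] Cons.prems by simp_all
    have f\<phi>: "f \<phi> \<in> carrier H" "f (\<phi> \<otimes>\<^bsub>C\<^esub> inv\<^bsub>C\<^esub> x k) \<in> carrier H" using f cl Cons.prems by auto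
    have "f \<phi> = f (\<phi> \<otimes>\<^bsub>C\<^esub> inv\<^bsub>C\<^esub> x k) \<otimes>\<^bsub>H\<^esub> y k"
      using step[of "\<phi> \<otimes>\<^bsub>C\<^esub> inv\<^bsub>C\<^esub> x k" k] cl k Cons.prems by (simp add: C.m_assoc)
    then have "f \<phi> \<otimes>\<^bsub>H\<^esub> inv\<^bsub>H\<^esub> y k = f (\<phi> \<otimes>\<^bsub>C\<^esub> inv\<^bsub>C\<^esub> x k)" using f\<phi> cl by (simp add: H.m_assoc)
    then have fu: "f (\<phi> \<otimes>\<^bsub>C\<^esub> u) = f \<phi> \<otimes>\<^bsub>H\<^esub> v" using step[OF _ k] Cons.prems by (simp add: u_def v_def)
    have "f (\<phi> \<otimes>\<^bsub>C\<^esub> (u \<otimes>\<^bsub>C\<^esub> free_ext C x w)) = f (\<phi> \<otimes>\<^bsub>C\<^esub> u) \<otimes>\<^bsub>H\<^esub> free_ext H y w"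
      using Cons.IH[of "\<phi> \<otimes>\<^bsub>C\<^esub> u"] Cons.prems uv w by (simp add: C.m_assoc)
    also have "\<dots> = f \<phi> \<otimes>\<^bsub>H\<^esub> (v \<otimes>\<^bsub>H\<^esub> free_ext H y w)" using fu f\<phi> uv w by (simp add: H.m_assoc)
    finally have "f (\<phi> \<otimes>\<^bsub>C\<^esub> (u \<otimes>\<^bsub>C\<^esub> free_ext C x w)) = f \<phi> \<otimes>\<^bsub>H\<^esub> (v \<otimes>\<^bsub>H\<^esub> free_ext H y w)" .
    moreover have "free_ext C x (c # w) = u \<otimes>\<^bsub>C\<^esub> free_ext C x w"
      "free_ext H y (c # w) = v \<otimes>\<^bsub>H\<^esub> free_ext H y w"
      by (simp_all add: free_ext_def c u_def v_def)
    ultimately show ?case by simp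
  }
qed

context conj_auts
begin

abbreviation "\<F> \<equiv> free_group (UNIV :: symbol set)"
abbreviation "rels \<equiv> relations \<F> n (gen Alpha1) (gen Alpha) (gen Sigma1) (gen Sigma)"
abbreviation "relators \<equiv> {u \<otimes>\<^bsub>\<F>\<^esub> inv\<^bsub>\<F>\<^esub> v | u v. (u, v) \<in> rels}"

lemma symbol_value_closed: "symbol_value n x \<in> carrier C"
  using n3 by (cases x) simp_all

text \<open>
  Completeness of the relations: a word that is trivial in \<open>C\<^sub>n\<close> lies in every normal subgroup \<open>N\<close>
  that contains the relators. The quotient by \<open>N\<close> satisfies the relations, so the labelling of
  \<open>C\<^sub>n\<close> with values in it exists; evaluating it at the word shows that the coset is trivial.
\<close>

lemma kernel_subset_normal:
  assumes N: "N \<lhd> \<F>" "relators \<subseteq> N"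
    and z: "z \<in> carrier \<F>" "free_ext C (symbol_value n) z = \<one>\<^sub>C"
  shows "z \<in> N"
proof -
  interpret N: normal N \<F> by (rule N(1))
  let ?H = "\<F> Mod N"
  define q where "q w = N #>\<^bsub>\<F>\<^esub> w" for w
  have q: "q \<in> hom \<F> ?H" using N.r_coset_hom_Mod by (simp add: q_def[abs_def])
  have H: "group ?H" by (rule N.factorgroup_is_group)
  interpret q: group_hom \<F> ?H q
    by (intro group_hom.intro group_hom_axioms.intro group_free_group H q)
  have "rels \<subseteq> carrier \<F> \<times> carrier \<F>"
    by (rule relations_closed[OF group_free_group]) simp_all
  then have rels_cl: "u \<in> carrier \<F>" "v \<in> carrier \<F>" if "(u, v) \<in> rels" for u v
    using that by blast+
  have "q u = q v" if uv: "(u, v) \<in> rels" for u v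
  proof -
    note cl = rels_cl[OF uv]
    have "u \<otimes>\<^bsub>\<F>\<^esub> inv\<^bsub>\<F>\<^esub> v \<in> N" using N(2) uv by blast
    then have "q (u \<otimes>\<^bsub>\<F>\<^esub> inv\<^bsub>\<F>\<^esub> v) = \<one>\<^bsub>?H\<^esub>" by (simp add: q_def FactGroup_def N.rcos_const)
    then have "q u \<otimes>\<^bsub>?H\<^esub> inv\<^bsub>?H\<^esub> q v = \<one>\<^bsub>?H\<^esub>" using cl by simp
    then show ?thesis using cl by (metis q.H.inv_closed q.H.inv_equality q.H.inv_inv q.hom_closed)
  qed
  then have rel: "\<forall>(u, v)\<in>relations ?H n (q (gen Alpha1)) (q (gen Alpha)) (q (gen Sigma1)) (q (gen Sigma)). u = v"
    unfolding relations_hom[OF group_free_group H q gen_closed[THEN iffD2, OF UNIV_I]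
      gen_closed[THEN iffD2, OF UNIV_I] gen_closed[THEN iffD2, OF UNIV_I] gen_closed[THEN iffD2, OF UNIV_I]]
    by auto
  have qcl: "q (gen x) \<in> carrier ?H" for x by simp
  define a s where "a i = monoid.twist ?H (inv\<^bsub>?H\<^esub> q (gen Alpha)) (q (gen Alpha1)) (int i - 1)"
    and "s i = monoid.twist ?H (q (gen Sigma)) (q (gen Sigma1)) (int i - 1)" for i
  note w = q.H.relations_welded[OF n3 qcl qcl qcl qcl rel]
  have welded: "welded ?H n a s" and prods: "ordered_prod ?H s [1..<n] = q (gen Sigma)"
      "ordered_prod ?H a [1..<n] = inv\<^bsub>?H\<^esub> q (gen Alpha)" "a 1 = q (gen Alpha1)" "s 1 = q (gen Sigma1)"
    using w by (simp_all add: a_def[abs_def] s_def[abs_def])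
  interpret T: welded ?H n a s by (rule welded)
  interpret L: conj_aut_labels n ?H a s by unfold_locales
  obtain f where f: "f \<in> carrier C \<rightarrow> carrier ?H" "f \<one>\<^sub>C = \<one>\<^bsub>?H\<^esub>"
    and f\<alpha>: "\<And>\<phi> k. \<lbrakk>\<phi> \<in> carrier C; 1 \<le> k; k < n\<rbrakk> \<Longrightarrow> f (\<phi> \<otimes>\<^sub>C \<alpha> k) = f \<phi> \<otimes>\<^bsub>?H\<^esub> a k"
    and f\<sigma>: "\<And>\<phi> k. \<lbrakk>\<phi> \<in> carrier C; 1 \<le> k; k < n\<rbrakk> \<Longrightarrow> f (\<phi> \<otimes>\<^sub>C \<sigma> k) = f \<phi> \<otimes>\<^bsub>?H\<^esub> s k"
    by (rule L.labelling) blast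
  have step: "f (\<phi> \<otimes>\<^sub>C symbol_value n x) = f \<phi> \<otimes>\<^bsub>?H\<^esub> q (gen x)" if \<phi>: "\<phi> \<in> carrier C" for \<phi> x
  proof (cases x)
    case Alpha1
    then show ?thesis using f\<alpha>[OF \<phi>, of 1] n3 prods by simp
  next
    case Sigma1
    then show ?thesis using f\<sigma>[OF \<phi>, of 1] n3 prods by simp
  next
    case Sigma
    have "f (\<phi> \<otimes>\<^sub>C ordered_prod C \<sigma> [1..<n]) = f \<phi> \<otimes>\<^bsub>?H\<^esub> ordered_prod ?H s [1..<n]"
      by (rule L.labelling_ordered_prod[OF _ f(1) _ _ \<phi>]) (simp_all add: f\<sigma>)
    then show ?thesis using Sigma prods by (simp add: sigma_prod)
  next
    case Alpha
    \<comment> \<open>The ascending product of the \<open>\<alpha> k\<close> is the inverse of \<open>alpha n\<close>; so the step from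
      \<open>\<phi>\<close> to \<open>\<phi> (alpha n)\<close> is read backwards.\<close>
    have \<phi>': "\<phi> \<otimes>\<^sub>C alpha n \<in> carrier C" using \<phi> by simp
    have "f (\<phi> \<otimes>\<^sub>C alpha n \<otimes>\<^sub>C ordered_prod C \<alpha> [1..<n]) = f (\<phi> \<otimes>\<^sub>C alpha n) \<otimes>\<^bsub>?H\<^esub> ordered_prod ?H a [1..<n]"
      by (rule L.labelling_ordered_prod[OF _ f(1) _ _ \<phi>']) (simp_all add: f\<alpha>)
    then have "f \<phi> = f (\<phi> \<otimes>\<^sub>C alpha n) \<otimes>\<^bsub>?H\<^esub> inv\<^bsub>?H\<^esub> q (gen Alpha)"
      using \<phi> prods by (simp add: C.m_assoc flip: alpha_prod)
    then have "f (\<phi> \<otimes>\<^sub>C alpha n) = f \<phi> \<otimes>\<^bsub>?H\<^esub> q (gen Alpha)"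
      by (rule iffD1[OF q.H.inv_solve_right[OF funcset_mem[OF f(1) \<phi>] funcset_mem[OF f(1) \<phi>'] qcl]])
    then show ?thesis using Alpha by simp
  qed
  have f_z: "f (\<one>\<^sub>C \<otimes>\<^sub>C free_ext C (symbol_value n) z) = f \<one>\<^sub>C \<otimes>\<^bsub>?H\<^esub> free_ext ?H (\<lambda>x. q (gen x)) z"
    by (rule right_factor_free_ext[OF C.is_group H f(1), of _ UNIV])
      (simp_all add: symbol_value_closed step)
  have "free_ext ?H (\<lambda>x. q (gen x)) z \<in> carrier ?H"
    by (rule q.H.free_ext_closed[of _ UNIV]) (use qcl in auto)
  then have "free_ext ?H (\<lambda>x. q (gen x)) z = f \<one>\<^sub>C \<otimes>\<^bsub>?H\<^esub> free_ext ?H (\<lambda>x. q (gen x)) z"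
    unfolding f(2) by (rule q.H.l_one[symmetric])
  also have "\<dots> = \<one>\<^bsub>?H\<^esub>"
    unfolding f_z[symmetric] z(2) by (simp only: C.r_one C.one_closed f(2))
  finally have "free_ext ?H (\<lambda>x. q (gen x)) z = \<one>\<^bsub>?H\<^esub>" .
  then have "q z = \<one>\<^bsub>?H\<^esub>" using hom_eq_free_ext[OF H q z(1)] by simp
  then show "z \<in> N" using group.rcos_self[OF group_free_group z(1) N.subgroup_axioms]
    by (simp add: q_def FactGroup_def)
qed

theorem presentation: "presented_by C (UNIV :: symbol set) (symbol_value n) rels"
proof -
  let ?h = "free_ext C (symbol_value n)"
  have h: "?h \<in> hom \<F> C" by (rule C.free_ext_hom) (simp add: symbol_value_closed)
  interpret h: group_hom \<F> C ?h
    by (intro group_hom.intro group_hom_axioms.intro group_free_group C.is_group h)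
  have hgen: "?h (gen x) = symbol_value n x" for x
    by (rule free_ext_gen) (simp_all add: symbol_value_closed C.monoid_axioms)
  have rels_cl: "rels \<subseteq> carrier \<F> \<times> carrier \<F>"
    by (rule relations_closed[OF group_free_group]) simp_all
  have "map_prod ?h ?h ` rels = relations C n (\<alpha> 1) (alpha n) (\<sigma> 1) (sigma n)"
    using relations_hom[OF group_free_group C.is_group h, of "gen Alpha1" "gen Alpha" "gen Sigma1" "gen Sigma" n]
    by (simp add: hgen)
  then have rel: "?h u = ?h v" if "(u, v) \<in> rels" for u v
    using relations_C that by (metis (mono_tags, lifting) case_prodD image_eqI map_prod_simp)
  have "relators \<subseteq> kernel \<F> C ?h"
  proof
    fix w assume "w \<in> relators"
    then obtain u v where w: "w = u \<otimes>\<^bsub>\<F>\<^esub> inv\<^bsub>\<F>\<^esub> v" and uv: "(u, v) \<in> rels" by blast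
    then have "u \<in> carrier \<F>" "v \<in> carrier \<F>" using rels_cl by auto
    then show "w \<in> kernel \<F> C ?h" using rel[OF uv] by (simp add: kernel_def w)
  qed
  then have "normal_closure \<F> relators \<subseteq> kernel \<F> C ?h"
    unfolding normal_closure_def using h.normal_kernel by blast
  moreover have "kernel \<F> C ?h \<subseteq> normal_closure \<F> relators"
    unfolding normal_closure_def kernel_def using kernel_subset_normal by blast
  moreover have "generate C (range (symbol_value n)) = carrier C"
  proof (rule generate_C)
    show "range (symbol_value n) \<subseteq> carrier C" using symbol_value_closed by auto
    have "symbol_value n x \<in> generate C (range (symbol_value n))" for x
      by (rule generate.incl) simp
    from this[of Alpha] this[of Alpha1] this[of Sigma] this[of Sigma1]
    show "alpha n \<in> generate C (range (symbol_value n))" "\<alpha> 1 \<in> generate C (range (symbol_value n))"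
      "sigma n \<in> generate C (range (symbol_value n))" "\<sigma> 1 \<in> generate C (range (symbol_value n))" by simp_all
  qed
  ultimately show ?thesis
    unfolding presented_by_def using C.is_group symbol_value_closed rels_cl by auto
qed

end

theorem proposition4p3:
  fixes n :: nat
  assumes "n \<ge> 3"
  shows "presented_by (conj_aut_group n) (UNIV :: symbol set) (symbol_value n)
           (relations (free_group UNIV) n (gen Alpha1) (gen Alpha) (gen Sigma1) (gen Sigma))
       \<and> (\<forall>i\<in>{1..n - 2}.
            sigma_gen n (i + 1) =
              sigma n [^]\<^bsub>conj_aut_group n\<^esub> int i \<otimes>\<^bsub>conj_aut_group n\<^esub> sigma_gen n 1
                \<otimes>\<^bsub>conj_aut_group n\<^esub> sigma n [^]\<^bsub>conj_aut_group n\<^esub> (- int i)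
          \<and> alpha_gen n (i + 1) =
              alpha n [^]\<^bsub>conj_aut_group n\<^esub> (- int i) \<otimes>\<^bsub>conj_aut_group n\<^esub> alpha_gen n 1
                \<otimes>\<^bsub>conj_aut_group n\<^esub> alpha n [^]\<^bsub>conj_aut_group n\<^esub> int i)"
proof -
  interpret conj_auts n by unfold_locales (rule assms)
  show ?thesis
  proof (intro conjI ballI)
    show "presented_by C (UNIV :: symbol set) (symbol_value n) rels" by (rule presentation)
    fix i assume "i \<in> {1..n - 2}"
    then have i: "1 \<le> i + 1" "i + 1 < n" by auto
    show "sigma_gen n (i + 1) = sigma n [^]\<^bsub>C\<^esub> int i \<otimes>\<^bsub>C\<^esub> sigma_gen n 1 \<otimes>\<^bsub>C\<^esub> sigma n [^]\<^bsub>C\<^esub> (- int i)"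
      using recover_\<sigma>[OF i] by (simp add: C.twist_def)
    show "alpha_gen n (i + 1) = alpha n [^]\<^bsub>C\<^esub> (- int i) \<otimes>\<^bsub>C\<^esub> alpha_gen n 1 \<otimes>\<^bsub>C\<^esub> alpha n [^]\<^bsub>C\<^esub> int i"
      using recover_\<alpha>[OF i] by (simp add: C.twist_inv)
  qed
qed

end
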